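(* Let $\mathcal{X},\mathcal{Y}$ be closed convex sets and $f=\frac1n\sum_{i=1}^n f_i:\mathcal{X}\times\mathcal{Y}\to\mathbb{R}$, where each $f_i(\mathbf{x},\mathbf{y})$ is differentiable, convex in $\mathbf{x}$ and concave in $\mathbf{y}$, $\{f_i\}_{i=1}^n$ is $L$-average smooth, and $f$ is $(\mu_x,\mu_y)$-convex-concave with $\mu_x,\mu_y>0$. Put $\kappa_x=L/\mu_x$ and $\kappa_y=L/\mu_y$. Run the algorithm AL-SVRE (defined in the context) from $(\mathbf{x}_0,\mathbf{y}_0)\in\mathcal{X}\times\mathcal{Y}$ with $\beta\ge 0$, $q=\mu_x/(\mu_x+\beta)$, $p=1/(2n)$, $\tau_k=1/(4\sqrt{n}(L+\beta))$ and $$T_k=\left\lceil 4\left(n+\frac{2\sqrt{n}(L+\beta)}{\min\{\mu_x+\beta,\mu_y\}}\right)\log\left(12\left(\frac{2}{1-\rho}+\frac{1728\,\beta(L+\beta)(7(L+\beta)+2\sqrt{n}\mu_y)}{\mu_x\mu_y\min\{\mu_x,\mu_y\}(1-\rho)^2(\sqrt{q}-\rho)^2}\right)\right)\right\rceil,$$ where $0<\rho<\sqrt{q}$. Then for every $k\ge1$ the iterates $(\mathbf{x}_k,\mathbf{y}_k)$ satisfy $$\mathbb{E}\left[\max_{\mathbf{y}\in\mathcal{Y}}f(\mathbf{x}_k,\mathbf{y})-\min_{\mathbf{x}\in\mathcal{X}}f(\mathbf{x},\mathbf{y}_k)\right]\le\frac{916\,\Delta_f\left(\kappa_xL+\sqrt{n}(L+\beta)\right)\kappa_y^2}{\mu_x(\sqrt{q}-\rho)^2}(1-\rho)^k,$$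 where $\Delta_f=\max_{\mathbf{y}\in\mathcal{Y}}f(\mathbf{x}_0,\mathbf{y})-\min_{\mathbf{x}\in\mathcal{X}}f(\mathbf{x},\mathbf{y}_0)$.
   Context: Average smoothness: differentiable functions $\{f_i\}_{i=1}^n$ are $L$-average smooth if $\frac1n\sum_{i=1}^n\|\nabla f_i(\mathbf{z})-\nabla f_i(\mathbf{z}')\|_2^2\le L^2\|\mathbf{z}-\mathbf{z}'\|_2^2$ for all $\mathbf{z},\mathbf{z}'$ in the domain. $f$ is $(\mu_x,\mu_y)$-convex-concave if $f(\cdot,\mathbf{y})$ is $\mu_x$-strongly convex for every $\mathbf{y}$ and $f(\mathbf{x},\cdot)$ is $\mu_y$-strongly concave for every $\mathbf{x}$. $\mathcal{P}_{\mathcal{C}}$ denotes Euclidean projection onto $\mathcal{C}$. Algorithm L-SVRE$(\{h_i\}_{i=1}^n,(\mathbf{x}_0,\mathbf{y}_0),\tau,p,T)$, for $h=\frac1n\sum_i h_i$ on $\mathcal{Z}=\mathcal{X}\times\mathcal{Y}$: let $\mathbf{g}=(\nabla_{\mathbf{x}}h,-\nabla_{\mathbf{y}}h)$, $\mathbf{g}_i=(\nabla_{\mathbf{x}}h_i,-\nabla_{\mathbf{y}}h_i)$, $\alpha=1-p$, $\mathbf{z}_0=\mathbf{w}_0=(\mathbf{x}_0,\mathbf{y}_0)$. For $k=0,\dots,T-1$: $\bar{\mathbf{z}}_k=\alpha\mathbf{z}_k+(1-\alpha)\mathbf{w}_k$; $\mathbf{z}_{k+1/2}=\mathcal{P}_{\mathcal{Z}}(\bar{\mathbf{z}}_k-\tau\mathbf{g}(\mathbf{w}_k))$;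 draw $i\in\{1,\dots,n\}$ uniformly at random; $\mathbf{z}_{k+1}=\mathcal{P}_{\mathcal{Z}}(\bar{\mathbf{z}}_k-\tau[\mathbf{g}(\mathbf{w}_k)+\mathbf{g}_i(\mathbf{z}_{k+1/2})-\mathbf{g}_i(\mathbf{w}_k)])$; $\mathbf{w}_{k+1}=\mathbf{z}_{k+1}$ with probability $p$ and $\mathbf{w}_{k+1}=\mathbf{w}_k$ with probability $1-p$. Output $\mathbf{z}_T$. All random choices are independent. Algorithm AL-SVRE$(\{f_i\}_{i=1}^n,(\mathbf{x}_0,\mathbf{y}_0),\beta,q,K,p,\{\tau_k\}_{k=1}^K,\{T_k\}_{k=1}^K)$: set $\gamma=\frac{1-\sqrt q}{1+\sqrt q}$ and $\mathbf{u}_0=\mathbf{x}_0$. For $k=1,\dots,K$, with $F_k(\mathbf{x},\mathbf{y})=f(\mathbf{x},\mathbf{y})+\frac{\beta}{2}\|\mathbf{x}-\mathbf{u}_{k-1}\|_2^2$: (1) $(\tilde{\mathbf{x}}_k,\tilde{\mathbf{y}}_k)=$ L-SVRE$\big(\{f_i(\mathbf{x},\mathbf{y})+\frac{\beta}{2}\|\mathbf{x}-\mathbf{u}_{k-1}\|_2^2\}_{i=1}^n,(\mathbf{x}_{k-1},\mathbf{y}_{k-1}),\tau_k,p,T_k\big)$; (2) $\mathbf{x}_k=\mathcal{P}_{\mathcal{X}}(\tilde{\mathbf{x}}_k-\tau_k\nabla_{\mathbf{x}}F_k(\tilde{\mathbf{x}}_k,\tilde{\mathbf{y}}_k))$; (3)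 $\mathbf{y}_k=\mathcal{P}_{\mathcal{Y}}(\tilde{\mathbf{y}}_k+\tau_k\nabla_{\mathbf{y}}F_k(\tilde{\mathbf{x}}_k,\tilde{\mathbf{y}}_k))$; (4) $\mathbf{u}_k=\mathbf{x}_k+\gamma(\mathbf{x}_k-\mathbf{x}_{k-1})$. Output $(\mathbf{x}_K,\mathbf{y}_K)$.
   Formalization: The formal theorem also assumes μ_x ≤ L and μ_y ≤ L; for L ≥ 0 these follow when 𝒳 and 𝒴 each have two points, and the bound can fail without them when 𝒳 or 𝒴 is a single point, where strong convexity or concavity is vacuous. *)

theory Defs
  imports "HOL-Analysis.Analysis" "HOL-Probability.Probability"
begin

section \<open>Convexity, gradients and smoothness\<close>

definition strongly_convex_on :: "'a::real_inner set \<Rightarrow> real \<Rightarrow> ('a \<Rightarrow> real) \<Rightarrow> bool" where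
  "strongly_convex_on S \<mu> g \<longleftrightarrow> convex S \<and>
    (\<forall>x\<in>S. \<forall>y\<in>S. \<forall>u\<ge>0. \<forall>v\<ge>0. u + v = 1 \<longrightarrow>
      g (u *\<^sub>R x + v *\<^sub>R y) \<le> u * g x + v * g y - \<mu> / 2 * u * v * (norm (x - y))\<^sup>2)"

definition strongly_concave_on :: "'a::real_inner set \<Rightarrow> real \<Rightarrow> ('a \<Rightarrow> real) \<Rightarrow> bool" where
  "strongly_concave_on S \<mu> g \<longleftrightarrow> strongly_convex_on S \<mu> (\<lambda>x. - g x)"

definition convex_concave_on ::
  "'a::real_inner set \<Rightarrow> 'b::real_inner set \<Rightarrow> real \<Rightarrow> real \<Rightarrow> ('a \<times> 'b \<Rightarrow> real) \<Rightarrow> bool" where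
  "convex_concave_on X Y \<mu>x \<mu>y f \<longleftrightarrow>
    (\<forall>y\<in>Y. strongly_convex_on X \<mu>x (\<lambda>x. f (x, y))) \<and>
    (\<forall>x\<in>X. strongly_concave_on Y \<mu>y (\<lambda>y. f (x, y)))"

text \<open>
  The derivative is taken within \<open>Z\<close>, so a function need only be given on \<open>Z\<close>, and boundary points
  are covered. If \<open>Z\<close> is convex with nonempty interior, the gradient on \<open>Z\<close> is unique. Otherwise
  any choice is allowed; two choices differ by vectors orthogonal to the affine hull of \<open>Z\<close>,
  which the projection onto \<open>Z\<close> does not see.
\<close>

definition has_gradient_on :: "('a::real_inner \<Rightarrow> real) \<Rightarrow> ('a \<Rightarrow> 'a) \<Rightarrow> 'a set \<Rightarrow> bool" where
  "has_gradient_on h G Z \<longleftrightarrow> (\<forall>z\<in>Z. (h has_derivative (\<lambda>v. v \<bullet> G z)) (at z within Z))"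

definition average :: "nat \<Rightarrow> (nat \<Rightarrow> 'z \<Rightarrow> 'v::real_vector) \<Rightarrow> 'z \<Rightarrow> 'v" where
  "average n F z = (\<Sum>i = 1..n. F i z) /\<^sub>R real n"

definition average_smooth_on ::
  "'a::real_inner set \<Rightarrow> nat \<Rightarrow> real \<Rightarrow> (nat \<Rightarrow> 'a \<Rightarrow> 'a) \<Rightarrow> bool" where
  "average_smooth_on Z n L G \<longleftrightarrow>
    (\<forall>z\<in>Z. \<forall>z'\<in>Z. (\<Sum>i = 1..n. (norm (G i z - G i z'))\<^sup>2) / real n \<le> L\<^sup>2 * (norm (z - z'))\<^sup>2)"

text \<open>
  For a differentiable strongly-convex-strongly-concave \<open>f\<close> and closed \<open>X\<close>, \<open>Y\<close>, the supremum and
  the infimum are attained (lemmas \<open>SUP_is_max\<close> and \<open>INF_is_min\<close> below), so they are the maximum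
  and the minimum.
\<close>

definition duality_gap :: "'a set \<Rightarrow> 'b set \<Rightarrow> ('a \<times> 'b \<Rightarrow> real) \<Rightarrow> 'a \<times> 'b \<Rightarrow> real" where
  "duality_gap X Y f z = (SUP y\<in>Y. f (fst z, y)) - (INF x\<in>X. f (x, snd z))"

section \<open>L-SVRE\<close>

text \<open>
  The algorithms access their input functions \<open>h\<^sub>1, \<dots>, h\<^sub>n\<close> only through the gradients
  \<open>H i = (\<nabla>\<^sub>x h\<^sub>i, \<nabla>\<^sub>y h\<^sub>i)\<close>, so they are given these gradients. The gradient of
  \<open>h = (h\<^sub>1 + \<dots> + h\<^sub>n) / n\<close> is then \<open>average n H\<close>.
\<close>

definition saddle_op :: "('z \<Rightarrow> 'a \<times> 'b::real_vector) \<Rightarrow> 'z \<Rightarrow> 'a \<times> 'b" where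
  "saddle_op H z = (fst (H z), - snd (H z))"

text \<open>One iteration, on states \<open>(z\<^sub>k, w\<^sub>k)\<close>.\<close>

definition lsvre_step ::
  "('a::euclidean_space \<times> 'b::euclidean_space) set \<Rightarrow> nat \<Rightarrow> (nat \<Rightarrow> 'a \<times> 'b \<Rightarrow> 'a \<times> 'b) \<Rightarrow>
    real \<Rightarrow> real \<Rightarrow> ('a \<times> 'b) \<times> ('a \<times> 'b) \<Rightarrow> (('a \<times> 'b) \<times> ('a \<times> 'b)) pmf" where
  "lsvre_step Z n H \<tau> p s =
    (let z = fst s; w = snd s; \<alpha> = 1 - p;
         g = saddle_op (average n H);
         zbar = \<alpha> *\<^sub>R z + (1 - \<alpha>) *\<^sub>R w;
         zhalf = closest_point Z (zbar - \<tau> *\<^sub>R g w)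
     in do {
       i \<leftarrow> pmf_of_set {1..n};
       let z' = closest_point Z
             (zbar - \<tau> *\<^sub>R (g w + saddle_op (H i) zhalf - saddle_op (H i) w));
       b \<leftarrow> bernoulli_pmf p;
       return_pmf (z', if b then z' else w)
     })"

primrec lsvre_state ::
  "('a::euclidean_space \<times> 'b::euclidean_space) set \<Rightarrow> nat \<Rightarrow> (nat \<Rightarrow> 'a \<times> 'b \<Rightarrow> 'a \<times> 'b) \<Rightarrow>
    'a \<times> 'b \<Rightarrow> real \<Rightarrow> real \<Rightarrow> nat \<Rightarrow> (('a \<times> 'b) \<times> ('a \<times> 'b)) pmf" where
  "lsvre_state Z n H z0 \<tau> p 0 = return_pmf (z0, z0)"
| "lsvre_state Z n H z0 \<tau> p (Suc k) = lsvre_state Z n H z0 \<tau> p k \<bind> lsvre_step Z n H \<tau> p"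

definition lsvre ::
  "('a::euclidean_space \<times> 'b::euclidean_space) set \<Rightarrow> nat \<Rightarrow> (nat \<Rightarrow> 'a \<times> 'b \<Rightarrow> 'a \<times> 'b) \<Rightarrow>
    'a \<times> 'b \<Rightarrow> real \<Rightarrow> real \<Rightarrow> nat \<Rightarrow> ('a \<times> 'b) pmf" where
  "lsvre Z n H z0 \<tau> p T = map_pmf fst (lsvre_state Z n H z0 \<tau> p T)"

section \<open>AL-SVRE\<close>

definition prox_fun ::
  "real \<Rightarrow> 'a::real_inner \<Rightarrow> ('a \<times> 'b \<Rightarrow> real) \<Rightarrow> 'a \<times> 'b \<Rightarrow> real" where
  "prox_fun \<beta> u h z = h z + \<beta> / 2 * (norm (fst z - u))\<^sup>2"

text \<open>
  The gradient of \<open>prox_fun \<beta> u h\<close> when \<open>H\<close> is the gradient of \<open>h\<close>; see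
  \<open>has_gradient_on_prox\<close> below.
\<close>

definition prox_grad ::
  "real \<Rightarrow> 'a::real_inner \<Rightarrow> ('a \<times> 'b \<Rightarrow> 'a \<times> 'b) \<Rightarrow> 'a \<times> 'b \<Rightarrow> 'a \<times> 'b" where
  "prox_grad \<beta> u H z = (fst (H z) + \<beta> *\<^sub>R (fst z - u), snd (H z))"

text \<open>One outer iteration, on states \<open>(x\<^sub>k, y\<^sub>k, u\<^sub>k)\<close>.\<close>

definition alsvre_step ::
  "'a::euclidean_space set \<Rightarrow> 'b::euclidean_space set \<Rightarrow> nat \<Rightarrow> (nat \<Rightarrow> 'a \<times> 'b \<Rightarrow> 'a \<times> 'b) \<Rightarrow>
    real \<Rightarrow> real \<Rightarrow> real \<Rightarrow> real \<Rightarrow> nat \<Rightarrow> 'a \<times> 'b \<times> 'a \<Rightarrow> ('a \<times> 'b \<times> 'a) pmf" where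
  "alsvre_step X Y n G \<beta> q p \<tau> T s =
    (let x = fst s; y = fst (snd s); u = snd (snd s);
         \<gamma> = (1 - sqrt q) / (1 + sqrt q);
         gradF = prox_grad \<beta> u (average n G)
     in do {
       zt \<leftarrow> lsvre (X \<times> Y) n (\<lambda>i. prox_grad \<beta> u (G i)) (x, y) \<tau> p T;
       let x' = closest_point X (fst zt - \<tau> *\<^sub>R fst (gradF zt));
       let y' = closest_point Y (snd zt + \<tau> *\<^sub>R snd (gradF zt));
       return_pmf (x', y', x' + \<gamma> *\<^sub>R (x' - x))
     })"

primrec alsvre_state ::
  "'a::euclidean_space set \<Rightarrow> 'b::euclidean_space set \<Rightarrow> nat \<Rightarrow> (nat \<Rightarrow> 'a \<times> 'b \<Rightarrow> 'a \<times> 'b) \<Rightarrow>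
    'a \<times> 'b \<Rightarrow> real \<Rightarrow> real \<Rightarrow> real \<Rightarrow> (nat \<Rightarrow> real) \<Rightarrow> (nat \<Rightarrow> nat) \<Rightarrow> nat \<Rightarrow>
    ('a \<times> 'b \<times> 'a) pmf" where
  "alsvre_state X Y n G z0 \<beta> q p \<tau> T 0 = return_pmf (fst z0, snd z0, fst z0)"
| "alsvre_state X Y n G z0 \<beta> q p \<tau> T (Suc k) =
    alsvre_state X Y n G z0 \<beta> q p \<tau> T k \<bind> alsvre_step X Y n G \<beta> q p (\<tau> (Suc k)) (T (Suc k))"

text \<open>
  The joint distribution of the iterate \<open>(x\<^sub>k, y\<^sub>k)\<close>. It does not depend on the total number
  \<open>K \<ge> k\<close> of outer iterations, and the output for \<open>K\<close> outer iterations is the case \<open>k = K\<close>.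
\<close>

definition alsvre ::
  "'a::euclidean_space set \<Rightarrow> 'b::euclidean_space set \<Rightarrow> nat \<Rightarrow> (nat \<Rightarrow> 'a \<times> 'b \<Rightarrow> 'a \<times> 'b) \<Rightarrow>
    'a \<times> 'b \<Rightarrow> real \<Rightarrow> real \<Rightarrow> real \<Rightarrow> (nat \<Rightarrow> real) \<Rightarrow> (nat \<Rightarrow> nat) \<Rightarrow> nat \<Rightarrow> ('a \<times> 'b) pmf" where
  "alsvre X Y n G z0 \<beta> q p \<tau> T k =
    map_pmf (\<lambda>(x, y, u). (x, y)) (alsvre_state X Y n G z0 \<beta> q p \<tau> T k)"

section \<open>Basic properties\<close>

lemma has_gradient_on_average:
  assumes "\<And>i. i \<in> {1..n} \<Longrightarrow> has_gradient_on (h i) (H i) Z"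
  shows "has_gradient_on (average n h) (average n H) Z"
  unfolding has_gradient_on_def average_def
proof
  fix z assume z: "z \<in> Z"
  have "((\<lambda>z. \<Sum>i = 1..n. h i z) has_derivative (\<lambda>v. \<Sum>i = 1..n. v \<bullet> H i z)) (at z within Z)"
    using assms z by (intro has_derivative_sum) (auto simp: has_gradient_on_def)
  then have "((\<lambda>z. (\<Sum>i = 1..n. h i z) /\<^sub>R real n) has_derivative
      (\<lambda>v. (\<Sum>i = 1..n. v \<bullet> H i z) /\<^sub>R real n)) (at z within Z)"
    by (rule has_derivative_scaleR_right)
  then show "((\<lambda>z. (\<Sum>i = 1..n. h i z) /\<^sub>R real n) has_derivative
      (\<lambda>v. v \<bullet> ((\<Sum>i = 1..n. H i z) /\<^sub>R real n))) (at z within Z)"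
    by (simp add: inner_sum_right)
qed

lemma has_gradient_on_prox:
  fixes h :: "'a::real_inner \<times> 'b::real_inner \<Rightarrow> real"
  assumes "has_gradient_on h H Z"
  shows "has_gradient_on (prox_fun \<beta> u h) (prox_grad \<beta> u H) Z"
  unfolding has_gradient_on_def
proof
  fix z assume "z \<in> Z"
  then have h: "(h has_derivative (\<lambda>v. v \<bullet> H z)) (at z within Z)"
    using assms by (auto simp: has_gradient_on_def)
  have "((\<lambda>z. h z + \<beta> / 2 * ((fst z - u) \<bullet> (fst z - u))) has_derivative
      (\<lambda>v. v \<bullet> H z + \<beta> / 2 * ((fst z - u) \<bullet> fst v + fst v \<bullet> (fst z - u)))) (at z within Z)"
    by (auto intro!: derivative_eq_intros h)
  moreover have "(\<lambda>v. v \<bullet> H z + \<beta> / 2 * ((fst z - u) \<bullet> fst v + fst v \<bullet> (fst z - u))) =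
      (\<lambda>v. v \<bullet> prox_grad \<beta> u H z)"
    by (auto simp: prox_grad_def inner_prod_def inner_commute algebra_simps)
  ultimately show "(prox_fun \<beta> u h has_derivative (\<lambda>v. v \<bullet> prox_grad \<beta> u H z)) (at z within Z)"
    by (simp add: prox_fun_def[abs_def] power2_norm_eq_inner)
qed

lemma strongly_convex_on_gradient:
  assumes sc: "strongly_convex_on S \<mu> g" and d: "(g has_derivative g') (at x within S)"
    and x: "x \<in> S" and y: "y \<in> S"
  shows "g y \<ge> g x + g' (y - x) + \<mu> / 2 * (norm (y - x))\<^sup>2"
proof -
  have S: "convex S" using sc by (simp add: strongly_convex_on_def)
  let ?l = "\<lambda>t. x + t *\<^sub>R (y - x)"
  have l: "?l t = (1 - t) *\<^sub>R x + t *\<^sub>R y" for t by (simp add: algebra_simps)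
  have sub: "?l ` {0..1} \<subseteq> S"
    unfolding l using S x y by (auto simp: convex_def)
  have "(g \<circ> ?l has_derivative g' \<circ> (\<lambda>t. t *\<^sub>R (y - x))) (at 0 within {0..1})"
    by (rule diff_chain_within)
      (auto intro!: derivative_eq_intros has_derivative_subset[OF _ sub] d)
  then have "((\<lambda>t. g (?l t)) has_derivative (\<lambda>t. t * g' (y - x))) (at 0 within {0..1})"
    using has_derivative_linear[OF d] by (simp add: comp_def linear_cmul)
  then have "((\<lambda>t. g (?l t)) has_real_derivative g' (y - x)) (at 0 within {0..1})"
    by (simp add: has_field_derivative_def mult.commute[of _ "g' (y - x)"])
  then have lim: "((\<lambda>t. (g (?l t) - g x) / t) \<longlongrightarrow> g' (y - x)) (at 0 within {0..1})"
    by (simp add: has_field_derivative_iff)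
  have lim2: "((\<lambda>t. g y - g x - \<mu> / 2 * (1 - t) * (norm (y - x))\<^sup>2)
      \<longlongrightarrow> g y - g x - \<mu> / 2 * (1 - 0) * (norm (y - x))\<^sup>2) (at (0::real) within {0..1})"
    by (intro tendsto_intros)
  have le: "(g (?l t) - g x) / t \<le> g y - g x - \<mu> / 2 * (1 - t) * (norm (y - x))\<^sup>2"
    if t: "t \<in> {0..1}" "t \<noteq> 0" for t
  proof -
    have "g (?l t) \<le> (1 - t) * g x + t * g y - \<mu> / 2 * (1 - t) * t * (norm (x - y))\<^sup>2"
      unfolding l using sc x y t unfolding strongly_convex_on_def by auto
    then have "g (?l t) - g x \<le> (g y - g x - \<mu> / 2 * (1 - t) * (norm (y - x))\<^sup>2) * t"
      by (simp add: algebra_simps norm_minus_commute)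
    then show ?thesis using t by (simp add: pos_divide_le_eq)
  qed
  have "(0::real) islimpt {0..1}" by (simp add: islimpt_Icc)
  then have nt: "at (0::real) within {0..1} \<noteq> bot" by (simp add: trivial_limit_within)
  have "g' (y - x) \<le> g y - g x - \<mu> / 2 * (1 - 0) * (norm (y - x))\<^sup>2"
    by (rule tendsto_le[OF nt lim2 lim]) (use le in \<open>auto simp: eventually_at_filter\<close>)
  then show ?thesis by simp
qed

lemma strongly_convex_on_attains_min:
  fixes g :: "'a::euclidean_space \<Rightarrow> real"
  assumes sc: "strongly_convex_on S \<mu> g" and \<mu>: "\<mu> > 0" and S: "closed S" "S \<noteq> {}"
    and d: "\<And>x. x \<in> S \<Longrightarrow> (g has_derivative D x) (at x within S)"
  shows "\<exists>x\<in>S. \<forall>y\<in>S. g x \<le> g y"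
proof -
  obtain x0 where x0: "x0 \<in> S" using S by auto
  obtain K where K: "norm (D x0 v) \<le> norm v * K" for v
    using has_derivative_bounded_linear[OF d[OF x0]] bounded_linear.bounded by blast
  let ?S = "S \<inter> cball x0 (2 * \<bar>K\<bar> / \<mu>)"
  have cont: "continuous_on ?S g"
    by (rule continuous_on_subset[of S])
      (auto simp: continuous_on_eq_continuous_within intro!: has_derivative_continuous d)
  have x0': "x0 \<in> ?S" using x0 \<mu> by simp
  have "compact ?S" using S by (simp add: closed_Int_compact)
  then obtain x where x: "x \<in> ?S" "\<forall>y\<in>?S. g x \<le> g y"
    using continuous_attains_inf[OF _ _ cont] x0' by blast
  have "g x \<le> g y" if y: "y \<in> S" for y
  proof (cases "y \<in> ?S")
    case True then show ?thesis using x by blast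
  next
    case False
    define r where "r = norm (y - x0)"
    have r: "2 * \<bar>K\<bar> / \<mu> < r" using False y by (simp add: r_def dist_norm norm_minus_commute)
    have "- (r * \<bar>K\<bar>) \<le> D x0 (y - x0)"
    proof -
      have "r * K \<le> r * \<bar>K\<bar>" by (simp add: r_def mult_left_mono)
      then show ?thesis using K[of "y - x0"] by (auto simp: r_def)
    qed
    moreover have "g y \<ge> g x0 + D x0 (y - x0) + \<mu> / 2 * r\<^sup>2"
      unfolding r_def by (rule strongly_convex_on_gradient[OF sc d[OF x0] x0 y])
    moreover have "r * \<bar>K\<bar> \<le> \<mu> / 2 * r\<^sup>2"
    proof -
      have "\<bar>K\<bar> \<le> \<mu> / 2 * r" using r \<mu> by (simp add: field_simps)
      then have "r * \<bar>K\<bar> \<le> r * (\<mu> / 2 * r)" by (rule mult_left_mono) (simp add: r_def)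
      then show ?thesis by (simp add: power2_eq_square algebra_simps)
    qed
    moreover have "g x \<le> g x0" using x x0' by blast
    ultimately show ?thesis by linarith
  qed
  then show ?thesis using x by blast
qed

lemma partial_derivative_fst:
  assumes "has_gradient_on f G (X \<times> Y)" "x \<in> X" "y \<in> Y"
  shows "((\<lambda>x. f (x, y)) has_derivative (\<lambda>v. v \<bullet> fst (G (x, y)))) (at x within X)"
proof -
  have "(f has_derivative (\<lambda>v. v \<bullet> G (x, y))) (at (x, y) within (\<lambda>x. (x, y)) ` X)"
    using assms by (auto simp: has_gradient_on_def intro: has_derivative_subset)
  then have "(f \<circ> (\<lambda>x. (x, y)) has_derivative (\<lambda>v. v \<bullet> G (x, y)) \<circ> (\<lambda>v. (v, 0))) (at x within X)"
    by (intro diff_chain_within) (auto intro!: derivative_eq_intros)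
  then show ?thesis by (simp add: comp_def inner_prod_def)
qed

lemma partial_derivative_snd:
  assumes "has_gradient_on f G (X \<times> Y)" "x \<in> X" "y \<in> Y"
  shows "((\<lambda>y. f (x, y)) has_derivative (\<lambda>v. v \<bullet> snd (G (x, y)))) (at y within Y)"
proof -
  have "(f has_derivative (\<lambda>v. v \<bullet> G (x, y))) (at (x, y) within (\<lambda>y. (x, y)) ` Y)"
    using assms by (auto simp: has_gradient_on_def intro: has_derivative_subset)
  then have "(f \<circ> (\<lambda>y. (x, y)) has_derivative (\<lambda>v. v \<bullet> G (x, y)) \<circ> (\<lambda>v. (0, v))) (at y within Y)"
    by (intro diff_chain_within) (auto intro!: derivative_eq_intros)
  then show ?thesis by (simp add: comp_def inner_prod_def)
qed

lemma INF_is_min: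
  fixes f :: "'a::euclidean_space \<times> 'b::euclidean_space \<Rightarrow> real"
  assumes "convex_concave_on X Y \<mu>x \<mu>y f" "\<mu>x > 0" "closed X" "X \<noteq> {}"
    "has_gradient_on f G (X \<times> Y)" "y \<in> Y"
  obtains x where "x \<in> X" "\<And>x'. x' \<in> X \<Longrightarrow> f (x, y) \<le> f (x', y)"
    "(INF x'\<in>X. f (x', y)) = f (x, y)"
proof -
  have "strongly_convex_on X \<mu>x (\<lambda>x. f (x, y))"
    using assms by (simp add: convex_concave_on_def)
  from strongly_convex_on_attains_min[OF this assms(2-4) partial_derivative_fst[OF assms(5) _ assms(6)]]
  obtain x where x: "x \<in> X" "\<forall>x'\<in>X. f (x, y) \<le> f (x', y)"
    by blast
  then have "(INF x'\<in>X. f (x', y)) = f (x, y)" by (intro cInf_eq_minimum) auto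
  with x that show thesis by blast
qed

lemma SUP_is_max:
  fixes f :: "'a::euclidean_space \<times> 'b::euclidean_space \<Rightarrow> real"
  assumes "convex_concave_on X Y \<mu>x \<mu>y f" "\<mu>y > 0" "closed Y" "Y \<noteq> {}"
    "has_gradient_on f G (X \<times> Y)" "x \<in> X"
  obtains y where "y \<in> Y" "\<And>y'. y' \<in> Y \<Longrightarrow> f (x, y') \<le> f (x, y)"
    "(SUP y'\<in>Y. f (x, y')) = f (x, y)"
proof -
  have "strongly_convex_on Y \<mu>y (\<lambda>y. - f (x, y))"
    using assms by (simp add: convex_concave_on_def strongly_concave_on_def)
  from strongly_convex_on_attains_min[OF this assms(2-4)
      has_derivative_minus[OF partial_derivative_snd[OF assms(5,6)]]]
  obtain y where y: "y \<in> Y" "\<forall>y'\<in>Y. - f (x, y) \<le> - f (x, y')"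
    by blast
  then have "(SUP y'\<in>Y. f (x, y')) = f (x, y)" by (intro cSup_eq_maximum) auto
  with y that show thesis by auto
qed

lemma average_smooth_on_lipschitz:
  fixes G :: "nat \<Rightarrow> 'a::real_inner \<Rightarrow> 'a"
  assumes sm: "average_smooth_on Z n L G" and n: "n \<ge> 1" and L: "L \<ge> 0" and z: "z \<in> Z" "z' \<in> Z"
  shows "norm (average n G z - average n G z') \<le> L * norm (z - z')"
proof -
  let ?d = "\<lambda>i. norm (G i z - G i z')"
  have "norm (average n G z - average n G z') = norm (\<Sum>i = 1..n. G i z - G i z') / real n"
    by (simp add: average_def sum_subtractf divide_inverse flip: scaleR_diff_right)
  also have "\<dots> \<le> (\<Sum>i = 1..n. ?d i) / real n"
    by (intro divide_right_mono norm_sum) auto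
  finally have "(norm (average n G z - average n G z'))\<^sup>2 \<le> ((\<Sum>i = 1..n. ?d i) / real n)\<^sup>2"
    by (intro power_mono) auto
  also have "\<dots> \<le> (real n * (\<Sum>i = 1..n. (?d i)\<^sup>2)) / (real n)\<^sup>2"
    using sum_squared_le_sum_of_squares[of ?d "{1..n}"]
    by (auto simp: power_divide mult.commute intro!: divide_right_mono)
  also have "\<dots> = (\<Sum>i = 1..n. (?d i)\<^sup>2) / real n" using n by (simp add: power2_eq_square)
  also have "\<dots> \<le> (L * norm (z - z'))\<^sup>2"
    using sm z by (simp add: average_smooth_on_def power_mult_distrib)
  finally show ?thesis by (rule power2_le_imp_le) (simp add: L)
qed

text \<open>
  If \<open>X\<close> has two distinct points, smoothness forces \<open>\<mu>x \<le> L\<close>; likewise for \<open>Y\<close> and \<open>\<mu>y\<close>. If \<open>X\<close> is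
  a single point, every function on it is \<open>\<mu>x\<close>-strongly convex for every \<open>\<mu>x\<close>, so \<open>\<mu>x\<close> and \<open>L\<close> are
  unrelated.
\<close>

lemma strong_convexity_le_smoothness:
  fixes X :: "'a::euclidean_space set" and Y :: "'b::euclidean_space set"
  assumes cc: "convex_concave_on X Y \<mu>x \<mu>y (average n f)" and n: "n \<ge> 1" and L: "L \<ge> 0"
    and gr: "\<And>i. i \<in> {1..n} \<Longrightarrow> has_gradient_on (f i) (G i) (X \<times> Y)"
    and sm: "average_smooth_on (X \<times> Y) n L G"
    and xy: "x \<in> X" "x' \<in> X" "x \<noteq> x'" "y \<in> Y"
  shows "\<mu>x \<le> L"
proof -
  let ?g = "\<lambda>x. fst (average n G (x, y))"
  have gr': "has_gradient_on (average n f) (average n G) (X \<times> Y)"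
    by (rule has_gradient_on_average[OF gr])
  have sc: "strongly_convex_on X \<mu>x (\<lambda>x. average n f (x, y))"
    using cc xy by (simp add: convex_concave_on_def)
  have fo: "average n f (b, y) \<ge> average n f (a, y) + (b - a) \<bullet> ?g a + \<mu>x / 2 * (norm (b - a))\<^sup>2"
    if "a \<in> X" "b \<in> X" for a b
    using strongly_convex_on_gradient[OF sc partial_derivative_fst[OF gr' that(1) xy(4)] that] .
  have "\<mu>x * (norm (x - x'))\<^sup>2 \<le> (x - x') \<bullet> (?g x - ?g x')"
    using fo[of x x'] fo[of x' x] xy
    by (simp add: inner_diff_left inner_diff_right norm_minus_commute[of x' x])
  also have "\<dots> \<le> norm (x - x') * norm (?g x - ?g x')" by (rule norm_cauchy_schwarz)
  also have "\<dots> \<le> norm (x - x') * norm (average n G (x, y) - average n G (x', y))"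
    by (intro mult_left_mono) (simp_all add: norm_fst_le[of "fst z" "snd z" for z, unfolded prod.collapse] flip: fst_diff)
  also have "\<dots> \<le> norm (x - x') * (L * norm ((x, y) - (x', y)))"
    by (intro mult_left_mono average_smooth_on_lipschitz[OF sm n L]) (use xy in auto)
  also have "\<dots> = L * (norm (x - x'))\<^sup>2" by (simp add: norm_Pair power2_eq_square)
  finally show ?thesis using xy by simp
qed

lemma strong_concavity_le_smoothness:
  fixes X :: "'a::euclidean_space set" and Y :: "'b::euclidean_space set"
  assumes cc: "convex_concave_on X Y \<mu>x \<mu>y (average n f)" and n: "n \<ge> 1" and L: "L \<ge> 0"
    and gr: "\<And>i. i \<in> {1..n} \<Longrightarrow> has_gradient_on (f i) (G i) (X \<times> Y)"
    and sm: "average_smooth_on (X \<times> Y) n L G"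
    and xy: "y \<in> Y" "y' \<in> Y" "y \<noteq> y'" "x \<in> X"
  shows "\<mu>y \<le> L"
proof -
  let ?g = "\<lambda>y. snd (average n G (x, y))"
  have gr': "has_gradient_on (average n f) (average n G) (X \<times> Y)"
    by (rule has_gradient_on_average[OF gr])
  have sc: "strongly_convex_on Y \<mu>y (\<lambda>y. - average n f (x, y))"
    using cc xy by (simp add: convex_concave_on_def strongly_concave_on_def)
  have fo: "- average n f (x, b) \<ge> - average n f (x, a) + - ((b - a) \<bullet> ?g a) + \<mu>y / 2 * (norm (b - a))\<^sup>2"
    if "a \<in> Y" "b \<in> Y" for a b
    using strongly_convex_on_gradient[OF sc
        has_derivative_minus[OF partial_derivative_snd[OF gr' xy(4) that(1)]] that] .
  have "\<mu>y * (norm (y - y'))\<^sup>2 \<le> (y - y') \<bullet> (?g y' - ?g y)"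
    using fo[of y y'] fo[of y' y] xy
    by (simp add: inner_diff_left inner_diff_right norm_minus_commute[of y' y])
  also have "\<dots> \<le> norm (y - y') * norm (?g y' - ?g y)" by (rule norm_cauchy_schwarz)
  also have "\<dots> \<le> norm (y - y') * norm (average n G (x, y') - average n G (x, y))"
    by (intro mult_left_mono) (simp_all add: norm_snd_le[of "snd z" "fst z" for z, unfolded prod.collapse] flip: snd_diff)
  also have "\<dots> \<le> norm (y - y') * (L * norm ((x, y') - (x, y)))"
    by (intro mult_left_mono average_smooth_on_lipschitz[OF sm n L]) (use xy in auto)
  also have "\<dots> = L * (norm (y - y'))\<^sup>2"
    by (simp add: norm_Pair power2_eq_square norm_minus_commute[of y' y])
  finally show ?thesis using xy by simp
qed

text \<open>The iterates take finitely many values, so expectations over them are finite sums.\<close>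

lemma finite_set_alsvre:
  assumes "n \<ge> 1"
  shows "finite (set_pmf (alsvre X Y n G z0 \<beta> q p \<tau> T k))"
proof -
  have step: "finite (set_pmf (lsvre_step Z n H t p s))"
    for Z :: "('a \<times> 'b) set" and H t s
    using assms by (auto simp: lsvre_step_def Let_def set_bind_pmf)
  have inner: "finite (set_pmf (lsvre_state Z n H z t p m))"
    for Z :: "('a \<times> 'b) set" and H z t m
    by (induction m) (auto simp: step)
  have "finite (set_pmf (alsvre_step X Y n G \<beta> q p t m s))" for t m s
    by (auto simp: alsvre_step_def lsvre_def Let_def inner)
  then have "finite (set_pmf (alsvre_state X Y n G z0 \<beta> q p \<tau> T k))"
    by (induction k) auto
  then show ?thesis by (simp add: alsvre_def)
qed

end

theory Submission
  imports Defs
begin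

text \<open>
  AL-SVRE is an inexact accelerated proximal point method for the primal function
  \<open>\<phi> x = max\<^sub>y f (x, y)\<close>. L-SVRE contracts the expected squared distance to the saddle point of a
  strongly monotone problem linearly, and \<open>T\<^sub>k\<close> is chosen such that one run divides it by \<open>4 M\<close>, where
  \<open>M\<close> is the quantity multiplied by 12 under the logarithm. The final projected gradient step turns
  this squared distance into a bound on the primal gap of the proximal subproblem.

  Two potentials are followed in expectation: an accelerated potential for \<open>\<phi>\<close>, and the squared
  distance of the warm start to the saddle point of the next subproblem. Errors enter the accelerated
  potential through Young's inequality with weight \<open>(\<theta> - \<rho>) / (2 (1 - \<rho>))\<close>, where \<open>\<theta> = sqrt q\<close>. The recursion
  is then linear, so no square roots of expectations occur, and the potentials decay
  like \<open>(1 - \<rho>)\<^sup>k\<close>. If \<open>\<beta>\<close> is much smaller than \<open>\<mu>\<^sub>x\<close>, the first inner error can be too large for this argument,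
  but then a proximal step nearly jumps to the solution, and squared distances to the
  saddle point contract without acceleration.
\<close>

subsection \<open>Projections and variational inequalities\<close>

text \<open>Under constraints the gradient at a solution need not vanish, so the value of an inner
  result can be off by a first-order term. After the projected step only second-order terms remain,
  hence a bound linear in the squared distance that L-SVRE contracts. The dual gap needs no
  accelerated sequence of its own: the proximal term does not involve \<open>y\<close>, so the final
  ascent step is also a step for \<open>f\<close> itself, and its loss is bounded by squared
  distances to the saddle point of \<open>f\<close>. The accelerated potential controls these at the
  price of \<open>(L / \<mu>y)\<^sup>2\<close>. The two potentials feed each other: inner errors
  enter the accelerated one, which in turn bounds how far the target moves with the centre
  \<open>u\<close>. In \<open>M\<close>, the summand \<open>2 / (1 - \<rho>)\<close> damps the old
  warm-start error, and the fraction pays for the motion of the target. That motion is proportional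
  to \<beta>, and so is the fraction; for tiny \<beta> it cannot also outweigh the constant
  \<open>C\<close> with which the first inner error enters. The regimes are separated at
  \<open>72 * \<beta> = \<mu>x\<close>.\<close>

lemma closest_point_vi:
  fixes a :: "'a::euclidean_space"
  assumes "closed S" "convex S" "z \<in> S"
  shows "0 \<le> (closest_point S a - a) \<bullet> (z - closest_point S a)"
proof -
  have "(a - closest_point S a) \<bullet> (z - closest_point S a) \<le> 0"
    by (rule closest_point_dot) (use assms in auto)
  then show ?thesis by (simp add: inner_diff_left)
qed

lemma norm_diff_scaleR_sq:
  fixes a b :: "'a::real_inner"
  shows "(norm (a - c *\<^sub>R b))\<^sup>2 = (norm a)\<^sup>2 - 2 * c * (b \<bullet> a) + c\<^sup>2 * (norm b)\<^sup>2"
  unfolding power2_norm_eq_inner by (simp add: algebra_simps inner_commute power2_eq_square)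

text \<open>The solution \<open>zs\<close> satisfies the inequality of its own projected step, so
  the comparison works like nonexpansiveness of the projection: \<open>p - zs\<close> is no longer
  than \<open>(z - zs) - \<tau> (g - gs)\<close>. Monotonicity drops the cross term of the
  square.\<close>

lemma projection_step_dist:
  fixes z zs p :: "'a::real_inner"
  assumes p: "0 \<le> (p - (z - \<tau> *\<^sub>R g)) \<bullet> (zs - p)" and zs: "0 \<le> gs \<bullet> (p - zs)"
    and mono: "0 \<le> (g - gs) \<bullet> (z - zs)" and lip: "(norm (g - gs))\<^sup>2 \<le> L\<^sup>2 * (norm (z - zs))\<^sup>2"
    and \<tau>: "0 \<le> \<tau>"
  shows "(norm (p - zs))\<^sup>2 \<le> (1 + \<tau>\<^sup>2 * L\<^sup>2) * (norm (z - zs))\<^sup>2"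
proof -
  let ?w = "(z - zs) - \<tau> *\<^sub>R (g - gs)"
  have "0 \<le> (p - (z - \<tau> *\<^sub>R g)) \<bullet> (zs - p) + \<tau> * (gs \<bullet> (p - zs))"
    using p zs \<tau> by simp
  also have "\<dots> = ?w \<bullet> (p - zs) - (norm (p - zs))\<^sup>2"
    by (simp add: power2_norm_eq_inner algebra_simps inner_commute)
  finally have "(norm (p - zs))\<^sup>2 \<le> ?w \<bullet> (p - zs)" by simp
  also have "\<dots> \<le> norm ?w * norm (p - zs)" by (rule norm_cauchy_schwarz)
  finally have "norm (p - zs) \<le> norm ?w"
    by (cases "norm (p - zs) = 0") (auto simp: power2_eq_square)
  then have "(norm (p - zs))\<^sup>2 \<le> (norm ?w)\<^sup>2" by simp
  also have "\<dots> = (norm (z - zs))\<^sup>2 - 2 * \<tau> * ((g - gs) \<bullet> (z - zs)) + \<tau>\<^sup>2 * (norm (g - gs))\<^sup>2"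
    by (rule norm_diff_scaleR_sq)
  also have "\<dots> \<le> (norm (z - zs))\<^sup>2 + \<tau>\<^sup>2 * (L\<^sup>2 * (norm (z - zs))\<^sup>2)"
    using mult_left_mono[OF lip, of "\<tau>\<^sup>2"] mult_nonneg_nonneg[OF \<tau> mono] by simp
  finally show ?thesis by (simp add: algebra_simps)
qed

text \<open>Solutions are the fixed points of the projected step, which is a contraction for a
  suitable step size; Banach's theorem applies.\<close>

lemma strongly_monotone_vi_exists:
  fixes g :: "'a::euclidean_space \<Rightarrow> 'a"
  assumes S: "closed S" "convex S" "S \<noteq> {}" and \<mu>: "0 < \<mu>"
    and mono: "\<And>x y. x \<in> S \<Longrightarrow> y \<in> S \<Longrightarrow> \<mu> * (norm (x - y))\<^sup>2 \<le> (g x - g y) \<bullet> (x - y)"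
    and lip: "\<And>x y. x \<in> S \<Longrightarrow> y \<in> S \<Longrightarrow> (norm (g x - g y))\<^sup>2 \<le> L\<^sup>2 * (norm (x - y))\<^sup>2"
  obtains x where "x \<in> S" "\<And>y. y \<in> S \<Longrightarrow> 0 \<le> g x \<bullet> (y - x)"
proof -
  \<comment> \<open>Expanding the square gives the squared contraction factor
    \<open>1 - 2 \<tau> \<mu> + \<tau>\<^sup>2 K\<close>, least at
    \<open>\<tau> = \<mu> / K\<close>. The maximum with \<open>\<mu>\<^sup>2\<close> keeps its value
    \<open>1 - \<mu>\<^sup>2 / K\<close> nonnegative and \<open>K\<close> positive.\<close>
  define K where "K = max (L\<^sup>2) (\<mu>\<^sup>2)"
  define \<tau> where "\<tau> = \<mu> / K"
  define c where "c = sqrt (1 - \<mu>\<^sup>2 / K)"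
  have K: "K > 0" "L\<^sup>2 \<le> K" "\<mu>\<^sup>2 \<le> K" using \<mu> by (auto simp: K_def less_max_iff_disj)
  have \<tau>: "\<tau> > 0" using \<mu> K by (simp add: \<tau>_def)
  have c: "0 \<le> c" "c < 1" using K \<mu> by (auto simp: c_def)
  let ?T = "\<lambda>x. closest_point S (x - \<tau> *\<^sub>R g x)"
  have contr: "dist (?T x) (?T y) \<le> c * dist x y" if xy: "x \<in> S" "y \<in> S" for x y
  proof -
    have "(norm ((x - \<tau> *\<^sub>R g x) - (y - \<tau> *\<^sub>R g y)))\<^sup>2 =
        (norm (x - y))\<^sup>2 - 2 * \<tau> * ((g x - g y) \<bullet> (x - y)) + \<tau>\<^sup>2 * (norm (g x - g y))\<^sup>2"
      using norm_diff_scaleR_sq[of "x - y" \<tau> "g x - g y"] by (simp add: algebra_simps)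
    also have "\<dots> \<le> (norm (x - y))\<^sup>2 - 2 * \<tau> * (\<mu> * (norm (x - y))\<^sup>2) + \<tau>\<^sup>2 * (K * (norm (x - y))\<^sup>2)"
      using mult_left_mono[OF mono[OF xy], of "2 * \<tau>"]
        mult_left_mono[OF order_trans[OF lip[OF xy] mult_right_mono[OF K(2) zero_le_power2]] zero_le_power2[of \<tau>]] \<tau>
      by linarith
    also have "\<dots> = (1 - \<mu>\<^sup>2 / K) * (norm (x - y))\<^sup>2"
      using K by (simp add: \<tau>_def field_simps power2_eq_square)
    also have "\<dots> = (c * norm (x - y))\<^sup>2" using K by (simp add: c_def power_mult_distrib)
    finally have "norm ((x - \<tau> *\<^sub>R g x) - (y - \<tau> *\<^sub>R g y)) \<le> c * norm (x - y)"
      by (rule power2_le_imp_le) (simp add: c)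
    then show ?thesis
      using closest_point_lipschitz[OF S(2,1,3), of "x - \<tau> *\<^sub>R g x" "y - \<tau> *\<^sub>R g y"]
      by (simp add: dist_norm)
  qed
  have "\<exists>!x. x \<in> S \<and> ?T x = x"
    by (rule Banach_fix[where c = c])
      (use S c contr in \<open>auto simp: complete_eq_closed intro: closest_point_in_set\<close>)
  then obtain x where x: "x \<in> S" "?T x = x" by blast
  have "0 \<le> g x \<bullet> (y - x)" if "y \<in> S" for y
    using closest_point_vi[OF S(1,2) that, of "x - \<tau> *\<^sub>R g x"] \<tau> by (simp add: x(2) zero_le_mult_iff)
  with x that show thesis by blast
qed

subsection \<open>Expectations under finitely supported distributions\<close>

lemma expectation_mono_finite:
  fixes f g :: "'a \<Rightarrow> real"
  assumes "finite (set_pmf P)" "\<And>s. s \<in> set_pmf P \<Longrightarrow> f s \<le> g s"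
  shows "measure_pmf.expectation P f \<le> measure_pmf.expectation P g"
  using assms by (intro integral_mono_AE integrable_measure_pmf_finite) (auto simp: AE_measure_pmf_iff)

lemma expectation_bind_le:
  fixes h :: "'b \<Rightarrow> real" and g :: "'a \<Rightarrow> real"
  assumes "finite (set_pmf P)" "\<And>s. s \<in> set_pmf P \<Longrightarrow> finite (set_pmf (F s))"
    and "\<And>s. s \<in> set_pmf P \<Longrightarrow> measure_pmf.expectation (F s) h \<le> g s"
  shows "measure_pmf.expectation (P \<bind> F) h \<le> measure_pmf.expectation P g"
proof -
  have "measure_pmf.expectation (P \<bind> F) h = (\<Sum>a\<in>set_pmf P. pmf P a *\<^sub>R measure_pmf.expectation (F a) h)"
    by (rule pmf_expectation_bind) (use assms in auto)
  also have "\<dots> \<le> (\<Sum>a\<in>set_pmf P. pmf P a *\<^sub>R g a)"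
    by (intro sum_mono scaleR_left_mono) (use assms in auto)
  also have "\<dots> = measure_pmf.expectation P g"
    by (rule integral_measure_pmf[symmetric]) (use assms in \<open>auto simp: set_pmf_iff\<close>)
  finally show ?thesis .
qed

subsection \<open>L-SVRE\<close>

lemma norm_diff_sq_le:
  fixes a b c :: "'a::real_inner"
  assumes "0 < t"
  shows "(norm (a - c))\<^sup>2 \<le> (1 + t) * (norm (a - b))\<^sup>2 + (1 + 1 / t) * (norm (b - c))\<^sup>2"
proof -
  have "0 \<le> t * (norm ((a - b) - (1 / t) *\<^sub>R (b - c)))\<^sup>2" using assms by simp
  also have "\<dots> = t * (norm (a - b))\<^sup>2 - 2 * ((b - c) \<bullet> (a - b)) + (norm (b - c))\<^sup>2 / t"
    unfolding norm_diff_scaleR_sq using assms by (simp add: field_simps power2_eq_square)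
  finally have *: "2 * ((b - c) \<bullet> (a - b)) \<le> t * (norm (a - b))\<^sup>2 + (norm (b - c))\<^sup>2 / t" by simp
  have "(norm (a - c))\<^sup>2 = (norm (a - b))\<^sup>2 + 2 * ((b - c) \<bullet> (a - b)) + (norm (b - c))\<^sup>2"
    unfolding power2_norm_eq_inner by (simp add: algebra_simps inner_commute)
  also have "\<dots> \<le> (1 + t) * (norm (a - b))\<^sup>2 + (1 + 1 / t) * (norm (b - c))\<^sup>2"
    using * by (simp add: algebra_simps)
  finally show ?thesis .
qed

text \<open>The right side minus the left side equals twice the two variational inequalities plus
  the square of \<open>zh - zp - \<tau> e\<close>. The half step is tested at \<open>zp\<close>, the
  full step at \<open>zs\<close>.\<close>

lemma extragradient_step:
  fixes z w zh zp zs g e :: "'a::real_inner"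
  assumes zp: "0 \<le> (zp - (\<alpha> *\<^sub>R z + (1 - \<alpha>) *\<^sub>R w - \<tau> *\<^sub>R (g + e))) \<bullet> (zs - zp)"
    and zh: "0 \<le> (zh - (\<alpha> *\<^sub>R z + (1 - \<alpha>) *\<^sub>R w - \<tau> *\<^sub>R g)) \<bullet> (zp - zh)"
  shows "(norm (zp - zs))\<^sup>2 \<le> \<alpha> * (norm (z - zs))\<^sup>2 + (1 - \<alpha>) * (norm (w - zs))\<^sup>2
    - \<alpha> * (norm (zh - z))\<^sup>2 - (1 - \<alpha>) * (norm (zh - w))\<^sup>2
    + 2 * \<tau> * ((g + e) \<bullet> (zs - zh)) + \<tau>\<^sup>2 * (norm e)\<^sup>2"
proof -
  have "\<alpha> * (norm (z - zs))\<^sup>2 + (1 - \<alpha>) * (norm (w - zs))\<^sup>2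
      - \<alpha> * (norm (zh - z))\<^sup>2 - (1 - \<alpha>) * (norm (zh - w))\<^sup>2
      + 2 * \<tau> * ((g + e) \<bullet> (zs - zh)) + \<tau>\<^sup>2 * (norm e)\<^sup>2 - (norm (zp - zs))\<^sup>2 =
      2 * ((zp - (\<alpha> *\<^sub>R z + (1 - \<alpha>) *\<^sub>R w - \<tau> *\<^sub>R (g + e))) \<bullet> (zs - zp)) +
      2 * ((zh - (\<alpha> *\<^sub>R z + (1 - \<alpha>) *\<^sub>R w - \<tau> *\<^sub>R g)) \<bullet> (zp - zh)) +
      (norm (zh - zp - \<tau> *\<^sub>R e))\<^sup>2"
    unfolding power2_norm_eq_inner by (simp add: algebra_simps inner_commute power2_eq_square)
  moreover have "0 \<le> (norm (zh - zp - \<tau> *\<^sub>R e))\<^sup>2" by simp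
  ultimately show ?thesis using zp zh by linarith
qed

lemma norm_saddle_op_diff: "norm (saddle_op H z - saddle_op H z') = norm (H z - H z')"
  by (simp add: saddle_op_def norm_prod_def norm_minus_commute)

lemma saddle_op_average: "saddle_op (average n H) z = average n (\<lambda>i. saddle_op (H i)) z"
  by (simp add: saddle_op_def average_def fst_sum snd_sum prod_eq_iff sum_negf)

lemma finite_set_lsvre_step: "n \<ge> 1 \<Longrightarrow> finite (set_pmf (lsvre_step Z n H \<tau> p s))"
  by (auto simp: lsvre_step_def Let_def set_bind_pmf)

lemma finite_set_lsvre_state: "n \<ge> 1 \<Longrightarrow> finite (set_pmf (lsvre_state Z n H z0 \<tau> p T))"
  by (induction T) (auto simp: finite_set_lsvre_step)

text \<open>\<open>strong\<close> merges strong monotonicity with the variational inequality at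
  \<open>zs\<close>, as only distances to \<open>zs\<close> are tracked. \<open>\<tau>L\<close>
  keeps the variance of the gradient estimator below an eighth of the term \<open>p\<close> times
  the squared distance from half step to \<open>w\<close>; \<open>lsvre_contraction\<close> meets it
  with equality.\<close>

locale lsvre_problem =
  fixes Z :: "('a::euclidean_space \<times> 'b::euclidean_space) set" and n :: nat
    and H :: "nat \<Rightarrow> 'a \<times> 'b \<Rightarrow> 'a \<times> 'b" and L \<mu> \<tau> p :: real and zs :: "'a \<times> 'b"
  assumes Z: "closed Z" "convex Z" and zs: "zs \<in> Z" and n: "n \<ge> 1" and \<mu>: "\<mu> > 0" and \<tau>: "\<tau> > 0"
    and smooth: "average_smooth_on Z n L H"
    and strong: "\<And>z. z \<in> Z \<Longrightarrow> \<mu> * (norm (z - zs))\<^sup>2 \<le> saddle_op (average n H) z \<bullet> (z - zs)"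
    and p: "p = 1 / (2 * real n)" and \<tau>L: "\<tau>\<^sup>2 * L\<^sup>2 \<le> p / 8"
begin

text \<open>The weights reproduce themselves. The coin for \<open>w\<close> turns the expected new
  value into the squared error of the new \<open>z\<close> plus \<open>1 - p\<close> times that of
  \<open>w\<close>; the extragradient step bounds the former by \<open>1 - p\<close> times the error
  of \<open>z\<close> plus \<open>p\<close> times that of \<open>w\<close>, and the old value
  reappears.\<close>

definition lyap where
  "lyap s = (1 - p) * (norm (fst s - zs))\<^sup>2 + (norm (snd s - zs))\<^sup>2"

text \<open>The reciprocal of a sum lies below both reciprocals: \<open>p / 2\<close>, as
  \<open>w\<close> is rarely refreshed, and \<open>\<tau> \<mu> / 2\<close>, from strong
  monotonicity. For the step size of the theorem, \<open>1 / rate\<close> is the factor in front of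
  the logarithm in \<open>T\<close>.\<close>

definition rate where "rate = 1 / (4 * real n + 2 / (\<tau> * \<mu>))"

lemma p_bounds: "0 < p" "p \<le> 1 / 2" using n by (auto simp: p field_simps)

lemma rate_bounds: "0 < rate" "rate \<le> p / 2" "rate \<le> \<tau> * \<mu> / 2" "rate \<le> 1"
proof -
  have 0: "2 / (\<tau> * \<mu>) > 0" "4 * real n > 0" using \<mu> \<tau> n by auto
  show "0 < rate"
    unfolding rate_def by (rule divide_pos_pos[OF zero_less_one add_pos_pos[OF 0(2,1)]])
  have "rate \<le> 1 / (4 * real n)"
    unfolding rate_def by (intro divide_left_mono mult_pos_pos add_pos_pos 0) (use 0 in auto)
  then show 1: "rate \<le> p / 2" by (simp add: p)
  have "rate \<le> 1 / (2 / (\<tau> * \<mu>))"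
    unfolding rate_def by (intro divide_left_mono mult_pos_pos add_pos_pos 0) (use 0 in auto)
  then show "rate \<le> \<tau> * \<mu> / 2" by simp
  show "rate \<le> 1" using 1 p_bounds by linarith
qed

lemma closest_point_in_Z: "closest_point Z a \<in> Z"
  using Z zs by (intro closest_point_in_set) auto

lemma lyap_step:
  assumes z: "z \<in> Z" and w: "w \<in> Z"
  shows "measure_pmf.expectation (lsvre_step Z n H \<tau> p (z, w)) lyap \<le> (1 - rate) * lyap (z, w)"
proof -
  define zbar where "zbar = (1 - p) *\<^sub>R z + (1 - (1 - p)) *\<^sub>R w"
  define g where "g = saddle_op (average n H)"
  define zh where "zh = closest_point Z (zbar - \<tau> *\<^sub>R g w)"
  define e where "e i = saddle_op (H i) zh - saddle_op (H i) w" for i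
  define zp where "zp i = closest_point Z (zbar - \<tau> *\<^sub>R (g w + e i))" for i
  define a where "a = (norm (zh - z))\<^sup>2"
  define b where "b = (norm (zh - w))\<^sup>2"
  define c where "c = (norm (zh - zs))\<^sup>2"
  have zh: "zh \<in> Z" unfolding zh_def by (rule closest_point_in_Z)
  have n0: "real n > 0" using n by simp
  \<comment> \<open>The estimator is unbiased: \<open>zh\<close> is fixed before \<open>i\<close> is
    drawn, so averaging over \<open>i\<close> yields the full operator at \<open>zh\<close>.\<close>
  have sum_e: "(\<Sum>i = 1..n. g w + e i) = real n *\<^sub>R g zh"
    using n0 by (simp add: e_def g_def saddle_op_average average_def sum.distrib sum_subtractf sum_constant_scaleR)
  have step: "lsvre_step Z n H \<tau> p (z, w) =
      pmf_of_set {1..n} \<bind> (\<lambda>i. bernoulli_pmf p \<bind> (\<lambda>b. return_pmf (zp i, if b then zp i else w)))"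
    unfolding lsvre_step_def Let_def fst_conv snd_conv zp_def e_def zh_def g_def zbar_def add_diff_eq
    by (rule refl)
  have bern: "measure_pmf.expectation (bernoulli_pmf p \<bind> (\<lambda>b. return_pmf (zp i, if b then zp i else w))) lyap =
      (norm (zp i - zs))\<^sup>2 + (1 - p) * (norm (w - zs))\<^sup>2" for i
    using p_bounds
    by (subst pmf_expectation_bind[of UNIV]) (auto simp: UNIV_bool lyap_def algebra_simps)
  have "measure_pmf.expectation (lsvre_step Z n H \<tau> p (z, w)) lyap =
      (\<Sum>i = 1..n. (norm (zp i - zs))\<^sup>2 + (1 - p) * (norm (w - zs))\<^sup>2) / real n"
    unfolding step using n
    by (subst pmf_expectation_bind_pmf_of_set)
      (auto simp: bern sum_distrib_left sum_divide_distrib divide_inverse_commute simp del: sum.distrib)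
  also have "\<dots> \<le> (\<Sum>i = 1..n. lyap (z, w) - (1 - p) * a - p * b
      + 2 * \<tau> * ((g w + e i) \<bullet> (zs - zh)) + \<tau>\<^sup>2 * (norm (e i))\<^sup>2) / real n"
  proof (intro divide_right_mono sum_mono)
    fix i
    have "(norm (zp i - zs))\<^sup>2 \<le> (1 - p) * (norm (z - zs))\<^sup>2 + (1 - (1 - p)) * (norm (w - zs))\<^sup>2
        - (1 - p) * (norm (zh - z))\<^sup>2 - (1 - (1 - p)) * (norm (zh - w))\<^sup>2
        + 2 * \<tau> * ((g w + e i) \<bullet> (zs - zh)) + \<tau>\<^sup>2 * (norm (e i))\<^sup>2"
      unfolding zp_def zh_def zbar_def
      by (intro extragradient_step closest_point_vi Z zs closest_point_in_Z)
    then show "(norm (zp i - zs))\<^sup>2 + (1 - p) * (norm (w - zs))\<^sup>2 \<le> lyap (z, w) - (1 - p) * a - p * b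
        + 2 * \<tau> * ((g w + e i) \<bullet> (zs - zh)) + \<tau>\<^sup>2 * (norm (e i))\<^sup>2"
      by (simp add: lyap_def a_def b_def algebra_simps)
  qed (use n0 in auto)
  also have "\<dots> = lyap (z, w) - (1 - p) * a - p * b
      + 2 * \<tau> * ((\<Sum>i = 1..n. g w + e i) \<bullet> (zs - zh)) / real n
      + \<tau>\<^sup>2 * ((\<Sum>i = 1..n. (norm (e i))\<^sup>2) / real n)"
    using n0 by (simp add: sum.distrib sum_subtractf add_divide_distrib diff_divide_distrib
        flip: sum_distrib_left inner_sum_left)
  also have "\<dots> \<le> lyap (z, w) - (1 - p) * a - p * b - 2 * \<tau> * (\<mu> * c) + p / 8 * b"
  proof -
    have "(\<Sum>i = 1..n. (norm (e i))\<^sup>2) / real n \<le> L\<^sup>2 * b"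
      using smooth zh w by (simp add: average_smooth_on_def e_def norm_saddle_op_diff b_def)
    then have "\<tau>\<^sup>2 * ((\<Sum>i = 1..n. (norm (e i))\<^sup>2) / real n) \<le> \<tau>\<^sup>2 * (L\<^sup>2 * b)"
      by (intro mult_left_mono) auto
    also have "\<dots> = (\<tau>\<^sup>2 * L\<^sup>2) * b" by simp
    also have "\<dots> \<le> p / 8 * b" using \<tau>L by (intro mult_right_mono) (simp_all add: b_def)
    finally have 1: "\<tau>\<^sup>2 * ((\<Sum>i = 1..n. (norm (e i))\<^sup>2) / real n) \<le> p / 8 * b" .
    have "2 * \<tau> * ((\<Sum>i = 1..n. g w + e i) \<bullet> (zs - zh)) / real n = 2 * \<tau> * (g zh \<bullet> (zs - zh))"
      unfolding sum_e using n0 by simp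
    also have "\<dots> \<le> 2 * \<tau> * (- (\<mu> * c))"
      using strong[OF zh] \<tau> by (intro mult_left_mono) (auto simp: g_def c_def inner_diff_right)
    finally show ?thesis using 1 by linarith
  qed
  also have "\<dots> \<le> (1 - rate) * lyap (z, w)"
  proof -
    \<comment> \<open>The available decrease is
      \<open>(1 - p) a + 7/8 p b + 2 \<tau> \<mu> c\<close>. Young's inequality with weights 3 and
      3/4 costs \<open>4 rate \<le> 1\<close> per \<open>(1 - p) a\<close>,
      \<open>7/4 rate \<le> 7/8 p\<close> per \<open>b\<close>, and
      \<open>(4/3 + 7/3) rate \<le> 11/6 \<tau> \<mu>\<close> per \<open>c\<close>.\<close>
    have nn: "0 \<le> a" "0 \<le> b" "0 \<le> c" by (auto simp: a_def b_def c_def)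
    have "(norm (z - zs))\<^sup>2 \<le> 4 * a + 4 / 3 * c"
      using norm_diff_sq_le[of 3 z zs zh] by (simp add: a_def c_def norm_minus_commute)
    then have "rate * ((1 - p) * (norm (z - zs))\<^sup>2) \<le> rate * ((1 - p) * (4 * a + 4 / 3 * c))"
      using rate_bounds p_bounds by (intro mult_left_mono) auto
    also have "\<dots> = (1 - p) * (4 * rate) * a + (1 - p) * (4 / 3 * rate * c)" by (simp add: algebra_simps)
    also have "\<dots> \<le> (1 - p) * 1 * a + 1 * (4 / 3 * rate * c)"
      using rate_bounds p_bounds nn by (intro add_mono mult_right_mono mult_left_mono) auto
    finally have 1: "rate * ((1 - p) * (norm (z - zs))\<^sup>2) \<le> (1 - p) * a + 4 / 3 * (rate * c)" by simp
    have "(norm (w - zs))\<^sup>2 \<le> 7 / 4 * b + 7 / 3 * c"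
      using norm_diff_sq_le[of "3 / 4" w zs zh] by (simp add: b_def c_def norm_minus_commute)
    then have "rate * (norm (w - zs))\<^sup>2 \<le> rate * (7 / 4 * b + 7 / 3 * c)"
      using rate_bounds by (intro mult_left_mono) auto
    then have 2: "rate * (norm (w - zs))\<^sup>2 \<le> 7 / 4 * (rate * b) + 7 / 3 * (rate * c)"
      by (simp add: algebra_simps)
    have 3: "rate * b \<le> p / 2 * b" "rate * c \<le> \<tau> * \<mu> / 2 * c"
      using mult_right_mono[OF rate_bounds(2) nn(2)] mult_right_mono[OF rate_bounds(3) nn(3)] by auto
    have "rate * lyap (z, w) = rate * ((1 - p) * (norm (z - zs))\<^sup>2) + rate * (norm (w - zs))\<^sup>2"
      by (simp add: lyap_def distrib_left)
    moreover have "0 \<le> \<tau> * \<mu> * c" using \<mu> \<tau> nn by simp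
    moreover have "(1 - rate) * lyap (z, w) = lyap (z, w) - rate * lyap (z, w)" by (simp add: left_diff_distrib)
    moreover have "\<tau> * \<mu> / 2 * c = \<tau> * \<mu> * c / 2" "2 * \<tau> * (\<mu> * c) = 2 * (\<tau> * \<mu> * c)" by simp_all
    ultimately show ?thesis using 1 2 3 by linarith
  qed
  finally show ?thesis .
qed

lemma lsvre_state_in_Z:
  assumes "z0 \<in> Z" "s \<in> set_pmf (lsvre_state Z n H z0 \<tau> p T)"
  shows "s \<in> Z \<times> Z"
  using assms(2)
proof (induction T arbitrary: s)
  case (Suc T)
  then obtain s' where s': "s' \<in> Z \<times> Z" "s \<in> set_pmf (lsvre_step Z n H \<tau> p s')"
    unfolding lsvre_state.simps set_bind_pmf by blast
  then show ?case
    using n by (auto simp: lsvre_step_def Let_def set_bind_pmf closest_point_in_Z split: if_splits)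
qed (use assms in auto)

lemma lyap_state:
  assumes "z0 \<in> Z"
  shows "measure_pmf.expectation (lsvre_state Z n H z0 \<tau> p T) lyap \<le> (1 - rate) ^ T * lyap (z0, z0)"
proof (induction T)
  case (Suc T)
  have "measure_pmf.expectation (lsvre_state Z n H z0 \<tau> p (Suc T)) lyap \<le>
      measure_pmf.expectation (lsvre_state Z n H z0 \<tau> p T) (\<lambda>s. (1 - rate) * lyap s)"
    unfolding lsvre_state.simps
    by (rule expectation_bind_le)
      (use n lsvre_state_in_Z[OF assms] lyap_step in \<open>auto intro!: finite_set_lsvre_state finite_set_lsvre_step\<close>)
  also have "\<dots> = (1 - rate) * measure_pmf.expectation (lsvre_state Z n H z0 \<tau> p T) lyap" by simp
  also have "\<dots> \<le> (1 - rate) * ((1 - rate) ^ T * lyap (z0, z0))"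
    using Suc rate_bounds by (intro mult_left_mono) auto
  finally show ?case by simp
qed simp

lemma set_lsvre:
  assumes z0: "z0 \<in> Z" and z: "z \<in> set_pmf (lsvre Z n H z0 \<tau> p T)"
  shows "z \<in> Z"
proof -
  obtain s where "s \<in> set_pmf (lsvre_state Z n H z0 \<tau> p T)" "z = fst s"
    using z unfolding lsvre_def set_map_pmf by blast
  then show ?thesis using lsvre_state_in_Z[OF z0] by (simp add: mem_Times_iff)
qed

text \<open>The 3 is the price of returning from \<open>lyap\<close> to one distance: the start
  contributes \<open>2 - p\<close>, the weight of \<open>z\<close> is \<open>1 - p\<close>, and the
  quotient is at most 3 for \<open>p\<close> up to 1/2.\<close>

lemma lsvre_expectation:
  assumes z0: "z0 \<in> Z"
  shows "measure_pmf.expectation (lsvre Z n H z0 \<tau> p T) (\<lambda>z. (norm (z - zs))\<^sup>2)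
    \<le> 3 * (1 - rate) ^ T * (norm (z0 - zs))\<^sup>2"
proof -
  have "measure_pmf.expectation (lsvre Z n H z0 \<tau> p T) (\<lambda>z. (norm (z - zs))\<^sup>2) =
      measure_pmf.expectation (lsvre_state Z n H z0 \<tau> p T) (\<lambda>s. (norm (fst s - zs))\<^sup>2)"
    by (simp add: lsvre_def)
  also have "\<dots> \<le> measure_pmf.expectation (lsvre_state Z n H z0 \<tau> p T) (\<lambda>s. lyap s / (1 - p))"
    using p_bounds n
    by (intro expectation_mono_finite finite_set_lsvre_state) (auto simp: lyap_def field_simps)
  also have "\<dots> = measure_pmf.expectation (lsvre_state Z n H z0 \<tau> p T) lyap / (1 - p)" by simp
  also have "\<dots> \<le> (1 - rate) ^ T * lyap (z0, z0) / (1 - p)"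
    using lyap_state[OF z0] p_bounds by (intro divide_right_mono) auto
  also have "\<dots> = (1 - rate) ^ T * (norm (z0 - zs))\<^sup>2 * ((2 - p) / (1 - p))"
    by (simp add: lyap_def algebra_simps add_divide_distrib)
  also have "\<dots> \<le> (1 - rate) ^ T * (norm (z0 - zs))\<^sup>2 * 3"
    using p_bounds rate_bounds by (intro mult_left_mono) (auto simp: field_simps)
  finally show ?thesis by simp
qed

end

subsection \<open>Smooth strongly-convex-strongly-concave functions\<close>

text \<open>First-order inequalities replace differentiability, which makes the locale stable under
  exchanging the players (\<open>swap\<close>) and adding a proximal term (\<open>prox\<close>).
  Estimates for \<open>phi\<close> thus carry over to \<open>psi\<close> and to every
  subproblem.\<close>

locale saddle_problem =
  fixes X :: "'a::euclidean_space set" and Y :: "'b::euclidean_space set"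
    and f :: "'a \<Rightarrow> 'b \<Rightarrow> real" and gx :: "'a \<Rightarrow> 'b \<Rightarrow> 'a" and gy :: "'a \<Rightarrow> 'b \<Rightarrow> 'b"
    and \<mu>x \<mu>y L :: real
  assumes X: "closed X" "convex X" "X \<noteq> {}" and Y: "closed Y" "convex Y" "Y \<noteq> {}"
    and \<mu>: "0 < \<mu>x" "0 < \<mu>y" "\<mu>x \<le> L" "\<mu>y \<le> L"
    and f_convex: "\<And>x x' y. x \<in> X \<Longrightarrow> x' \<in> X \<Longrightarrow> y \<in> Y \<Longrightarrow>
      f x y + gx x y \<bullet> (x' - x) + \<mu>x / 2 * (norm (x' - x))\<^sup>2 \<le> f x' y"
    and f_concave: "\<And>x y y'. x \<in> X \<Longrightarrow> y \<in> Y \<Longrightarrow> y' \<in> Y \<Longrightarrow>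
      f x y' \<le> f x y + gy x y \<bullet> (y' - y) - \<mu>y / 2 * (norm (y' - y))\<^sup>2"
    and lip: "\<And>x x' y y'. x \<in> X \<Longrightarrow> x' \<in> X \<Longrightarrow> y \<in> Y \<Longrightarrow> y' \<in> Y \<Longrightarrow>
      norm (gx x y - gx x' y', gy x y - gy x' y') \<le> L * norm (x - x', y - y')"
begin

lemma L_pos: "0 < L" using \<mu> by simp

lemma swap: "saddle_problem Y X (\<lambda>y x. - f x y) (\<lambda>y x. - gy x y) (\<lambda>y x. - gx x y) \<mu>y \<mu>x L"
proof
  fix y y' x assume "y \<in> Y" "y' \<in> Y" "x \<in> X"
  then show "- f x y + - gy x y \<bullet> (y' - y) + \<mu>y / 2 * (norm (y' - y))\<^sup>2 \<le> - f x y'"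
    using f_concave[of x y y'] by simp
next
  fix y x x' assume "y \<in> Y" "x \<in> X" "x' \<in> X"
  then show "- f x' y \<le> - f x y + - gx x y \<bullet> (x' - x) - \<mu>x / 2 * (norm (x' - x))\<^sup>2"
    using f_convex[of x x' y] by simp
next
  fix y y' x x' assume "y \<in> Y" "y' \<in> Y" "x \<in> X" "x' \<in> X"
  then show "norm (- gy x y - - gy x' y', - gx x y - - gx x' y') \<le> L * norm (y - y', x - x')"
    using lip[of x x' y y'] by (simp add: norm_Pair add.commute norm_minus_commute)
qed (use X Y \<mu> in auto)

lemma strongly_monotone:
  assumes "x \<in> X" "x' \<in> X" "y \<in> Y" "y' \<in> Y"
  shows "\<mu>x * (norm (x - x'))\<^sup>2 + \<mu>y * (norm (y - y'))\<^sup>2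
    \<le> (gx x y - gx x' y') \<bullet> (x - x') - (gy x y - gy x' y') \<bullet> (y - y')"
  using f_convex[of x x' y] f_convex[of x' x y'] f_concave[of x y y'] f_concave[of x' y' y] assms
  by (simp add: inner_diff_left inner_diff_right norm_minus_commute)

text \<open>Optimality is encoded by its variational inequality: perturbation arguments add such
  inequalities, and a term independent of \<open>y\<close> does not change this one.\<close>

definition max_pt where "max_pt x y \<longleftrightarrow> y \<in> Y \<and> (\<forall>y'\<in>Y. gy x y \<bullet> (y' - y) \<le> 0)"

definition min_pt where "min_pt y x \<longleftrightarrow> x \<in> X \<and> (\<forall>x'\<in>X. 0 \<le> gx x y \<bullet> (x' - x))"

lemma max_pt_exists:
  assumes x: "x \<in> X"
  shows "\<exists>y. max_pt x y"
proof -
  have "(norm (- gy x y - - gy x y'))\<^sup>2 \<le> L\<^sup>2 * (norm (y - y'))\<^sup>2" if "y \<in> Y" "y' \<in> Y" for y y'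
  proof -
    have "norm (- gy x y - - gy x y') \<le> norm (gx x y - gx x y', gy x y - gy x y')"
      by (metis minus_diff_minus norm_minus_cancel norm_snd_le)
    also have "\<dots> \<le> L * norm (y - y')" using lip[OF x x that] by (simp add: norm_Pair)
    finally show ?thesis by (metis norm_ge_zero power_mono power_mult_distrib)
  qed
  moreover have "\<mu>y * (norm (y - y'))\<^sup>2 \<le> (- gy x y - - gy x y') \<bullet> (y - y')" if "y \<in> Y" "y' \<in> Y" for y y'
    using strongly_monotone[OF x x that] by (simp add: inner_diff_left)
  ultimately obtain y where "y \<in> Y" "\<And>y'. y' \<in> Y \<Longrightarrow> 0 \<le> - gy x y \<bullet> (y' - y)"
    using strongly_monotone_vi_exists[OF Y \<mu>(2), of "\<lambda>y. - gy x y" L] by blast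
  then show ?thesis unfolding max_pt_def by fastforce
qed

lemma max_pt_max:
  assumes "x \<in> X" "max_pt x y" "y' \<in> Y"
  shows "f x y' + \<mu>y / 2 * (norm (y' - y))\<^sup>2 \<le> f x y"
proof -
  have "gy x y \<bullet> (y' - y) \<le> 0" using assms by (auto simp: max_pt_def)
  moreover have "y \<in> Y" using assms by (simp add: max_pt_def)
  ultimately show ?thesis using f_concave[OF assms(1) _ assms(3), of y] by linarith
qed

text \<open>Strong concavity in \<open>y\<close> is played against the Lipschitz dependence of
  \<open>gy\<close> on \<open>x\<close>. The case \<open>x = x'\<close> is uniqueness of the
  maximiser, which makes the choice in \<open>phi\<close> harmless.\<close>

lemma max_pt_lipschitz:
  assumes "x \<in> X" "x' \<in> X" "max_pt x y" "max_pt x' y'"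
  shows "norm (y - y') \<le> L / \<mu>y * norm (x - x')"
proof -
  have y: "y \<in> Y" "y' \<in> Y" "gy x y \<bullet> (y' - y) \<le> 0" "gy x' y' \<bullet> (y - y') \<le> 0"
    using assms by (auto simp: max_pt_def)
  have "\<mu>y * (norm (y - y'))\<^sup>2 \<le> - ((gy x y - gy x y') \<bullet> (y - y'))"
    using strongly_monotone[OF assms(1,1) y(1,2)] by simp
  also have "\<dots> \<le> (gy x y' - gy x' y') \<bullet> (y - y')"
    using y(3,4) by (simp add: inner_diff_left inner_diff_right)
  also have "\<dots> \<le> norm (gy x y' - gy x' y') * norm (y - y')" by (rule norm_cauchy_schwarz)
  also have "\<dots> \<le> (L * norm (x - x')) * norm (y - y')"
    using order_trans[OF norm_snd_le lip[OF assms(1,2) y(2,2)]] by (intro mult_right_mono) (auto simp: norm_Pair)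
  finally show ?thesis
    using \<mu> L_pos by (cases "norm (y - y') = 0") (auto simp: power2_eq_square field_simps)
qed

section \<open>The primal function and the dual function\<close>

definition phi where "phi x = f x (SOME y. max_pt x y)"
definition psi where "psi y = f (SOME x. min_pt y x) y"

lemma phi_eq: "x \<in> X \<Longrightarrow> max_pt x y \<Longrightarrow> phi x = f x y"
proof -
  assume x: "x \<in> X" and y: "max_pt x y"
  let ?y = "SOME y. max_pt x y"
  have y': "max_pt x ?y" using y by (rule someI)
  have "norm (?y - y) \<le> L / \<mu>y * norm (x - x)" by (rule max_pt_lipschitz[OF x x y' y])
  then show ?thesis by (simp add: phi_def)
qed

lemma phi_ge:
  assumes x: "x \<in> X" and y: "y \<in> Y"
  shows "f x y \<le> phi x"
proof -
  obtain yh where yh: "max_pt x yh" using max_pt_exists[OF x] by blast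
  have "0 \<le> \<mu>y / 2 * (norm (y - yh))\<^sup>2" using \<mu> by simp
  then show ?thesis using max_pt_max[OF x yh y] phi_eq[OF x yh] by linarith
qed

lemma phi_SUP: "x \<in> X \<Longrightarrow> (SUP y\<in>Y. f x y) = phi x"
proof -
  assume x: "x \<in> X"
  then obtain y where y: "max_pt x y" using max_pt_exists by blast
  then have "y \<in> Y" by (simp add: max_pt_def)
  then show ?thesis
    by (intro cSup_eq_maximum) (auto simp: phi_eq[OF x y] intro: phi_ge[OF x, unfolded phi_eq[OF x y]])
qed

lemma swap_max_pt: "saddle_problem.max_pt X (\<lambda>y x. - gx x y) y x \<longleftrightarrow> min_pt y x"
proof -
  interpret swap: saddle_problem Y X "\<lambda>y x. - f x y" "\<lambda>y x. - gy x y" "\<lambda>y x. - gx x y" \<mu>y \<mu>x L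
    by (rule swap)
  show ?thesis by (simp add: swap.max_pt_def min_pt_def)
qed

lemma swap_min_pt: "saddle_problem.min_pt Y (\<lambda>y x. - gy x y) x y \<longleftrightarrow> max_pt x y"
proof -
  interpret swap: saddle_problem Y X "\<lambda>y x. - f x y" "\<lambda>y x. - gy x y" "\<lambda>y x. - gx x y" \<mu>y \<mu>x L
    by (rule swap)
  show ?thesis by (simp add: swap.min_pt_def max_pt_def)
qed

lemma swap_phi: "saddle_problem.phi X (\<lambda>y x. - f x y) (\<lambda>y x. - gx x y) y = - psi y"
proof -
  interpret swap: saddle_problem Y X "\<lambda>y x. - f x y" "\<lambda>y x. - gy x y" "\<lambda>y x. - gx x y" \<mu>y \<mu>x L
    by (rule swap)
  show ?thesis by (simp add: swap.phi_def psi_def swap_max_pt)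
qed

lemma min_pt_exists: "y \<in> Y \<Longrightarrow> \<exists>x. min_pt y x"
  using saddle_problem.max_pt_exists[OF swap] by (simp add: swap_max_pt)

lemma min_pt_min: "y \<in> Y \<Longrightarrow> min_pt y x \<Longrightarrow> x' \<in> X \<Longrightarrow> f x y + \<mu>x / 2 * (norm (x' - x))\<^sup>2 \<le> f x' y"
  using saddle_problem.max_pt_max[OF swap, of y x x'] by (simp add: swap_max_pt)

lemma psi_eq: "y \<in> Y \<Longrightarrow> min_pt y x \<Longrightarrow> psi y = f x y"
  using saddle_problem.phi_eq[OF swap, of y x] by (simp add: swap_max_pt swap_phi)

lemma psi_le: "y \<in> Y \<Longrightarrow> x \<in> X \<Longrightarrow> psi y \<le> f x y"
  using saddle_problem.phi_ge[OF swap, of y x] by (simp add: swap_phi)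

lemma psi_INF: "y \<in> Y \<Longrightarrow> (INF x\<in>X. f x y) = psi y"
proof -
  assume y: "y \<in> Y"
  then obtain x where x: "min_pt y x" using min_pt_exists by blast
  then have "x \<in> X" by (simp add: min_pt_def)
  then show ?thesis
    by (intro cInf_eq_minimum) (auto simp: psi_eq[OF y x] intro: psi_le[OF y, unfolded psi_eq[OF y x]])
qed

text \<open>Freeze \<open>y\<close> at the maximiser of the convex combination: there
  \<open>f\<close> equals \<open>phi\<close>, at both endpoints it lies below. The gradient terms
  cancel, and \<open>\<theta> (1 - \<theta>)\<^sup>2 + (1 - \<theta>) \<theta>\<^sup>2 = \<theta> (1
  - \<theta>)\<close>.\<close>

lemma phi_strongly_convex:
  assumes "x \<in> X" "x' \<in> X" "0 \<le> \<theta>" "\<theta> \<le> 1"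
  shows "phi (\<theta> *\<^sub>R x + (1 - \<theta>) *\<^sub>R x') \<le> \<theta> * phi x + (1 - \<theta>) * phi x' - \<mu>x / 2 * \<theta> * (1 - \<theta>) * (norm (x - x'))\<^sup>2"
proof -
  let ?c = "\<theta> *\<^sub>R x + (1 - \<theta>) *\<^sub>R x'"
  have c: "?c \<in> X" using X(2) assms by (auto intro: convexD)
  obtain y where y: "max_pt ?c y" using max_pt_exists[OF c] by blast
  then have yY: "y \<in> Y" by (simp add: max_pt_def)
  have d: "x - ?c = (1 - \<theta>) *\<^sub>R (x - x')" "x' - ?c = - (\<theta> *\<^sub>R (x - x'))" by (simp_all add: algebra_simps)
  define C where "C = f ?c y"
  define I where "I = gx ?c y \<bullet> (x - x')"
  define N where "N = \<mu>x / 2 * (norm (x - x'))\<^sup>2"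
  have "C + (1 - \<theta>) * I + (1 - \<theta>)\<^sup>2 * N \<le> phi x"
    using order_trans[OF f_convex[OF c assms(1) yY] phi_ge[OF assms(1) yY]] unfolding d
    by (simp add: power_mult_distrib C_def I_def N_def mult.left_commute)
  from mult_left_mono[OF this assms(3)]
  have 1: "\<theta> * C + \<theta> * (1 - \<theta>) * I + \<theta> * (1 - \<theta>)\<^sup>2 * N \<le> \<theta> * phi x"
    by (simp add: algebra_simps)
  have "C - \<theta> * I + \<theta>\<^sup>2 * N \<le> phi x'"
    using order_trans[OF f_convex[OF c assms(2) yY] phi_ge[OF assms(2) yY]] unfolding d
    by (simp add: power_mult_distrib C_def I_def N_def mult.left_commute)
  from mult_left_mono[OF this, of "1 - \<theta>"] assms(4)
  have 2: "(1 - \<theta>) * C - \<theta> * (1 - \<theta>) * I + (1 - \<theta>) * \<theta>\<^sup>2 * N \<le> (1 - \<theta>) * phi x'"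
    by (simp add: algebra_simps)
  have "phi ?c + \<theta> * (1 - \<theta>) * N = (\<theta> * C + \<theta> * (1 - \<theta>) * I + \<theta> * (1 - \<theta>)\<^sup>2 * N)
      + ((1 - \<theta>) * C - \<theta> * (1 - \<theta>) * I + (1 - \<theta>) * \<theta>\<^sup>2 * N)"
    unfolding phi_eq[OF c y] C_def[symmetric] by (simp add: algebra_simps power2_eq_square)
  moreover have "\<mu>x / 2 * \<theta> * (1 - \<theta>) * (norm (x - x'))\<^sup>2 = \<theta> * (1 - \<theta>) * N" by (simp add: N_def)
  ultimately show ?thesis using 1 2 by linarith
qed

section \<open>Saddle points and growth away from them\<close>

definition saddle_pt where "saddle_pt x y \<longleftrightarrow> min_pt y x \<and> max_pt x y"

lemma saddle_pt_in: "saddle_pt x y \<Longrightarrow> x \<in> X \<and> y \<in> Y"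
  by (simp add: saddle_pt_def min_pt_def max_pt_def)

lemma swap_saddle_pt: "saddle_problem.saddle_pt Y X (\<lambda>y x. - gy x y) (\<lambda>y x. - gx x y) y x \<longleftrightarrow> saddle_pt x y"
proof -
  interpret swap: saddle_problem Y X "\<lambda>y x. - f x y" "\<lambda>y x. - gy x y" "\<lambda>y x. - gx x y" \<mu>y \<mu>x L
    by (rule swap)
  show ?thesis by (auto simp: swap.saddle_pt_def saddle_pt_def swap_max_pt swap_min_pt)
qed

text \<open>The operator \<open>(gx, - gy)\<close> is strongly monotone on the product; moving one
  coordinate at a time splits its variational inequality into the two required ones.\<close>

lemma saddle_pt_exists: "\<exists>x y. saddle_pt x y"
proof -
  let ?g = "\<lambda>z. (gx (fst z) (snd z), - gy (fst z) (snd z))"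
  have "min \<mu>x \<mu>y * (norm (z - z'))\<^sup>2 \<le> (?g z - ?g z') \<bullet> (z - z')"
    if "z \<in> X \<times> Y" "z' \<in> X \<times> Y" for z z'
  proof -
    have "min \<mu>x \<mu>y * (norm (z - z'))\<^sup>2 = min \<mu>x \<mu>y * (norm (fst z - fst z'))\<^sup>2 + min \<mu>x \<mu>y * (norm (snd z - snd z'))\<^sup>2"
      by (simp add: norm_prod_def algebra_simps)
    also have "\<dots> \<le> \<mu>x * (norm (fst z - fst z'))\<^sup>2 + \<mu>y * (norm (snd z - snd z'))\<^sup>2"
      by (intro add_mono mult_right_mono) auto
    also have "\<dots> \<le> (?g z - ?g z') \<bullet> (z - z')"
      using strongly_monotone[of "fst z" "fst z'" "snd z" "snd z'"] that
      by (auto simp: inner_prod_def inner_diff_left)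
    finally show ?thesis .
  qed
  moreover have "(norm (?g z - ?g z'))\<^sup>2 \<le> L\<^sup>2 * (norm (z - z'))\<^sup>2"
    if "z \<in> X \<times> Y" "z' \<in> X \<times> Y" for z z'
  proof -
    have "norm (?g z - ?g z') \<le> L * norm (z - z')"
      using lip[of "fst z" "fst z'" "snd z" "snd z'"] that
      by (auto simp: norm_prod_def norm_minus_commute)
    then show ?thesis by (metis norm_ge_zero power_mono power_mult_distrib)
  qed
  moreover have "closed (X \<times> Y)" "convex (X \<times> Y)" "X \<times> Y \<noteq> {}" "0 < min \<mu>x \<mu>y"
    using X Y \<mu> by (auto simp: closed_Times convex_Times)
  ultimately obtain z where z: "z \<in> X \<times> Y" "\<And>z'. z' \<in> X \<times> Y \<Longrightarrow> 0 \<le> ?g z \<bullet> (z' - z)"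
    using strongly_monotone_vi_exists[of "X \<times> Y" "min \<mu>x \<mu>y" ?g L] by blast
  have "0 \<le> gx (fst z) (snd z) \<bullet> (x' - fst z)" if "x' \<in> X" for x'
    using z(2)[of "(x', snd z)"] z(1) that by (auto simp: inner_prod_def)
  moreover have "gy (fst z) (snd z) \<bullet> (y' - snd z) \<le> 0" if "y' \<in> Y" for y'
    using z(2)[of "(fst z, y')"] z(1) that by (auto simp: inner_prod_def)
  ultimately have "saddle_pt (fst z) (snd z)"
    using z(1) by (auto simp: saddle_pt_def min_pt_def max_pt_def)
  then show ?thesis by blast
qed

lemma saddle_value:
  assumes "saddle_pt xs ys"
  shows "phi xs = f xs ys" "psi ys = f xs ys"
  using assms by (auto simp: saddle_pt_def min_pt_def max_pt_def intro!: phi_eq psi_eq)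

text \<open>The slice of \<open>f\<close> at \<open>ys\<close> lies below \<open>phi\<close>,
  touches it at \<open>xs\<close> and is minimal there, so its strong convexity is enough.\<close>

lemma phi_growth:
  assumes s: "saddle_pt xs ys" and x: "x \<in> X"
  shows "phi xs + \<mu>x / 2 * (norm (x - xs))\<^sup>2 \<le> phi x"
proof -
  have "f xs ys + \<mu>x / 2 * (norm (x - xs))\<^sup>2 \<le> f x ys"
    using s x saddle_pt_in[OF s] by (intro min_pt_min) (auto simp: saddle_pt_def)
  also have "\<dots> \<le> phi x" using x saddle_pt_in[OF s] by (intro phi_ge) auto
  finally show ?thesis using saddle_value[OF s] by simp
qed

lemma psi_growth:
  assumes s: "saddle_pt xs ys" and y: "y \<in> Y"
  shows "psi y + \<mu>y / 2 * (norm (y - ys))\<^sup>2 \<le> psi ys"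
  using saddle_problem.phi_growth[OF swap, of ys xs y] assms by (simp add: swap_saddle_pt swap_phi)

section \<open>The final projected gradient step\<close>

lemma projected_step_dist:
  assumes s: "saddle_pt xs ys" and t: "xt \<in> X" "yt \<in> Y" and \<tau>: "0 < \<tau>" "4 * \<tau> * L \<le> 1"
    and xp: "xp = closest_point X (xt - \<tau> *\<^sub>R gx xt yt)"
    and yp: "yp = closest_point Y (yt + \<tau> *\<^sub>R gy xt yt)"
  shows "(norm (xp - xs))\<^sup>2 + (norm (yp - ys))\<^sup>2 \<le> 17 / 16 * ((norm (xt - xs))\<^sup>2 + (norm (yt - ys))\<^sup>2)"
proof -
  have xsY: "xs \<in> X" "ys \<in> Y" using saddle_pt_in[OF s] by auto
  have pX: "xp \<in> X" "yp \<in> Y" unfolding xp yp using X Y by (auto intro: closest_point_in_set)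
  have 1: "0 \<le> ((xp, yp) - ((xt, yt) - \<tau> *\<^sub>R (gx xt yt, - gy xt yt))) \<bullet> ((xs, ys) - (xp, yp))"
    using closest_point_vi[OF X(1,2) xsY(1), of "xt - \<tau> *\<^sub>R gx xt yt"]
      closest_point_vi[OF Y(1,2) xsY(2), of "yt + \<tau> *\<^sub>R gy xt yt"]
    by (simp add: inner_prod_def xp yp)
  have 2: "0 \<le> (gx xs ys, - gy xs ys) \<bullet> ((xp, yp) - (xs, ys))"
  proof -
    have "0 \<le> gx xs ys \<bullet> (xp - xs)" "gy xs ys \<bullet> (yp - ys) \<le> 0"
      using s pX by (auto simp: saddle_pt_def min_pt_def max_pt_def)
    then show ?thesis by (simp add: inner_prod_def)
  qed
  have 3: "0 \<le> ((gx xt yt, - gy xt yt) - (gx xs ys, - gy xs ys)) \<bullet> ((xt, yt) - (xs, ys))"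
  proof -
    have "0 \<le> \<mu>x * (norm (xt - xs))\<^sup>2 + \<mu>y * (norm (yt - ys))\<^sup>2" using \<mu> by simp
    also have "\<dots> \<le> ((gx xt yt, - gy xt yt) - (gx xs ys, - gy xs ys)) \<bullet> ((xt, yt) - (xs, ys))"
      using strongly_monotone[OF t(1) xsY(1) t(2) xsY(2)] by (simp add: inner_prod_def inner_diff_left)
    finally show ?thesis .
  qed
  have "norm ((gx xt yt, - gy xt yt) - (gx xs ys, - gy xs ys)) \<le> L * norm ((xt, yt) - (xs, ys))"
    using lip[OF t(1) xsY(1) t(2) xsY(2)] by (simp add: norm_Pair norm_minus_commute)
  then have 4: "(norm ((gx xt yt, - gy xt yt) - (gx xs ys, - gy xs ys)))\<^sup>2 \<le> L\<^sup>2 * (norm ((xt, yt) - (xs, ys)))\<^sup>2"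
    by (metis norm_ge_zero power_mono power_mult_distrib)
  have "(norm ((xp, yp) - (xs, ys)))\<^sup>2 \<le> (1 + \<tau>\<^sup>2 * L\<^sup>2) * (norm ((xt, yt) - (xs, ys)))\<^sup>2"
    by (rule projection_step_dist[OF 1 2 3 4]) (use \<tau> in simp)
  also have "\<dots> \<le> (1 + 1 / 16) * (norm ((xt, yt) - (xs, ys)))\<^sup>2"
  proof -
    have "(4 * \<tau> * L)\<^sup>2 \<le> 1\<^sup>2" using \<tau> L_pos by (intro power_mono) auto
    then show ?thesis by (intro mult_right_mono) (auto simp: power_mult_distrib)
  qed
  finally show ?thesis by (simp add: norm_Pair)
qed

text \<open>The projection inequality of \<open>xp\<close> replaces the first-order term
  \<open>gx xt yt \<bullet> (xp - xs)\<close> by squares over \<open>2 \<tau>\<close>. The negative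
  squares \<open>- d\<^sup>2 - a\<^sup>2\<close> that it brings absorb the products left by the
  Lipschitz bound on the gradient.\<close>

lemma phi_projected_step:
  assumes s: "saddle_pt xs ys" and t: "xt \<in> X" "yt \<in> Y" and \<tau>: "0 < \<tau>" "4 * \<tau> * L \<le> 1"
    and xp: "xp = closest_point X (xt - \<tau> *\<^sub>R gx xt yt)"
  shows "phi xp - phi xs \<le> (2 * L\<^sup>2 / \<mu>y + 1 / (2 * \<tau>)) * ((norm (xt - xs))\<^sup>2 + (norm (yt - ys))\<^sup>2)"
proof -
  define D where "D = (norm (xt - xs))\<^sup>2 + (norm (yt - ys))\<^sup>2"
  define a where "a = norm (xp - xs)"
  define d where "d = norm (xp - xt)"
  define e where "e = norm (yt - ys)"
  have xsY: "xs \<in> X" "ys \<in> Y" using saddle_pt_in[OF s] by auto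
  have pX: "xp \<in> X" unfolding xp using X by (auto intro: closest_point_in_set)
  obtain yh where yh: "max_pt xp yh" using max_pt_exists[OF pX] by blast
  then have yhY: "yh \<in> Y" by (simp add: max_pt_def)
  have a2: "a\<^sup>2 \<le> 17 / 16 * D"
    using projected_step_dist[OF s t \<tau> xp refl] zero_le_power2 unfolding a_def D_def
    by (meson le_add_same_cancel1 order_trans)
  have "phi xp - phi xs \<le> f xp yh - f xs yh"
    using phi_eq[OF pX yh] phi_ge[OF xsY(1) yhY] by simp
  also have "\<dots> \<le> gx xp yh \<bullet> (xp - xs)"
  proof -
    have "0 \<le> \<mu>x / 2 * (norm (xs - xp))\<^sup>2" using \<mu> by simp
    then show ?thesis using f_convex[OF pX xsY(1) yhY] by (simp add: inner_diff_right)
  qed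
  also have "\<dots> = (gx xp yh - gx xt yt) \<bullet> (xp - xs) + gx xt yt \<bullet> (xp - xs)"
    by (simp add: inner_diff_left)
  also have "(gx xp yh - gx xt yt) \<bullet> (xp - xs) \<le> L * (d + (L / \<mu>y * a + e)) * a"
  proof -
    have "norm (yh - ys) \<le> L / \<mu>y * a"
      unfolding a_def using s by (intro max_pt_lipschitz pX xsY yh) (simp add: saddle_pt_def)
    then have "norm (yh - yt) \<le> L / \<mu>y * a + e"
      unfolding e_def using norm_triangle_ineq[of "yh - ys" "ys - yt"] by (simp add: norm_minus_commute)
    moreover have "norm (xp - xt, yh - yt) \<le> d + norm (yh - yt)"
      unfolding d_def norm_Pair by (rule sqrt_sum_squares_le_sum) auto
    ultimately have "norm (xp - xt, yh - yt) \<le> d + (L / \<mu>y * a + e)" by simp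
    then have "L * norm (xp - xt, yh - yt) \<le> L * (d + (L / \<mu>y * a + e))"
      using L_pos by (intro mult_left_mono) auto
    then have "norm (gx xp yh - gx xt yt) \<le> L * (d + (L / \<mu>y * a + e))"
      using order_trans[OF norm_fst_le lip[OF pX t(1) yhY t(2)]] by simp
    then have "norm (gx xp yh - gx xt yt) * norm (xp - xs) \<le> L * (d + (L / \<mu>y * a + e)) * norm (xp - xs)"
      by (intro mult_right_mono) auto
    then show ?thesis using norm_cauchy_schwarz order_trans unfolding a_def by blast
  qed
  also have "gx xt yt \<bullet> (xp - xs) \<le> ((norm (xt - xs))\<^sup>2 - d\<^sup>2 - a\<^sup>2) / (2 * \<tau>)"
  proof -
    have "0 \<le> (xp - (xt - \<tau> *\<^sub>R gx xt yt)) \<bullet> (xs - xp)"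
      unfolding xp by (rule closest_point_vi[OF X(1,2) xsY(1)])
    then have "2 * \<tau> * (gx xt yt \<bullet> (xp - xs)) \<le> 2 * ((xp - xt) \<bullet> (xs - xp))"
      by (simp add: inner_diff_left inner_diff_right inner_add_left algebra_simps)
    also have "\<dots> = (norm (xt - xs))\<^sup>2 - d\<^sup>2 - a\<^sup>2"
      unfolding d_def a_def power2_norm_eq_inner by (simp add: algebra_simps inner_commute)
    finally show ?thesis using \<tau> by (simp add: field_simps)
  qed
  also have "L * (d + (L / \<mu>y * a + e)) * a + ((norm (xt - xs))\<^sup>2 - d\<^sup>2 - a\<^sup>2) / (2 * \<tau>)
      \<le> L\<^sup>2 / \<mu>y * a\<^sup>2 + L / 6 * e\<^sup>2 + (norm (xt - xs))\<^sup>2 / (2 * \<tau>)"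
  proof -
    \<comment> \<open>The negative squares are worth at least
      \<open>2 L (d\<^sup>2 + a\<^sup>2)\<close>. The weights in Young's inequality spend
      \<open>L / 2 + 3 L / 2\<close> on \<open>a\<^sup>2\<close>, exactly this amount.\<close>
    have "2 * L \<le> 1 / (2 * \<tau>)" using \<tau> by (simp add: field_simps)
    then have "2 * L * (d\<^sup>2 + a\<^sup>2) \<le> 1 / (2 * \<tau>) * (d\<^sup>2 + a\<^sup>2)" by (rule mult_right_mono) simp
    then have "2 * L * (d\<^sup>2 + a\<^sup>2) \<le> (d\<^sup>2 + a\<^sup>2) / (2 * \<tau>)" by simp
    moreover have "L * (d * a) \<le> L * (d\<^sup>2 / 2 + a\<^sup>2 / 2)"
      using L_pos zero_le_power2[of "d - a"] by (intro mult_left_mono) (auto simp: power2_eq_square algebra_simps)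
    moreover have "L * (e * a) \<le> L * (e\<^sup>2 / 6 + 3 / 2 * a\<^sup>2)"
      using L_pos zero_le_power2[of "e - 3 * a"] by (intro mult_left_mono) (auto simp: power2_eq_square algebra_simps)
    moreover have "0 \<le> L * d\<^sup>2" using L_pos by simp
    moreover have "L * (d + (L / \<mu>y * a + e)) * a = L * (d * a) + L\<^sup>2 / \<mu>y * a\<^sup>2 + L * (e * a)"
      by (simp add: algebra_simps power2_eq_square)
    moreover have "((norm (xt - xs))\<^sup>2 - d\<^sup>2 - a\<^sup>2) / (2 * \<tau>) = (norm (xt - xs))\<^sup>2 / (2 * \<tau>) - (d\<^sup>2 + a\<^sup>2) / (2 * \<tau>)"
      by (simp add: diff_divide_distrib add_divide_distrib)
    moreover have "L / 6 * e\<^sup>2 = L * e\<^sup>2 / 6" by simp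
    ultimately show ?thesis by (simp only: distrib_left distrib_right)
  qed
  \<comment> \<open>The constants add up to 17/16 + 1/6, below the 2 of the claim.\<close>
  also have "\<dots> \<le> L\<^sup>2 / \<mu>y * (17 / 16 * D) + L\<^sup>2 / \<mu>y / 6 * D + D / (2 * \<tau>)"
  proof (intro add_mono mult_mono divide_right_mono a2)
    show "L \<le> L\<^sup>2 / \<mu>y" using \<mu> L_pos by (simp add: field_simps power2_eq_square)
  qed (use \<mu> L_pos \<tau> in \<open>auto simp: e_def D_def\<close>)
  also have "\<dots> \<le> (2 * L\<^sup>2 / \<mu>y + 1 / (2 * \<tau>)) * D"
  proof -
    have "0 \<le> L\<^sup>2 / \<mu>y * D" using \<mu> by (simp add: D_def)
    then show ?thesis by (simp add: algebra_simps)
  qed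
  finally show ?thesis unfolding D_def by simp
qed

lemma psi_projected_step:
  assumes s: "saddle_pt xs ys" and t: "xt \<in> X" "yt \<in> Y" and \<tau>: "0 < \<tau>" "4 * \<tau> * L \<le> 1"
    and yp: "yp = closest_point Y (yt + \<tau> *\<^sub>R gy xt yt)"
  shows "psi ys - psi yp \<le> (2 * L\<^sup>2 / \<mu>x + 1 / (2 * \<tau>)) * ((norm (xt - xs))\<^sup>2 + (norm (yt - ys))\<^sup>2)"
  using saddle_problem.phi_projected_step[OF swap, of ys xs yt xt \<tau> yp] assms
  by (simp add: swap_saddle_pt swap_phi add.commute)

section \<open>Proximal regularisation\<close>

lemma prox:
  assumes "0 \<le> \<beta>"
  shows "saddle_problem X Y (\<lambda>x y. f x y + \<beta> / 2 * (norm (x - u))\<^sup>2) (\<lambda>x y. gx x y + \<beta> *\<^sub>R (x - u)) gy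
    (\<mu>x + \<beta>) \<mu>y (L + \<beta>)"
proof
  fix x x' y assume xy: "x \<in> X" "x' \<in> X" "y \<in> Y"
  have "\<beta> / 2 * (norm (x' - u))\<^sup>2 = \<beta> / 2 * (norm (x - u))\<^sup>2 + \<beta> * ((x - u) \<bullet> (x' - x)) + \<beta> / 2 * (norm (x' - x))\<^sup>2"
    unfolding power2_norm_eq_inner by (simp add: algebra_simps inner_commute)
  then show "f x y + \<beta> / 2 * (norm (x - u))\<^sup>2 + (gx x y + \<beta> *\<^sub>R (x - u)) \<bullet> (x' - x) + (\<mu>x + \<beta>) / 2 * (norm (x' - x))\<^sup>2
      \<le> f x' y + \<beta> / 2 * (norm (x' - u))\<^sup>2"
    using f_convex[OF xy] by (simp add: inner_add_left add_divide_distrib distrib_right)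
next
  fix x x' y y' assume xy: "x \<in> X" "x' \<in> X" "y \<in> Y" "y' \<in> Y"
  have "norm (gx x y + \<beta> *\<^sub>R (x - u) - (gx x' y' + \<beta> *\<^sub>R (x' - u)), gy x y - gy x' y') =
      norm ((gx x y - gx x' y', gy x y - gy x' y') + (\<beta> *\<^sub>R (x - x'), 0))"
    by (simp add: algebra_simps)
  also have "\<dots> \<le> L * norm (x - x', y - y') + \<beta> * norm (x - x')"
    using norm_triangle_ineq[of "(gx x y - gx x' y', gy x y - gy x' y')" "(\<beta> *\<^sub>R (x - x'), 0)"] lip[OF xy] assms
    by (simp add: norm_Pair)
  also have "\<dots> \<le> L * norm (x - x', y - y') + \<beta> * norm (x - x', y - y')"
    using assms by (intro add_left_mono mult_left_mono norm_fst_le)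
  finally show "norm (gx x y + \<beta> *\<^sub>R (x - u) - (gx x' y' + \<beta> *\<^sub>R (x' - u)), gy x y - gy x' y')
      \<le> (L + \<beta>) * norm (x - x', y - y')" by (simp add: distrib_right)
next
  fix x y y' assume "x \<in> X" "y \<in> Y" "y' \<in> Y"
  then show "f x y' + \<beta> / 2 * (norm (x - u))\<^sup>2
      \<le> f x y + \<beta> / 2 * (norm (x - u))\<^sup>2 + gy x y \<bullet> (y' - y) - \<mu>y / 2 * (norm (y' - y))\<^sup>2"
    using f_concave[of x y y'] by simp
qed (use X Y \<mu> assms in auto)

lemma prox_phi:
  assumes \<beta>: "0 \<le> \<beta>" and x: "x \<in> X"
  shows "saddle_problem.phi Y (\<lambda>x y. f x y + \<beta> / 2 * (norm (x - u))\<^sup>2) gy x = phi x + \<beta> / 2 * (norm (x - u))\<^sup>2"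
proof -
  interpret P: saddle_problem X Y "\<lambda>x y. f x y + \<beta> / 2 * (norm (x - u))\<^sup>2" "\<lambda>x y. gx x y + \<beta> *\<^sub>R (x - u)" gy
    "\<mu>x + \<beta>" \<mu>y "L + \<beta>" by (rule prox[OF \<beta>])
  obtain y where y: "max_pt x y" using max_pt_exists[OF x] by blast
  then have "P.max_pt x y" by (simp add: max_pt_def P.max_pt_def)
  then show ?thesis using phi_eq[OF x y] P.phi_eq[OF x] by simp
qed

text \<open>The two points solve subproblems with different centres. Adding their four variational
  inequalities leaves the operator difference, which strong monotonicity bounds below, against the
  shift of the centre.\<close>

lemma prox_saddle_perturbation:
  assumes in_XY: "x \<in> X" "y \<in> Y" "x' \<in> X" "y' \<in> Y"
    and 1: "0 \<le> (gx x y + \<beta> *\<^sub>R (x - u)) \<bullet> (x' - x)" "gy x y \<bullet> (y' - y) \<le> 0"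
    and 2: "0 \<le> (gx x' y' + \<beta> *\<^sub>R (x' - u')) \<bullet> (x - x')" "gy x' y' \<bullet> (y - y') \<le> 0"
  shows "(\<mu>x + \<beta>) * (norm (x - x'))\<^sup>2 + \<mu>y * (norm (y - y'))\<^sup>2 \<le> \<beta> * ((u - u') \<bullet> (x - x'))"
proof -
  have "0 \<le> (gx x y + \<beta> *\<^sub>R (x - u)) \<bullet> (x' - x) + (gx x' y' + \<beta> *\<^sub>R (x' - u')) \<bullet> (x - x')
      - gy x y \<bullet> (y' - y) - gy x' y' \<bullet> (y - y')"
    using 1 2 by linarith
  also have "\<dots> = \<beta> * ((u - u') \<bullet> (x - x')) - \<beta> * (norm (x - x'))\<^sup>2
      - ((gx x y - gx x' y') \<bullet> (x - x') - (gy x y - gy x' y') \<bullet> (y - y'))"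
    unfolding power2_norm_eq_inner by (simp add: algebra_simps inner_commute)
  finally show ?thesis
    using strongly_monotone[OF in_XY(1,3,2,4)] by (simp add: algebra_simps)
qed

end

subsection \<open>The accelerated inexact proximal point step\<close>

text \<open>
  With \<open>v = ((1 + \<theta>) u - x) / \<theta>\<close>, the extrapolated point is \<open>u = (x + \<theta> v) / (1 + \<theta>)\<close>: \<open>v\<close> is the auxiliary
  sequence of Nesterov's method, recovered from the state \<open>(x, u)\<close> of the algorithm.
\<close>

definition accel_potential ::
  "('a::real_inner \<Rightarrow> real) \<Rightarrow> real \<Rightarrow> real \<Rightarrow> 'a \<Rightarrow> 'a \<Rightarrow> 'a \<Rightarrow> real" where
  "accel_potential \<phi> \<mu> \<theta> xs x u =
    \<phi> x - \<phi> xs + \<mu> / 2 * (norm (xs - (1 / \<theta>) *\<^sub>R ((1 + \<theta>) *\<^sub>R u - x)))\<^sup>2"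

text \<open>Growth of the subproblem is tested at \<open>c\<close>, which differs from
  \<open>x'\<close> by \<open>\<theta>\<close> times \<open>xs\<close> minus the new auxiliary
  point. Since \<open>\<theta>\<^sup>2 (\<mu> + \<beta>) = \<mu>\<close>, this yields the new
  quadratic term; on the right, the surplus in \<open>xs - x\<close> cancels against the strong
  convexity of \<phi>. Growth is centred at the exact solution \<open>xp\<close> instead of
  \<open>x'\<close>; Young's inequality with weight \<open>s\<close> separates them, and the error
  \<open>e\<close> becomes \<open>e / s\<close>.\<close>

lemma accel_potential_step:
  fixes \<phi> :: "'a::real_inner \<Rightarrow> real"
  assumes \<theta>: "0 < \<theta>" "\<theta> \<le> 1" and \<mu>\<beta>: "0 < \<mu>" "0 \<le> \<beta>" "\<theta>\<^sup>2 * (\<mu> + \<beta>) = \<mu>" and s: "0 < s" "s \<le> 1"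
    and c: "c = \<theta> *\<^sub>R xs + (1 - \<theta>) *\<^sub>R x" and u': "u' = x' + ((1 - \<theta>) / (1 + \<theta>)) *\<^sub>R (x' - x)"
    and convex: "\<phi> c \<le> \<theta> * \<phi> xs + (1 - \<theta>) * \<phi> x - \<mu> / 2 * \<theta> * (1 - \<theta>) * (norm (xs - x))\<^sup>2"
    and growth_c: "P + (\<mu> + \<beta>) / 2 * (norm (c - xp))\<^sup>2 \<le> \<phi> c + \<beta> / 2 * (norm (c - u))\<^sup>2"
    and growth: "P + (\<mu> + \<beta>) / 2 * (norm (x' - xp))\<^sup>2 \<le> \<phi> x' + \<beta> / 2 * (norm (x' - u))\<^sup>2"
    and inexact: "\<phi> x' + \<beta> / 2 * (norm (x' - u))\<^sup>2 \<le> P + e"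
    and opt: "\<phi> xs \<le> \<phi> x'"
  shows "(1 - s) * accel_potential \<phi> \<mu> \<theta> xs x' u' \<le> (1 - \<theta>) * accel_potential \<phi> \<mu> \<theta> xs x u + e / s"
proof -
  define a where "a = xs - (1 / \<theta>) *\<^sub>R ((1 + \<theta>) *\<^sub>R u' - x')"
  define b where "b = xs - (1 / \<theta>) *\<^sub>R ((1 + \<theta>) *\<^sub>R u - x)"
  define d where "d = x' - xp"
  have "(1 + \<theta>) *\<^sub>R u' = (1 + \<theta>) *\<^sub>R x' + (1 - \<theta>) *\<^sub>R (x' - x)"
    using \<theta> by (simp add: u' scaleR_add_right)
  then have "c - x' = \<theta> *\<^sub>R a"
    using \<theta> by (simp add: a_def c scaleR_diff_right) (simp add: algebra_simps)
  then have ca: "c - xp = \<theta> *\<^sub>R a + d" by (simp add: d_def algebra_simps)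
  have cu: "(1 + \<theta>) *\<^sub>R (c - u) = \<theta> *\<^sub>R (b + \<theta> *\<^sub>R (xs - x))"
    using \<theta> by (simp add: b_def c scaleR_diff_right scaleR_add_right) (simp add: algebra_simps)
  define B where "B = (norm b)\<^sup>2"
  define N where "N = (norm (xs - x))\<^sup>2"
  have "0 \<le> \<theta> * (norm (b - (xs - x)))\<^sup>2" using \<theta> by simp
  also have "\<dots> = (1 + \<theta>) * (B + \<theta> * N) - (norm (b + \<theta> *\<^sub>R (xs - x)))\<^sup>2"
    unfolding B_def N_def power2_norm_eq_inner
    by (simp add: algebra_simps inner_commute power2_eq_square)
  finally have 1: "(norm (b + \<theta> *\<^sub>R (xs - x)))\<^sup>2 \<le> (1 + \<theta>) * (B + \<theta> * N)" by simp
  have "(1 + \<theta>)\<^sup>2 * (norm (c - u))\<^sup>2 = \<theta>\<^sup>2 * (norm (b + \<theta> *\<^sub>R (xs - x)))\<^sup>2"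
    using arg_cong[OF cu, of "\<lambda>v. (norm v)\<^sup>2"] by (simp add: power_mult_distrib)
  then have "\<beta> * ((1 + \<theta>)\<^sup>2 * (norm (c - u))\<^sup>2) = \<beta> * (\<theta>\<^sup>2 * (norm (b + \<theta> *\<^sub>R (xs - x)))\<^sup>2)" by simp
  also have "\<dots> \<le> \<beta> * (\<theta>\<^sup>2 * ((1 + \<theta>) * (B + \<theta> * N)))"
    using 1 \<mu>\<beta> by (intro mult_left_mono) auto
  also have "\<dots> = (\<beta> * \<theta>\<^sup>2) * (1 + \<theta>) * (B + \<theta> * N)" by simp
  also have "\<beta> * \<theta>\<^sup>2 = \<mu> * (1 - \<theta>) * (1 + \<theta>)"
    using \<mu>\<beta>(3) by (simp add: algebra_simps power2_eq_square)
  also have "\<mu> * (1 - \<theta>) * (1 + \<theta>) * (1 + \<theta>) * (B + \<theta> * N) = (1 + \<theta>)\<^sup>2 * (\<mu> * (1 - \<theta>) * (B + \<theta> * N))"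
    by (simp add: power2_eq_square)
  finally have "(1 + \<theta>)\<^sup>2 * (\<beta> * (norm (c - u))\<^sup>2) \<le> (1 + \<theta>)\<^sup>2 * (\<mu> * (1 - \<theta>) * (B + \<theta> * N))"
    by (simp add: mult.left_commute)
  then have cu2: "\<beta> * (norm (c - u))\<^sup>2 \<le> \<mu> * (1 - \<theta>) * (B + \<theta> * N)"
    using \<theta> by (simp add: mult_le_cancel_left)
  define A where "A = (norm a)\<^sup>2"
  define D where "D = (norm d)\<^sup>2"
  have "0 \<le> (norm ((s * \<theta>) *\<^sub>R a + d))\<^sup>2" by simp
  also have "\<dots> = s * ((norm (\<theta> *\<^sub>R a + d))\<^sup>2 - (1 - s) * \<theta>\<^sup>2 * A + (1 / s - 1) * D)"
    unfolding A_def D_def power2_norm_eq_inner using s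
    by (simp add: algebra_simps inner_commute power2_eq_square)
  finally have young: "(1 - s) * \<theta>\<^sup>2 * A - (1 / s - 1) * D \<le> (norm (c - xp))\<^sup>2"
    unfolding ca using s by (simp add: zero_le_mult_iff)
  \<comment> \<open>An inexact value controls the inexact point: growth at \<open>x'\<close> bounds
    its distance to \<open>xp\<close> by the same \<open>e\<close>.\<close>
  have De: "(\<mu> + \<beta>) / 2 * D \<le> e" using growth inexact by (simp add: D_def d_def)
  have "\<phi> x' - \<phi> xs + (1 - s) * (\<mu> / 2 * A) \<le> (1 - \<theta>) * (\<phi> x - \<phi> xs + \<mu> / 2 * B) + e / s"
  proof -
    define c1 where "c1 = (1 - s) * (\<mu> / 2 * A)"
    define c2 where "c2 = (1 / s - 1) * ((\<mu> + \<beta>) / 2 * D)"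
    define c3 where "c3 = (\<mu> + \<beta>) / 2 * (norm (c - xp))\<^sup>2"
    define n1 where "n1 = \<mu> / 2 * \<theta> * (1 - \<theta>) * N"
    define b1 where "b1 = (1 - \<theta>) * (\<mu> / 2 * B)"
    define k1 where "k1 = \<beta> / 2 * (norm (c - u))\<^sup>2"
    define k2 where "k2 = \<beta> / 2 * (norm (x' - u))\<^sup>2"
    define e1 where "e1 = e / s"
    have "c1 = (1 - s) * (\<theta>\<^sup>2 * (\<mu> + \<beta>) / 2 * A)" by (simp only: c1_def \<mu>\<beta>(3))
    then have "c1 - c2 = (\<mu> + \<beta>) / 2 * ((1 - s) * \<theta>\<^sup>2 * A - (1 / s - 1) * D)"
      unfolding c2_def by (simp only: right_diff_distrib) (simp add: mult_ac)
    also have "\<dots> \<le> c3"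
      unfolding c3_def using young \<mu>\<beta> by (intro mult_left_mono) auto
    finally have 1: "c1 - c2 \<le> c3" .
    have "c2 \<le> (1 / s - 1) * e" unfolding c2_def using De s by (intro mult_left_mono) auto
    then have 2: "c2 \<le> e1 - e" by (simp add: e1_def algebra_simps)
    have 3: "k1 \<le> b1 + n1" using cu2 by (simp add: k1_def b1_def n1_def field_simps)
    have 4: "P + c3 \<le> \<phi> c + k1" "\<phi> c \<le> \<theta> * \<phi> xs + (1 - \<theta>) * \<phi> x - n1" "\<phi> x' + k2 \<le> P + e"
      using growth_c convex inexact by (simp_all add: c3_def k1_def k2_def n1_def N_def)
    have 5: "0 \<le> k2" using \<mu>\<beta> by (simp add: k2_def)
    have "(1 - \<theta>) * (\<phi> x - \<phi> xs + \<mu> / 2 * B) = (1 - \<theta>) * \<phi> x - \<phi> xs + \<theta> * \<phi> xs + b1"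
      by (simp add: b1_def algebra_simps)
    then show ?thesis using 1 2 3 4 5 unfolding c1_def[symmetric] e1_def[symmetric] by linarith
  qed
  \<comment> \<open>By \<open>opt\<close> the value gap is nonnegative, so the loss
    \<open>1 - s\<close> may be put on the whole potential.\<close>
  moreover have "(1 - s) * (\<phi> x' - \<phi> xs) \<le> 1 * (\<phi> x' - \<phi> xs)"
    using s opt by (intro mult_right_mono) auto
  ultimately show ?thesis
    unfolding accel_potential_def a_def[symmetric] b_def[symmetric] A_def[symmetric] B_def[symmetric]
    by (simp add: distrib_left)
qed

subsection \<open>Linear recursions for the expected potentials\<close>

text \<open>
  \<open>S\<close> is the accelerated potential and \<open>W\<close> the squared distance of the warm start. The lower bound on \<open>\<beta>\<close> is
  only needed for the initial value of \<open>W\<close>.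
\<close>

lemma accelerated_recursion:
  fixes S W :: "nat \<Rightarrow> real"
  assumes \<rho>: "0 < \<rho>" "\<rho> < \<theta>" "\<theta> \<le> 1" and pos: "0 < C" "0 < M" "0 < m" "0 < \<mu>" "0 \<le> \<beta>" "0 \<le> \<Delta>"
    and r: "r = 1 - \<rho>" and s: "s = (\<theta> - \<rho>) / (2 * r)"
    and M1: "2 \<le> M * r" and M2: "1728 * \<beta> * C \<le> M * (\<mu> * m * r\<^sup>2 * (\<theta> - \<rho>)\<^sup>2)"
    and \<beta>: "\<mu> \<le> 72 * \<beta>"
    and S0: "S 0 \<le> 2 * \<Delta>" and W0: "W 0 \<le> 2 * \<Delta> / m"
    and S: "\<And>k. (1 - s) * S (Suc k) \<le> (1 - \<theta>) * S k + C / (4 * M) * W k / s"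
    and W: "\<And>k. W (Suc k) \<le> 17 / 8 * W k / (4 * M) + 2 * \<beta> / (m * \<mu>) * (S (Suc k) + S k)"
  shows "S k \<le> 2 * r\<^sup>2 / (\<theta> - \<rho>)\<^sup>2 * \<Delta> * r ^ k" "W k \<le> 2 * M * \<Delta> / C * r ^ Suc k"
proof -
  define g where "g = \<theta> - \<rho>"
  \<comment> \<open>\<open>s\<close> makes \<open>(1 - s) r\<close> exceed
    \<open>1 - \<theta>\<close> by \<open>g / 2\<close>. The error term contributes
    \<open>r\<^sup>2 / g\<close>, and \<open>R\<close> is chosen to make this
    \<open>R g / 2\<close>, so that the excess is used up exactly.\<close>
  define R where "R = 2 * r\<^sup>2 / g\<^sup>2"
  have g: "0 < g" "g \<le> r" "r < 1" "0 < r" using \<rho> by (auto simp: g_def r)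
  have g2: "g\<^sup>2 \<le> r\<^sup>2" using g by (intro power_mono) auto
  have s01: "0 < s" "s < 1" "(1 - s) * r = (1 - \<theta>) + g / 2"
    using \<rho> g by (auto simp: s g_def r field_simps)
  have R: "2 \<le> R" using g g2 by (simp add: R_def field_simps)
  have Rg: "R * g\<^sup>2 = 2 * r\<^sup>2" using g by (simp add: R_def)
  have M3: "1728 * \<beta> * C \<le> M * (\<mu> * m * r\<^sup>2 * g\<^sup>2)" using M2 by (simp add: g_def)
  have key: "S k \<le> R * \<Delta> * r ^ k \<and> W k \<le> 2 * M * \<Delta> / C * r ^ Suc k"
  proof (induction k)
    case 0
    have "2 * \<Delta> \<le> R * \<Delta>" using R pos by (intro mult_right_mono) auto
    moreover have "2 * \<Delta> / m \<le> 2 * M * \<Delta> / C * r"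
    proof -
      have "\<mu> * C \<le> 72 * \<beta> * C" using \<beta> pos by (intro mult_right_mono) auto
      also have "\<dots> \<le> 1728 * \<beta> * C" using pos by simp
      also have "\<dots> \<le> M * (\<mu> * m * r\<^sup>2 * g\<^sup>2)" by (rule M3)
      also have "\<dots> = \<mu> * (M * m * r) * (r * g\<^sup>2)" by (simp add: power2_eq_square)
      also have "\<dots> \<le> \<mu> * (M * m * r) * 1"
        using pos g by (intro mult_left_mono mult_le_one power_le_one) auto
      finally have "C \<le> M * m * r" using pos by simp
      then have "2 * \<Delta> * C \<le> 2 * \<Delta> * (M * m * r)" using pos by (intro mult_left_mono) auto
      then show ?thesis using pos by (simp add: field_simps)
    qed
    ultimately show ?case using S0 W0 by simp
  next
    case (Suc k)
    define E where "E = \<Delta> * r ^ k"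
    have E: "0 \<le> E" using pos g by (simp add: E_def)
    have Sk: "S k \<le> R * E" and Wk: "W k \<le> 2 * M / C * r * E"
      using Suc by (auto simp: E_def mult_ac)
    have "C / (4 * M) * W k \<le> C / (4 * M) * (2 * M / C * r * E)"
      using Wk pos by (intro mult_left_mono) auto
    also have "\<dots> = r * E / 2" using pos by (simp add: field_simps)
    finally have "C / (4 * M) * W k / s \<le> r * E / 2 / s"
      using s01 by (intro divide_right_mono) auto
    also have "\<dots> = r\<^sup>2 / g * E" using g by (simp add: s g_def field_simps power2_eq_square)
    also have "r\<^sup>2 / g = R * g / 2" using Rg g by (simp add: field_simps power2_eq_square)
    finally have "(1 - s) * S (Suc k) \<le> (1 - \<theta>) * (R * E) + R * g / 2 * E"
      using order_trans[OF S[of k]] Sk mult_left_mono[OF Sk, of "1 - \<theta>"] \<rho> by fastforce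
    also have "\<dots> = ((1 - \<theta>) + g / 2) * (R * E)" by (simp add: algebra_simps)
    also have "\<dots> = (1 - s) * (r * (R * E))" unfolding s01(3)[symmetric] by simp
    finally have S1: "S (Suc k) \<le> r * (R * E)" using s01 by simp
    have "r * (R * E) \<le> 1 * (R * E)" using g E R by (intro mult_right_mono) auto
    then have SS: "S (Suc k) + S k \<le> 2 * (R * E)" using S1 Sk by linarith
    \<comment> \<open>The budget for \<open>W\<close> is split into 17/32 for the inner error and
      15/32 for the motion of the target.\<close>
    have 1: "17 / 8 * W k / (4 * M) \<le> 17 / 32 * (2 * M / C * r\<^sup>2 * E)"
    proof -
      have "17 / 8 * W k / (4 * M) = 17 / 32 / M * W k" by simp
      also have "\<dots> \<le> 17 / 32 / M * (2 * M / C * r * E)" using Wk pos by (intro mult_left_mono) auto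
      also have "\<dots> = 17 / 32 * (2 / C * r * E) * 1" using pos by simp
      also have "\<dots> \<le> 17 / 32 * (2 / C * r * E) * (M * r)"
        using M1 pos g E by (intro mult_left_mono) auto
      also have "\<dots> = 17 / 32 * (2 * M / C * r\<^sup>2 * E)" by (simp add: power2_eq_square)
      finally show ?thesis .
    qed
    have 2: "2 * \<beta> / (m * \<mu>) * (S (Suc k) + S k) \<le> 15 / 32 * (2 * M / C * r\<^sup>2 * E)"
    proof -
      have "8 * \<beta> * C * r\<^sup>2 \<le> 8 / 1728 * (M * (\<mu> * m * r\<^sup>2 * g\<^sup>2)) * 1"
      proof -
        have "8 * \<beta> * C * r\<^sup>2 \<le> 8 * \<beta> * C * 1"
          using pos g by (intro mult_left_mono power_le_one) auto
        then show ?thesis using M3 by simp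
      qed
      also have "\<dots> \<le> 15 / 16 * (M * (\<mu> * m * r\<^sup>2 * g\<^sup>2))" using pos g by simp
      finally have "8 * \<beta> * C * r\<^sup>2 \<le> 15 / 16 * M * r\<^sup>2 * (\<mu> * m * g\<^sup>2)"
        by (simp add: mult_ac)
      then have "4 * \<beta> / (m * \<mu>) * R \<le> 15 / 16 * M * r\<^sup>2 / C"
        using pos g by (simp add: R_def field_simps)
      from mult_right_mono[OF this E]
      have "2 * \<beta> / (m * \<mu>) * (2 * (R * E)) \<le> 15 / 32 * (2 * M / C * r\<^sup>2 * E)"
        by (simp add: mult_ac)
      moreover have "2 * \<beta> / (m * \<mu>) * (S (Suc k) + S k) \<le> 2 * \<beta> / (m * \<mu>) * (2 * (R * E))"
        using SS pos by (intro mult_left_mono) auto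
      ultimately show ?thesis by linarith
    qed
    have "W (Suc k) \<le> 2 * M / C * r\<^sup>2 * E"
      using order_trans[OF W[of k] add_mono[OF 1 2]] by (simp add: mult_ac flip: distrib_right)
    then show ?case using S1 by (simp add: E_def power2_eq_square mult_ac)
  qed
  then show "S k \<le> 2 * r\<^sup>2 / (\<theta> - \<rho>)\<^sup>2 * \<Delta> * r ^ k" "W k \<le> 2 * M * \<Delta> / C * r ^ Suc k"
    by (auto simp: R_def g_def)
qed

text \<open>
  \<open>D\<close> and \<open>U\<close> are the squared distances of \<open>x\<^sub>k\<close> and \<open>u\<^sub>k\<close> to the solution. The hypotheses \<open>b \<le> 2 r\<close> and
  \<open>\<gamma> \<le> r\<close> let the proximal step absorb the index shifts of the extrapolation.
\<close>

lemma unaccelerated_recursion: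
  fixes D U W :: "nat \<Rightarrow> real"
  assumes r: "0 < r" "r \<le> 1" and pos: "0 < M" "0 < m" "0 \<le> \<beta>" "0 \<le> A" "0 \<le> b" "0 \<le> \<gamma>"
    and br: "b \<le> 2 * r" "b \<le> 1 / 72" and \<gamma>: "\<gamma> \<le> r"
    and M1: "2 \<le> M * r" and M2: "1728 * \<beta> \<le> M * (m * r\<^sup>2)"
    and D0: "D 0 \<le> A" and U0: "U 0 \<le> A" and W0: "W 0 \<le> A"
    and D: "\<And>k. D (Suc k) \<le> 17 / 8 * W k / (4 * M) + 2 * b\<^sup>2 * U k"
    and U: "\<And>k. U (Suc k) \<le> 3 * (2 * D (Suc k) + \<gamma> * D k)"
    and W: "\<And>k. W (Suc k) \<le> 17 / 8 * W k / (4 * M) + \<beta> / m * (U (Suc k) + U k)"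
  shows "U k \<le> 9 * A * r ^ k" "W k \<le> M * A / 2 * r ^ Suc k"
proof -
  have "D k \<le> A * r ^ k \<and> U k \<le> 9 * A * r ^ k \<and> W k \<le> M * A / 2 * r ^ Suc k"
  proof (induction k)
    case 0
    have "2 * A \<le> M * r * A" using M1 pos by (intro mult_right_mono) auto
    then show ?case using D0 U0 W0 pos by (simp add: mult_ac)
  next
    case (Suc k)
    define E where "E = A * r ^ k"
    have E: "0 \<le> E" using pos r by (simp add: E_def)
    have Dk: "D k \<le> E" and Uk: "U k \<le> 9 * E" and Wk: "W k \<le> M / 2 * r * E"
      using Suc by (auto simp: E_def mult_ac)
    have 1: "17 / 8 * W k / (4 * M) \<le> 17 / 64 * (r * E)"
    proof -
      have "17 / 8 * W k / (4 * M) = 17 / 32 / M * W k" by simp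
      also have "\<dots> \<le> 17 / 32 / M * (M / 2 * r * E)" using Wk pos by (intro mult_left_mono) auto
      finally show ?thesis using pos by simp
    qed
    \<comment> \<open>One factor \<open>b\<close> pays for the next power of \<open>r\<close>, the
      other supplies the small constant; then 17/64 + 1/2 < 1 closes the bound on
      \<open>D\<close>.\<close>
    have "b * b \<le> 1 / 72 * (2 * r)" using br pos by (intro mult_mono) auto
    then have "b\<^sup>2 \<le> r / 36" by (simp add: power2_eq_square)
    then have "2 * b\<^sup>2 * U k \<le> 2 * (r / 36) * (9 * E)"
      using Uk E r by (intro order_trans[OF mult_left_mono[OF Uk] mult_right_mono] mult_left_mono) auto
    then have D1: "D (Suc k) \<le> r * E"
      using D[of k] 1 mult_nonneg_nonneg[of r E] r E by linarith
    have "\<gamma> * D k \<le> \<gamma> * E" using Dk pos by (intro mult_left_mono)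
    also have "\<dots> \<le> r * E" using \<gamma> E by (intro mult_right_mono)
    finally have "3 * (2 * D (Suc k) + \<gamma> * D k) \<le> 3 * (2 * (r * E) + r * E)"
      using D1 by (intro mult_left_mono add_mono) auto
    with U[of k] have U1: "U (Suc k) \<le> 9 * (r * E)" by (rule order_trans[THEN order_trans]) simp
    have "r * E \<le> 1 * E" using r E by (intro mult_right_mono) auto
    then have "U (Suc k) + U k \<le> 18 * E" using U1 Uk by linarith
    then have "\<beta> / m * (U (Suc k) + U k) \<le> \<beta> / m * (18 * E)" using pos by (intro mult_left_mono) auto
    also have "\<dots> \<le> M * r\<^sup>2 / 96 * E"
    proof -
      have "\<beta> / m * 18 \<le> M * r\<^sup>2 / 96" using M2 pos by (simp add: field_simps)
      from mult_right_mono[OF this E] show ?thesis by simp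
    qed
    finally have 2: "\<beta> / m * (U (Suc k) + U k) \<le> M * r\<^sup>2 * E / 96" by simp
    have "2 * (r * E) \<le> M * r * (r * E)" using M1 r E by (intro mult_right_mono) auto
    then have 3: "2 * (r * E) \<le> M * r\<^sup>2 * E" by (simp add: power2_eq_square mult_ac)
    have "W (Suc k) \<le> M * r\<^sup>2 * E / 2" using W[of k] 1 2 3 mult_nonneg_nonneg[of r E] r E by linarith
    then show ?case using D1 U1 by (simp add: E_def power2_eq_square mult_ac)
  qed
  then show "U k \<le> 9 * A * r ^ k" "W k \<le> M * A / 2 * r ^ Suc k" by auto
qed

subsection \<open>AL-SVRE\<close>

lemma finite_set_alsvre_step: "n \<ge> 1 \<Longrightarrow> finite (set_pmf (alsvre_step X Y n G \<beta> q p \<tau> T s))"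
  by (auto simp: alsvre_step_def lsvre_def Let_def finite_set_lsvre_state)

lemma finite_set_alsvre_state: "n \<ge> 1 \<Longrightarrow> finite (set_pmf (alsvre_state X Y n G z0 \<beta> q p \<tau> T k))"
  by (induction k) (auto simp: finite_set_alsvre_step)

lemma average_prox_grad:
  fixes G :: "nat \<Rightarrow> 'a::real_inner \<times> 'b::real_inner \<Rightarrow> 'a \<times> 'b"
  assumes "n \<ge> 1"
  shows "average n (\<lambda>i. prox_grad \<beta> u (G i)) = prox_grad \<beta> u (average n G)"
proof
  fix z
  have "average n (\<lambda>i. prox_grad \<beta> u (G i)) z =
      ((\<Sum>i = 1..n. G i z) + real n *\<^sub>R (\<beta> *\<^sub>R (fst z - u), 0)) /\<^sub>R real n"
    by (simp add: average_def prox_grad_def prod_eq_iff fst_sum snd_sum sum.distrib sum_constant_scaleR)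
  also have "\<dots> = prox_grad \<beta> u (average n G) z"
    using assms by (simp add: average_def prox_grad_def prod_eq_iff scaleR_add_right)
  finally show "average n (\<lambda>i. prox_grad \<beta> u (G i)) z = prox_grad \<beta> u (average n G) z" .
qed

text \<open>The proximal term adds the same vector \<open>w\<close> to every difference
  \<open>d i\<close>, so the cross term sees only their average, of norm at most \<open>L N\<close>.
  The three terms form the perfect square of \<open>L + \<beta>\<close>.\<close>

lemma average_smooth_on_prox:
  fixes G :: "nat \<Rightarrow> 'a::real_inner \<times> 'b::real_inner \<Rightarrow> 'a \<times> 'b"
  assumes sm: "average_smooth_on Z n L G" and n: "n \<ge> 1" and L: "L \<ge> 0" and \<beta>: "\<beta> \<ge> 0"
  shows "average_smooth_on Z n (L + \<beta>) (\<lambda>i. prox_grad \<beta> u (G i))"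
  unfolding average_smooth_on_def
proof (intro ballI)
  fix z z' assume z: "z \<in> Z" "z' \<in> Z"
  define w :: "'a \<times> 'b" where "w = (\<beta> *\<^sub>R (fst z - fst z'), 0)"
  define d where "d i = G i z - G i z'" for i
  define N where "N = norm (z - z')"
  have n0: "real n > 0" using n by simp
  have "norm (fst (z - z')) \<le> N" unfolding N_def by (metis norm_fst_le prod.collapse)
  then have wN: "norm w \<le> \<beta> * N"
    using \<beta> by (auto simp: w_def norm_Pair intro!: mult_left_mono)
  have "norm (average n G z - average n G z') \<le> L * N"
    unfolding N_def by (rule average_smooth_on_lipschitz[OF sm n L z])
  moreover have "average n G z - average n G z' = (\<Sum>i = 1..n. d i) /\<^sub>R real n"
    by (simp add: average_def d_def sum_subtractf scaleR_diff_right)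
  ultimately have avg: "norm ((\<Sum>i = 1..n. d i) /\<^sub>R real n) \<le> L * N" by simp
  have "(norm (d i + w))\<^sup>2 = (norm (d i))\<^sup>2 + 2 * (d i \<bullet> w) + (norm w)\<^sup>2" for i
    unfolding power2_norm_eq_inner by (simp add: algebra_simps inner_commute)
  moreover have "prox_grad \<beta> u (G i) z - prox_grad \<beta> u (G i) z' = d i + w" for i
    by (simp add: prox_grad_def w_def d_def prod_eq_iff algebra_simps)
  ultimately have "(\<Sum>i = 1..n. (norm (prox_grad \<beta> u (G i) z - prox_grad \<beta> u (G i) z'))\<^sup>2) / real n =
      (\<Sum>i = 1..n. (norm (d i))\<^sup>2) / real n + 2 * (((\<Sum>i = 1..n. d i) /\<^sub>R real n) \<bullet> w) + (norm w)\<^sup>2"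
    using n0 by (simp add: sum.distrib add_divide_distrib inner_sum_left divide_inverse_commute distrib_left
        flip: sum_distrib_left)
  also have "\<dots> \<le> L\<^sup>2 * N\<^sup>2 + 2 * (L * N * (\<beta> * N)) + (\<beta> * N)\<^sup>2"
  proof (intro add_mono)
    show "(\<Sum>i = 1..n. (norm (d i))\<^sup>2) / real n \<le> L\<^sup>2 * N\<^sup>2"
      using sm z by (simp add: average_smooth_on_def d_def N_def)
    have "((\<Sum>i = 1..n. d i) /\<^sub>R real n) \<bullet> w \<le> norm ((\<Sum>i = 1..n. d i) /\<^sub>R real n) * norm w"
      by (rule norm_cauchy_schwarz)
    also have "\<dots> \<le> L * N * (\<beta> * N)" using L by (intro mult_mono avg wN) (auto simp: N_def)
    finally show "2 * (((\<Sum>i = 1..n. d i) /\<^sub>R real n) \<bullet> w) \<le> 2 * (L * N * (\<beta> * N))" by simp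
    show "(norm w)\<^sup>2 \<le> (\<beta> * N)\<^sup>2" using wN by (intro power_mono) auto
  qed
  also have "\<dots> = (L + \<beta>)\<^sup>2 * N\<^sup>2" by (simp add: power2_eq_square algebra_simps)
  finally show "(\<Sum>i = 1..n. (norm (prox_grad \<beta> u (G i) z - prox_grad \<beta> u (G i) z'))\<^sup>2) / real n
      \<le> (L + \<beta>)\<^sup>2 * (norm (z - z'))\<^sup>2" by (simp add: N_def)
qed

section \<open>Setting and constants\<close>

locale alsvre_problem =
  fixes X :: "'a::euclidean_space set" and Y :: "'b::euclidean_space set"
    and n :: nat
    and f :: "nat \<Rightarrow> 'a \<times> 'b \<Rightarrow> real" and G :: "nat \<Rightarrow> 'a \<times> 'b \<Rightarrow> 'a \<times> 'b"
    and L \<mu>x \<mu>y \<beta> q p \<rho> \<tau> M :: real and T :: nat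
  assumes X: "closed X" "convex X" "X \<noteq> {}" and Y: "closed Y" "convex Y" "Y \<noteq> {}"
    and n: "n \<ge> 1"
    and f_differentiable: "\<And>i. i \<in> {1..n} \<Longrightarrow> has_gradient_on (f i) (G i) (X \<times> Y)"
    and f_smooth: "average_smooth_on (X \<times> Y) n L G"
    and f_strong: "convex_concave_on X Y \<mu>x \<mu>y (average n f)"
    and \<mu>: "\<mu>x > 0" "\<mu>y > 0" "\<mu>x \<le> L" "\<mu>y \<le> L"
    and \<beta>: "\<beta> \<ge> 0"
    and q: "q = \<mu>x / (\<mu>x + \<beta>)"
    and p: "p = 1 / (2 * real n)"
    and \<tau>: "\<tau> = 1 / (4 * sqrt (real n) * (L + \<beta>))"
    and \<rho>: "0 < \<rho>" "\<rho> < sqrt q"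
    and M: "M = 2 / (1 - \<rho>) +
          1728 * \<beta> * (L + \<beta>) * (7 * (L + \<beta>) + 2 * sqrt (real n) * \<mu>y) /
          (\<mu>x * \<mu>y * min \<mu>x \<mu>y * (1 - \<rho>)\<^sup>2 * (sqrt q - \<rho>)\<^sup>2)"
    and T: "T = nat \<lceil>4 * (real n + 2 * sqrt (real n) * (L + \<beta>) / min (\<mu>x + \<beta>) \<mu>y) * ln (12 * M)\<rceil>"
begin

abbreviation "gx x y \<equiv> fst (average n G (x, y))"
abbreviation "gy x y \<equiv> snd (average n G (x, y))"

definition m where "m = min \<mu>x \<mu>y"
definition \<theta> where "\<theta> = sqrt q"
definition r where "r = 1 - \<rho>"
definition \<gamma> where "\<gamma> = (1 - \<theta>) / (1 + \<theta>)"
text \<open>The primal loss per unit of squared inner error in \<open>step_phi\<close>, enlarged to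
  the combination that occurs in \<open>M\<close>; see \<open>M_eq\<close>.\<close>

definition C where "C = (L + \<beta>) * (7 * (L + \<beta>) + 2 * sqrt (real n) * \<mu>y) / \<mu>y"
text \<open>Twice \<open>K\<close> is the constant
  \<open>2 L\<^sup>2 / \<mu>x + 1 / (2 \<tau>)\<close> of the dual projected step for
  \<open>f\<close> itself.\<close>

definition K where "K = L / \<mu>x * L + sqrt (real n) * (L + \<beta>)"

lemma L_pos: "0 < L" using \<mu> by simp

lemma sqrt_n: "1 \<le> sqrt (real n)" using n by simp

lemma m_pos: "0 < m" using \<mu> by (simp add: m_def)
lemma m_le: "m \<le> \<mu>x" "m \<le> \<mu>y" by (simp_all add: m_def)

lemma \<theta>: "0 < \<theta>" "\<theta> \<le> 1" "\<theta>\<^sup>2 * (\<mu>x + \<beta>) = \<mu>x"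
proof -
  have "0 < \<mu>x + \<beta>" using \<mu> \<beta> by simp
  then have "0 < q" "q \<le> 1" "q * (\<mu>x + \<beta>) = \<mu>x" using \<mu> \<beta> by (auto simp: q)
  then show "0 < \<theta>" "\<theta> \<le> 1" "\<theta>\<^sup>2 * (\<mu>x + \<beta>) = \<mu>x"
    by (auto simp: \<theta>_def)
qed

lemma r: "0 < r" "r < 1" "\<theta> - \<rho> \<le> r" "0 < \<theta> - \<rho>" 
  using \<rho> \<theta> by (auto simp: r_def simp flip: \<theta>_def)

lemma \<gamma>: "0 \<le> \<gamma>" "\<gamma> \<le> 1" "\<gamma> \<le> r"
proof -
  show "0 \<le> \<gamma>" using \<theta> by (simp add: \<gamma>_def)
  have "\<gamma> \<le> (1 - \<theta>) / 1" unfolding \<gamma>_def using \<theta> by (intro divide_left_mono) auto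
  then show "\<gamma> \<le> 1" "\<gamma> \<le> r" using r \<theta> \<rho> by (auto simp: r_def simp flip: \<theta>_def)
qed

lemma M_eq: "M = 2 / r + 1728 * \<beta> * C / (\<mu>x * m * r\<^sup>2 * (\<theta> - \<rho>)\<^sup>2)"
  unfolding M C_def m_def[symmetric] r_def[symmetric] \<theta>_def[symmetric]
  by (simp only: times_divide_eq_right divide_divide_eq_left mult_ac)

lemma C_pos: "0 < C" using \<mu> \<beta> L_pos by (simp add: C_def add_pos_nonneg)

lemma C_ge: "7 * (L + \<beta>)\<^sup>2 / \<mu>y + 2 * sqrt (real n) * (L + \<beta>) = C"
  using \<mu> by (simp add: C_def field_simps power2_eq_square)

lemma M_r: "2 \<le> M * r"
proof -
  have "2 / r \<le> M" using \<mu> \<beta> C_pos r m_pos unfolding M_eq by simp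
  then show ?thesis using r by (simp add: field_simps)
qed

lemma M_pos: "0 < M"
proof -
  have "0 < M * r" using M_r by simp
  then show ?thesis using r by (simp add: zero_less_mult_iff)
qed

lemma M_C: "1728 * \<beta> * C \<le> M * (\<mu>x * m * r\<^sup>2 * (\<theta> - \<rho>)\<^sup>2)"
proof -
  define Q where "Q = \<mu>x * m * r\<^sup>2 * (\<theta> - \<rho>)\<^sup>2"
  have Q: "0 < Q" using \<mu> r m_pos by (simp add: Q_def)
  have "M = 2 / r + 1728 * \<beta> * C / Q" unfolding Q_def by (rule M_eq)
  then have "1728 * \<beta> * C / Q \<le> M" using r by simp
  then show ?thesis unfolding Q_def[symmetric] using Q by (simp add: field_simps)
qed

lemma \<tau>_pos: "0 < \<tau>" "4 * \<tau> * (L + \<beta>) \<le> 1" "1 / (2 * \<tau>) = 2 * sqrt (real n) * (L + \<beta>)"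
proof -
  define D where "D = sqrt (real n) * (L + \<beta>)"
  have L\<beta>: "0 < L + \<beta>" using L_pos \<beta> by simp
  have "1 * (L + \<beta>) \<le> D" unfolding D_def using sqrt_n L\<beta> by (intro mult_right_mono) auto
  then have D: "0 < D" "L + \<beta> \<le> D" using L\<beta> by auto
  have \<tau>D: "\<tau> = 1 / (4 * D)" by (simp add: \<tau> D_def mult.assoc)
  show "0 < \<tau>" "4 * \<tau> * (L + \<beta>) \<le> 1" using D by (simp_all add: \<tau>D)
  show "1 / (2 * \<tau>) = 2 * sqrt (real n) * (L + \<beta>)" by (simp add: \<tau>D) (simp add: D_def)
qed

lemma \<tau>L: "4 * \<tau> * L \<le> 1"
proof -
  have "4 * \<tau> * L \<le> 4 * \<tau> * (L + \<beta>)" using \<tau>_pos \<beta> by (intro mult_left_mono) auto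
  then show ?thesis using \<tau>_pos by linarith
qed

sublocale sp: saddle_problem X Y "\<lambda>x y. average n f (x, y)" gx gy \<mu>x \<mu>y L
proof
  have gr: "has_gradient_on (average n f) (average n G) (X \<times> Y)"
    by (rule has_gradient_on_average[OF f_differentiable])
  show "average n f (x, y) + gx x y \<bullet> (x' - x) + \<mu>x / 2 * (norm (x' - x))\<^sup>2 \<le> average n f (x', y)"
    if "x \<in> X" "x' \<in> X" "y \<in> Y" for x x' y
    using strongly_convex_on_gradient[OF _ partial_derivative_fst[OF gr that(1,3)] that(1,2), of \<mu>x] f_strong that
    by (simp add: convex_concave_on_def inner_commute)
  show "average n f (x, y') \<le> average n f (x, y) + gy x y \<bullet> (y' - y) - \<mu>y / 2 * (norm (y' - y))\<^sup>2"
    if "x \<in> X" "y \<in> Y" "y' \<in> Y" for x y y'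
    using strongly_convex_on_gradient[OF _ has_derivative_minus[OF partial_derivative_snd[OF gr that(1,2)]] that(2,3), of \<mu>y]
      f_strong that
    by (simp add: convex_concave_on_def strongly_concave_on_def inner_commute)
  show "norm (gx x y - gx x' y', gy x y - gy x' y') \<le> L * norm (x - x', y - y')"
    if "x \<in> X" "x' \<in> X" "y \<in> Y" "y' \<in> Y" for x x' y y'
    using average_smooth_on_lipschitz[OF f_smooth n less_imp_le[OF L_pos], of "(x, y)" "(x', y')"] that
    by (simp add: minus_prod_def)
qed (use X Y \<mu> in auto)

section \<open>Saddle points of the proximal subproblems\<close>

definition prox_sp where
  "prox_sp u z \<longleftrightarrow> z \<in> X \<times> Y \<and>
    (\<forall>x'\<in>X. 0 \<le> (gx (fst z) (snd z) + \<beta> *\<^sub>R (fst z - u)) \<bullet> (x' - fst z)) \<and>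
    (\<forall>y'\<in>Y. gy (fst z) (snd z) \<bullet> (y' - snd z) \<le> 0)"

text \<open>Meaningful for every \<open>u\<close>, since extrapolated centres may leave
  \<open>X\<close>.\<close>

definition zs where "zs u = (SOME z. prox_sp u z)"
definition opt where "opt = (SOME z. sp.saddle_pt (fst z) (snd z))"

lemma prox_saddle_problem:
  "saddle_problem X Y (\<lambda>x y. average n f (x, y) + \<beta> / 2 * (norm (x - u))\<^sup>2)
    (\<lambda>x y. gx x y + \<beta> *\<^sub>R (x - u)) gy (\<mu>x + \<beta>) \<mu>y (L + \<beta>)"
  by (rule sp.prox[OF \<beta>])

text \<open>The explicit inequalities serve to compare different centres; the locale form gives
  access to growth and projection estimates.\<close>

lemma prox_sp_iff:
  "prox_sp u z \<longleftrightarrow> saddle_problem.saddle_pt X Y (\<lambda>x y. gx x y + \<beta> *\<^sub>R (x - u)) gy (fst z) (snd z)"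
proof -
  interpret P: saddle_problem X Y "\<lambda>x y. average n f (x, y) + \<beta> / 2 * (norm (x - u))\<^sup>2"
    "\<lambda>x y. gx x y + \<beta> *\<^sub>R (x - u)" gy "\<mu>x + \<beta>" \<mu>y "L + \<beta>" by (rule prox_saddle_problem)
  show ?thesis
    by (auto simp: prox_sp_def P.saddle_pt_def P.min_pt_def P.max_pt_def mem_Times_iff)
qed

lemma prox_sp_zs: "prox_sp u (zs u)"
proof -
  obtain x y where "saddle_problem.saddle_pt X Y (\<lambda>x y. gx x y + \<beta> *\<^sub>R (x - u)) gy x y"
    using saddle_problem.saddle_pt_exists[OF prox_saddle_problem[of u]] by blast
  then have "prox_sp u (x, y)" by (simp add: prox_sp_iff)
  then show ?thesis unfolding zs_def by (rule someI)
qed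

lemma zs_in: "fst (zs u) \<in> X" "snd (zs u) \<in> Y"
  using prox_sp_zs[of u] by (auto simp: prox_sp_def)

lemma zs_saddle: "saddle_problem.saddle_pt X Y (\<lambda>x y. gx x y + \<beta> *\<^sub>R (x - u)) gy (fst (zs u)) (snd (zs u))"
  using prox_sp_zs by (simp add: prox_sp_iff)

lemma opt: "sp.saddle_pt (fst opt) (snd opt)"
proof -
  obtain x y where "sp.saddle_pt (fst (x, y)) (snd (x, y))" using sp.saddle_pt_exists by auto
  then show ?thesis unfolding opt_def by (rule someI)
qed

lemma opt_in: "fst opt \<in> X" "snd opt \<in> Y"
  using sp.saddle_pt_in[OF opt] by auto

lemma prox_sp_opt: "prox_sp (fst opt) opt"
  using opt by (auto simp: prox_sp_def sp.saddle_pt_def sp.min_pt_def sp.max_pt_def mem_Times_iff)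

lemma prox_sp_perturbation:
  assumes "prox_sp u z" "prox_sp u' z'"
  shows "(\<mu>x + \<beta>) * (norm (fst z - fst z'))\<^sup>2 + \<mu>y * (norm (snd z - snd z'))\<^sup>2
    \<le> \<beta> * ((u - u') \<bullet> (fst z - fst z'))"
  using assms by (intro sp.prox_saddle_perturbation) (auto simp: prox_sp_def)

text \<open>Completing the square in \<open>fst z - fst z'\<close> produces the quarter. The factor
  \<beta> records that the target barely moves when the proximal term is weak.\<close>

lemma prox_sp_dist:
  assumes "prox_sp u z" "prox_sp u' z'"
  shows "(norm (z - z'))\<^sup>2 \<le> \<beta> / (4 * m) * (norm (u - u'))\<^sup>2"
proof -
  let ?dx = "fst z - fst z'" and ?dy = "snd z - snd z'"
  have "m * (norm (z - z'))\<^sup>2 = m * (norm ?dx)\<^sup>2 + m * (norm ?dy)\<^sup>2"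
    by (simp add: norm_prod_def distrib_left)
  also have "\<dots> \<le> \<mu>x * (norm ?dx)\<^sup>2 + \<mu>y * (norm ?dy)\<^sup>2"
    by (intro add_mono mult_right_mono m_le) auto
  also have "\<dots> \<le> \<beta> * ((u - u') \<bullet> ?dx - (norm ?dx)\<^sup>2)"
    using prox_sp_perturbation[OF assms] by (simp add: algebra_simps)
  also have "\<dots> \<le> \<beta> * ((norm (u - u'))\<^sup>2 / 4)"
  proof (intro mult_left_mono \<beta>)
    have "0 \<le> (norm (?dx - (1 / 2) *\<^sub>R (u - u')))\<^sup>2" by simp
    then show "(u - u') \<bullet> ?dx - (norm ?dx)\<^sup>2 \<le> (norm (u - u'))\<^sup>2 / 4"
      unfolding norm_diff_scaleR_sq by (simp add: power2_eq_square)
  qed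
  finally show ?thesis using m_pos by (simp add: field_simps)
qed

lemma prox_sp_fst_dist:
  assumes "prox_sp u z" "prox_sp u' z'"
  shows "norm (fst z - fst z') \<le> \<beta> / (\<mu>x + \<beta>) * norm (u - u')"
proof -
  have "0 \<le> \<mu>y * (norm (snd z - snd z'))\<^sup>2" using \<mu> by simp
  then have "(\<mu>x + \<beta>) * (norm (fst z - fst z'))\<^sup>2 \<le> \<beta> * ((u - u') \<bullet> (fst z - fst z'))"
    using prox_sp_perturbation[OF assms] by linarith
  also have "\<dots> \<le> \<beta> * (norm (u - u') * norm (fst z - fst z'))"
    by (intro mult_left_mono \<beta> norm_cauchy_schwarz)
  finally have "(\<mu>x + \<beta>) * norm (fst z - fst z') * norm (fst z - fst z') \<le> \<beta> * norm (u - u') * norm (fst z - fst z')"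
    by (simp add: power2_eq_square mult.assoc)
  then have "(\<mu>x + \<beta>) * norm (fst z - fst z') \<le> \<beta> * norm (u - u')"
    using \<beta> by (cases "norm (fst z - fst z') = 0") (auto simp: mult_le_cancel_right)
  then show ?thesis using \<mu> \<beta> by (simp add: pos_le_divide_eq mult.commute)
qed

text \<open>The \<open>x\<close> part is nonexpansive and the \<open>y\<close> part follows the
  Lipschitz maximiser; this is the source of \<open>(L / \<mu>y)\<^sup>2\<close> in
  \<open>EG_step_S\<close>.\<close>

lemma zs_opt_dist: "(norm (zs u - opt))\<^sup>2 \<le> 2 * (L / \<mu>y)\<^sup>2 * (norm (u - fst opt))\<^sup>2"
proof -
  let ?dx = "fst (zs u) - fst opt" and ?dy = "snd (zs u) - snd opt"
  have "norm ?dx \<le> \<beta> / (\<mu>x + \<beta>) * norm (u - fst opt)"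
    by (rule prox_sp_fst_dist[OF prox_sp_zs prox_sp_opt])
  also have "\<dots> \<le> 1 * norm (u - fst opt)" using \<mu> \<beta> by (intro mult_right_mono) auto
  finally have 1: "norm ?dx \<le> norm (u - fst opt)" by simp
  have "norm ?dy \<le> L / \<mu>y * norm ?dx"
    using prox_sp_zs[of u] prox_sp_opt
    by (intro sp.max_pt_lipschitz) (auto simp: prox_sp_def sp.max_pt_def)
  then have "(norm ?dy)\<^sup>2 \<le> (L / \<mu>y * norm ?dx)\<^sup>2" by (intro power_mono) auto
  then have 2: "(norm ?dy)\<^sup>2 \<le> (L / \<mu>y)\<^sup>2 * (norm ?dx)\<^sup>2" by (simp only: power_mult_distrib)
  have k: "1 \<le> (L / \<mu>y)\<^sup>2" using \<mu> by (intro one_le_power) auto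
  have "(norm (zs u - opt))\<^sup>2 = 1 * (norm ?dx)\<^sup>2 + (norm ?dy)\<^sup>2" by (simp add: norm_prod_def)
  also have "\<dots> \<le> (L / \<mu>y)\<^sup>2 * (norm ?dx)\<^sup>2 + (L / \<mu>y)\<^sup>2 * (norm ?dx)\<^sup>2"
    using 2 k by (intro add_mono mult_right_mono) auto
  also have "\<dots> = 2 * (L / \<mu>y)\<^sup>2 * (norm ?dx)\<^sup>2" by simp
  also have "\<dots> \<le> 2 * (L / \<mu>y)\<^sup>2 * (norm (u - fst opt))\<^sup>2"
    using 1 by (intro mult_left_mono power_mono) auto
  finally show ?thesis .
qed

section \<open>The two potentials\<close>

definition S where "S x u = accel_potential sp.phi \<mu>x \<theta> (fst opt) x u"
definition W where "W x y u = (norm ((x, y) - zs u))\<^sup>2"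

text \<open>\<open>u\<close> is a convex combination of \<open>x\<close> and the auxiliary point
  \<open>v\<close>. Growth of \<open>phi\<close> controls the distance of \<open>x\<close>, the
  quadratic term of \<open>S\<close> that of \<open>v\<close>.\<close>

lemma dist_le_S:
  assumes x: "x \<in> X"
  shows "(norm (u - fst opt))\<^sup>2 \<le> 2 / \<mu>x * S x u"
proof -
  let ?xs = "fst opt"
  define v where "v = (1 / \<theta>) *\<^sub>R ((1 + \<theta>) *\<^sub>R u - x)"
  define A where "A = (norm (x - ?xs))\<^sup>2"
  define B where "B = (norm (?xs - v))\<^sup>2"
  have \<theta>0: "0 < \<theta>" "\<theta> \<le> 1" by (rule \<theta>)+
  have "(1 + \<theta>) *\<^sub>R (u - ?xs) = (x - ?xs) - \<theta> *\<^sub>R (?xs - v)"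
    using \<theta>0 by (simp add: v_def scaleR_diff_right) (simp add: algebra_simps)
  then have "(1 + \<theta>)\<^sup>2 * (norm (u - ?xs))\<^sup>2 = (norm ((x - ?xs) - \<theta> *\<^sub>R (?xs - v)))\<^sup>2"
    using \<theta>0 by (metis abs_of_nonneg add_nonneg_nonneg less_imp_le norm_scaleR power_mult_distrib zero_le_one)
  also have "\<dots> \<le> (1 + \<theta>) * (A + \<theta> * B)"
  proof -
    have "0 \<le> \<theta> * (norm ((x - ?xs) - (- 1) *\<^sub>R (?xs - v)))\<^sup>2" using \<theta>0 by simp
    then show ?thesis unfolding norm_diff_scaleR_sq A_def B_def by (simp add: algebra_simps power2_eq_square)
  qed
  also have "\<dots> \<le> (1 + \<theta>) * ((1 + \<theta>) * (A + B))"
    using \<theta>0 by (intro mult_left_mono) (auto simp: algebra_simps A_def B_def)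
  finally have "(1 + \<theta>)\<^sup>2 * (norm (u - ?xs))\<^sup>2 \<le> (1 + \<theta>)\<^sup>2 * (A + B)" by (simp add: power2_eq_square mult.assoc)
  then have "(norm (u - ?xs))\<^sup>2 \<le> A + B" using \<theta>0 by (simp add: mult_le_cancel_left)
  moreover have "\<mu>x / 2 * (A + B) \<le> S x u"
    using sp.phi_growth[OF opt x] by (simp add: S_def accel_potential_def A_def B_def v_def distrib_left)
  ultimately have "\<mu>x / 2 * (norm (u - ?xs))\<^sup>2 \<le> S x u"
    using \<mu> by (meson half_gt_zero less_imp_le mult_left_mono order_trans)
  then show ?thesis using \<mu> by (simp add: field_simps)
qed

lemma phi_le_S: "sp.phi x - sp.phi (fst opt) \<le> S x u"
  using \<mu> by (simp add: S_def accel_potential_def)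

lemma prox_value_growth:
  assumes x: "x \<in> X"
  shows "sp.phi (fst (zs u)) + \<beta> / 2 * (norm (fst (zs u) - u))\<^sup>2 + (\<mu>x + \<beta>) / 2 * (norm (x - fst (zs u)))\<^sup>2
    \<le> sp.phi x + \<beta> / 2 * (norm (x - u))\<^sup>2"
proof -
  interpret P: saddle_problem X Y "\<lambda>x y. average n f (x, y) + \<beta> / 2 * (norm (x - u))\<^sup>2"
    "\<lambda>x y. gx x y + \<beta> *\<^sub>R (x - u)" gy "\<mu>x + \<beta>" \<mu>y "L + \<beta>" by (rule prox_saddle_problem)
  show ?thesis
    using P.phi_growth[OF zs_saddle x] sp.prox_phi[OF \<beta> x, of u] sp.prox_phi[OF \<beta> zs_in(1)[of u], of u] by simp
qed

text \<open>\<open>(xt, yt)\<close> stands for any inner result and \<open>d\<close> for its squared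
  error. The estimates that follow are deterministic and affine in \<open>d\<close>, so randomness
  enters only through the mean of \<open>d\<close>.\<close>

definition outer_step where
  "outer_step x y u xt yt x' y' u' d \<longleftrightarrow> x \<in> X \<and> y \<in> Y \<and> xt \<in> X \<and> yt \<in> Y \<and>
    x' = closest_point X (xt - \<tau> *\<^sub>R (gx xt yt + \<beta> *\<^sub>R (xt - u))) \<and>
    y' = closest_point Y (yt + \<tau> *\<^sub>R gy xt yt) \<and>
    u' = x' + \<gamma> *\<^sub>R (x' - x) \<and>
    d = (norm (xt - fst (zs u)))\<^sup>2 + (norm (yt - snd (zs u)))\<^sup>2"

section \<open>Deterministic estimates for one outer step\<close>

context
  fixes x y u xt yt x' y' u' d
  assumes step: "outer_step x y u xt yt x' y' u' d"
begin

lemma step_conditions: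
  "x \<in> X" "xt \<in> X" "yt \<in> Y"
  "x' = closest_point X (xt - \<tau> *\<^sub>R (gx xt yt + \<beta> *\<^sub>R (xt - u)))"
  "y' = closest_point Y (yt + \<tau> *\<^sub>R gy xt yt)"
  "u' = x' + \<gamma> *\<^sub>R (x' - x)"
  "d = (norm (xt - fst (zs u)))\<^sup>2 + (norm (yt - snd (zs u)))\<^sup>2"
  using step by (simp_all add: outer_step_def)

lemma step_in: "x' \<in> X" "y' \<in> Y"
  using X Y by (auto simp: step_conditions(4,5) intro: closest_point_in_set)

lemma step_d: "0 \<le> d" "d = (norm ((xt, yt) - zs u))\<^sup>2"
  by (auto simp: step_conditions(7) norm_prod_def)

lemma step_dist: "(norm ((x', y') - zs u))\<^sup>2 \<le> 17 / 16 * d"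
  using saddle_problem.projected_step_dist[OF prox_saddle_problem zs_saddle step_conditions(2,3) \<tau>_pos(1,2) step_conditions(4,5)]
  by (simp add: step_conditions(7) norm_prod_def)

lemma step_phi:
  "sp.phi x' + \<beta> / 2 * (norm (x' - u))\<^sup>2 \<le> sp.phi (fst (zs u)) + \<beta> / 2 * (norm (fst (zs u) - u))\<^sup>2 + C * d"
proof -
  interpret P: saddle_problem X Y "\<lambda>x y. average n f (x, y) + \<beta> / 2 * (norm (x - u))\<^sup>2"
    "\<lambda>x y. gx x y + \<beta> *\<^sub>R (x - u)" gy "\<mu>x + \<beta>" \<mu>y "L + \<beta>" by (rule prox_saddle_problem)
  have "P.phi x' - P.phi (fst (zs u)) \<le> (2 * (L + \<beta>)\<^sup>2 / \<mu>y + 1 / (2 * \<tau>)) * d"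
    unfolding step_conditions(7)
    by (rule P.phi_projected_step[OF zs_saddle step_conditions(2,3) \<tau>_pos(1,2) step_conditions(4)])
  also have "\<dots> \<le> C * d"
  proof (intro mult_right_mono step_d)
    have "0 \<le> (L + \<beta>)\<^sup>2 / \<mu>y" using \<mu> by simp
    then show "2 * (L + \<beta>)\<^sup>2 / \<mu>y + 1 / (2 * \<tau>) \<le> C" unfolding C_ge[symmetric] \<tau>_pos(3) by simp
  qed
  finally show ?thesis 
    using sp.prox_phi[OF \<beta> step_in(1), of u] sp.prox_phi[OF \<beta> zs_in(1)[of u], of u] by linarith
qed

text \<open>As the proximal term does not involve \<open>y\<close>, the point \<open>y'\<close> is
  also a projected ascent step for \<open>f\<close>, comparable with \<open>opt\<close> directly;
  the distance to \<open>opt\<close> is then split at \<open>zs u\<close>.\<close>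

lemma step_psi: "sp.psi (snd opt) - sp.psi y' \<le> 2 * K * (2 * d + 2 * (norm (zs u - opt))\<^sup>2)"
proof -
  have K: "0 \<le> K" using \<mu> \<beta> by (simp add: K_def)
  have "sp.psi (snd opt) - sp.psi y' \<le> (2 * L\<^sup>2 / \<mu>x + 1 / (2 * \<tau>)) * ((norm (xt - fst opt))\<^sup>2 + (norm (yt - snd opt))\<^sup>2)"
    by (rule sp.psi_projected_step[OF opt step_conditions(2,3) \<tau>_pos(1) \<tau>L step_conditions(5)])
  also have "2 * L\<^sup>2 / \<mu>x + 1 / (2 * \<tau>) = 2 * K" unfolding \<tau>_pos(3) by (simp add: K_def power2_eq_square)
  also have "(norm (xt - fst opt))\<^sup>2 + (norm (yt - snd opt))\<^sup>2 = (norm ((xt, yt) - opt))\<^sup>2" by (simp add: norm_prod_def)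
  also have "2 * K * \<dots> \<le> 2 * K * (2 * d + 2 * (norm (zs u - opt))\<^sup>2)"
    using norm_diff_sq_le[of 1 "(xt, yt)" opt "zs u"] K by (intro mult_left_mono) (auto simp: step_d)
  finally show ?thesis .
qed

lemma step_S:
  assumes s: "0 < s" "s \<le> 1"
  shows "(1 - s) * S x' u' \<le> (1 - \<theta>) * S x u + C * d / s"
proof -
  let ?xs = "fst opt"
  define c where "c = \<theta> *\<^sub>R ?xs + (1 - \<theta>) *\<^sub>R x"
  have c: "c \<in> X" using X(2) \<theta> opt_in step_conditions(1) by (auto simp: c_def intro: convexD)
  show ?thesis
    unfolding S_def
  proof (rule accel_potential_step[OF \<theta>(1,2) \<mu>(1) \<beta> \<theta>(3) s c_def step_conditions(6)[unfolded \<gamma>_def]])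
    show "sp.phi c \<le> \<theta> * sp.phi ?xs + (1 - \<theta>) * sp.phi x - \<mu>x / 2 * \<theta> * (1 - \<theta>) * (norm (?xs - x))\<^sup>2"
      unfolding c_def using \<theta> by (intro sp.phi_strongly_convex opt_in step_conditions) auto
    have "0 \<le> \<mu>x / 2 * (norm (x' - ?xs))\<^sup>2" using \<mu> by simp
    then show "sp.phi ?xs \<le> sp.phi x'" using sp.phi_growth[OF opt step_in(1)] by linarith
  qed (use prox_value_growth c step_in step_phi in auto)
qed

text \<open>The new warm-start error consists of the error of the last solve and the motion of the
  target from \<open>zs u\<close> to \<open>zs u'\<close>, each doubled by Young's
  inequality.\<close>

lemma step_W: "W x' y' u' \<le> 17 / 8 * d + \<beta> / (2 * m) * (norm (u - u'))\<^sup>2"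
  using norm_diff_sq_le[of 1 "(x', y')" "zs u'" "zs u"] step_dist prox_sp_dist[OF prox_sp_zs prox_sp_zs, of u u']
  by (simp add: W_def)

lemma step_W_opt: "W x' y' u' \<le> 17 / 8 * d + \<beta> / m * ((norm (u - fst opt))\<^sup>2 + (norm (u' - fst opt))\<^sup>2)"
proof -
  have "\<beta> / (2 * m) * (norm (u - u'))\<^sup>2 \<le> \<beta> / (2 * m) * (2 * (norm (u - fst opt))\<^sup>2 + 2 * (norm (u' - fst opt))\<^sup>2)"
    using norm_diff_sq_le[of 1 u u' "fst opt"] \<beta> m_pos
    by (intro mult_left_mono) (auto simp: norm_minus_commute)
  also have "\<dots> = \<beta> / m * ((norm (u - fst opt))\<^sup>2 + (norm (u' - fst opt))\<^sup>2)"
    using m_pos by (simp add: field_simps)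
  finally show ?thesis using step_W by linarith
qed

text \<open>The new potential stands on the left because \<open>expectation_step\<close> allows only
  the old state and \<open>d\<close> on the right; \<open>EW_step_S\<close> moves it back after
  taking expectations.\<close>

lemma step_W_S: "W x' y' u' - 2 * \<beta> / (m * \<mu>x) * S x' u' \<le> 2 * \<beta> / (m * \<mu>x) * S x u + 17 / 8 * d"
proof -
  have "\<beta> / m * ((norm (u - fst opt))\<^sup>2 + (norm (u' - fst opt))\<^sup>2) \<le> \<beta> / m * (2 / \<mu>x * S x u + 2 / \<mu>x * S x' u')"
    using \<beta> m_pos by (intro mult_left_mono add_mono dist_le_S step_conditions step_in) auto
  also have "\<dots> = 2 * \<beta> / (m * \<mu>x) * S x u + 2 * \<beta> / (m * \<mu>x) * S x' u'"
    by (simp add: algebra_simps)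
  finally show ?thesis using step_W_opt by linarith
qed

lemma step_x: "(norm (x' - fst opt))\<^sup>2 \<le> 2 * (\<beta> / (\<mu>x + \<beta>))\<^sup>2 * (norm (u - fst opt))\<^sup>2 + 17 / 8 * d"
proof -
  have "norm (x' - fst (zs u)) \<le> norm ((x', y') - zs u)"
    by (metis fst_conv fst_diff norm_fst_le prod.collapse)
  then have "(norm (x' - fst (zs u)))\<^sup>2 \<le> 17 / 16 * d"
    using step_dist by (meson norm_ge_zero order_trans power_mono)
  moreover have "(norm (fst (zs u) - fst opt))\<^sup>2 \<le> (\<beta> / (\<mu>x + \<beta>) * norm (u - fst opt))\<^sup>2"
    by (intro power_mono prox_sp_fst_dist[OF prox_sp_zs prox_sp_opt]) auto
  ultimately show ?thesis
    using norm_diff_sq_le[of 1 x' "fst opt" "fst (zs u)"] by (simp add: power_mult_distrib power_divide)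
qed

text \<open>Convexity of the square with weights \<open>1 + \<gamma>\<close> and
  \<open>\<gamma>\<close>. One \<open>\<gamma>\<close> is kept on the old distance, where
  \<open>\<gamma> \<le> r\<close> later supplies a power of \<open>r\<close>.\<close>

lemma step_u: "(norm (u' - fst opt))\<^sup>2 \<le> 3 * (2 * (norm (x' - fst opt))\<^sup>2 + \<gamma> * (norm (x - fst opt))\<^sup>2)"
proof -
  let ?a = "x' - fst opt" and ?b = "x - fst opt"
  have "(norm (u' - fst opt))\<^sup>2 = (norm ((1 + \<gamma>) *\<^sub>R ?a - \<gamma> *\<^sub>R ?b))\<^sup>2"
    by (simp add: step_conditions(6) algebra_simps)
  also have "\<dots> \<le> (1 + 2 * \<gamma>) * ((1 + \<gamma>) * (norm ?a)\<^sup>2 + \<gamma> * (norm ?b)\<^sup>2)"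
  proof -
    have "0 \<le> \<gamma> * (1 + \<gamma>) * (norm (?a - (- 1) *\<^sub>R ?b))\<^sup>2" using \<gamma> by simp
    then show ?thesis unfolding norm_diff_scaleR_sq
      by (simp add: power_mult_distrib) (simp add: algebra_simps power2_eq_square)
  qed
  also have "\<dots> \<le> 3 * (2 * (norm ?a)\<^sup>2 + \<gamma> * (norm ?b)\<^sup>2)"
    using \<gamma>(1,2) by (intro mult_mono add_mono mult_right_mono add_nonneg_nonneg mult_nonneg_nonneg) auto
  finally show ?thesis .
qed

end

section \<open>Expectation of one outer step\<close>

lemma lsvre_contraction:
  fixes x y u
  assumes x: "x \<in> X" and y: "y \<in> Y"
  defines "A \<equiv> lsvre (X \<times> Y) n (\<lambda>i. prox_grad \<beta> u (G i)) (x, y) \<tau> p T"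
  shows "measure_pmf.expectation A (\<lambda>z. (norm (z - zs u))\<^sup>2) \<le> W x y u / (4 * M)"
    and "\<And>z. z \<in> set_pmf A \<Longrightarrow> z \<in> X \<times> Y"
proof -
  define \<mu>' where "\<mu>' = min (\<mu>x + \<beta>) \<mu>y"
  define sn where "sn = sqrt (real n)"
  have \<mu>': "0 < \<mu>'" using \<mu> \<beta> by (simp add: \<mu>'_def)
  have sn: "1 \<le> sn" "sn\<^sup>2 = real n" using sqrt_n by (simp_all add: sn_def)
  have L\<beta>: "0 < L + \<beta>" using L_pos \<beta> by simp
  have \<tau>sn: "\<tau> = 1 / (4 * sn * (L + \<beta>))" by (simp add: \<tau> sn_def)
  interpret P: saddle_problem X Y "\<lambda>x y. average n f (x, y) + \<beta> / 2 * (norm (x - u))\<^sup>2"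
    "\<lambda>x y. gx x y + \<beta> *\<^sub>R (x - u)" gy "\<mu>x + \<beta>" \<mu>y "L + \<beta>" by (rule prox_saddle_problem)
  interpret Q: lsvre_problem "X \<times> Y" n "\<lambda>i. prox_grad \<beta> u (G i)" "L + \<beta>" \<mu>' \<tau> p "zs u"
  proof
    show "average_smooth_on (X \<times> Y) n (L + \<beta>) (\<lambda>i. prox_grad \<beta> u (G i))"
      using L_pos \<beta> by (intro average_smooth_on_prox f_smooth n) auto
    have "\<tau> * (L + \<beta>) = 1 / (4 * sn)" using L\<beta> by (simp add: \<tau>sn)
    then have "\<tau>\<^sup>2 * (L + \<beta>)\<^sup>2 = (1 / (4 * sn))\<^sup>2" by (metis power_mult_distrib)
    then show "\<tau>\<^sup>2 * (L + \<beta>)\<^sup>2 \<le> p / 8" using sn by (simp add: p power_divide power_mult_distrib)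
    show "\<mu>' * (norm (z - zs u))\<^sup>2 \<le> saddle_op (average n (\<lambda>i. prox_grad \<beta> u (G i))) z \<bullet> (z - zs u)"
      if z: "z \<in> X \<times> Y" for z
    proof -
      let ?dx = "fst z - fst (zs u)" and ?dy = "snd z - snd (zs u)"
      have "\<mu>' * (norm (z - zs u))\<^sup>2 = \<mu>' * (norm ?dx)\<^sup>2 + \<mu>' * (norm ?dy)\<^sup>2"
        by (simp add: norm_prod_def distrib_left)
      also have "\<dots> \<le> (\<mu>x + \<beta>) * (norm ?dx)\<^sup>2 + \<mu>y * (norm ?dy)\<^sup>2"
        by (intro add_mono mult_right_mono) (auto simp: \<mu>'_def)
      also have "\<dots> \<le> (gx (fst z) (snd z) + \<beta> *\<^sub>R (fst z - u)
            - (gx (fst (zs u)) (snd (zs u)) + \<beta> *\<^sub>R (fst (zs u) - u))) \<bullet> ?dx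
          - (gy (fst z) (snd z) - gy (fst (zs u)) (snd (zs u))) \<bullet> ?dy"
        using z zs_in by (intro P.strongly_monotone) auto
      also have "\<dots> \<le> (gx (fst z) (snd z) + \<beta> *\<^sub>R (fst z - u)) \<bullet> ?dx - gy (fst z) (snd z) \<bullet> ?dy"
      proof -
        have "0 \<le> (gx (fst (zs u)) (snd (zs u)) + \<beta> *\<^sub>R (fst (zs u) - u)) \<bullet> ?dx"
          "gy (fst (zs u)) (snd (zs u)) \<bullet> ?dy \<le> 0"
          using prox_sp_zs[of u] z by (auto simp: prox_sp_def)
        then show ?thesis by (simp add: inner_diff_left)
      qed
      also have "\<dots> = saddle_op (average n (\<lambda>i. prox_grad \<beta> u (G i))) z \<bullet> (z - zs u)"
        unfolding average_prox_grad[OF n] by (simp add: saddle_op_def prox_grad_def inner_prod_def)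
      finally show ?thesis .
    qed
    show "zs u \<in> X \<times> Y" using zs_in by (simp add: mem_Times_iff)
  qed (use X Y n \<mu>' \<tau>_pos p in \<open>auto simp: closed_Times convex_Times\<close>)
  have rate: "Q.rate = 1 / (4 * (real n + 2 * sn * (L + \<beta>) / \<mu>'))"
    unfolding Q.rate_def using \<mu>' L\<beta> sn by (simp add: \<tau>sn distrib_left mult_ac)
  \<comment> \<open>\<open>T\<close> is at least \<open>ln (12 * M) / rate\<close>, and
    \<open>1 - rate \<le> exp (- rate)\<close>. The 12 is the 3 of \<open>lsvre_expectation\<close>
    times the desired 4.\<close>
  have "3 * (1 - Q.rate) ^ T \<le> 1 / (4 * M)"
  proof -
    have "ln (12 * M) / Q.rate = 4 * (real n + 2 * sqrt (real n) * (L + \<beta>) / min (\<mu>x + \<beta>) \<mu>y) * ln (12 * M)"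
      unfolding rate by (simp add: \<mu>'_def sn_def mult.commute)
    then have "ln (12 * M) / Q.rate \<le> real T"
      unfolding T using real_nat_ceiling_ge by simp
    then have "ln (12 * M) \<le> Q.rate * real T"
      using Q.rate_bounds by (simp add: field_simps)
    have "(1 - Q.rate) ^ T \<le> exp (- Q.rate) ^ T"
      using Q.rate_bounds exp_ge_add_one_self[of "- Q.rate"] by (intro power_mono) auto
    also have "\<dots> = exp (- (Q.rate * real T))" by (simp add: exp_of_nat_mult[symmetric] mult.commute)
    also have "\<dots> \<le> exp (- ln (12 * M))" using \<open>ln (12 * M) \<le> Q.rate * real T\<close> by simp
    also have "\<dots> = 1 / (12 * M)" using M_pos by (simp add: exp_minus inverse_eq_divide)
    finally show ?thesis by simp
  qed
  then have "3 * (1 - Q.rate) ^ T * (norm ((x, y) - zs u))\<^sup>2 \<le> 1 / (4 * M) * (norm ((x, y) - zs u))\<^sup>2"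
    by (intro mult_right_mono) auto
  then show "measure_pmf.expectation A (\<lambda>z. (norm (z - zs u))\<^sup>2) \<le> W x y u / (4 * M)"
    using Q.lsvre_expectation[of "(x, y)" T] x y by (simp add: A_def W_def)
  show "z \<in> set_pmf A \<Longrightarrow> z \<in> X \<times> Y" for z
    using Q.set_lsvre[of "(x, y)" z T] x y by (simp add: A_def)
qed

lemma alsvre_step_eq:
  "alsvre_step X Y n G \<beta> q p \<tau> T (x, y, u) =
    lsvre (X \<times> Y) n (\<lambda>i. prox_grad \<beta> u (G i)) (x, y) \<tau> p T \<bind> (\<lambda>z.
      let x' = closest_point X (fst z - \<tau> *\<^sub>R (gx (fst z) (snd z) + \<beta> *\<^sub>R (fst z - u)));
          y' = closest_point Y (snd z + \<tau> *\<^sub>R gy (fst z) (snd z))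
      in return_pmf (x', y', x' + \<gamma> *\<^sub>R (x' - x)))"
  by (simp add: alsvre_step_def prox_grad_def \<gamma>_def \<theta>_def Let_def)

lemma alsvre_step_expectation:
  assumes x: "x \<in> X" and y: "y \<in> Y" and b: "0 \<le> b"
    and h: "\<And>xt yt x' y' u' d. outer_step x y u xt yt x' y' u' d \<Longrightarrow> h (x', y', u') \<le> a + b * d"
  shows "measure_pmf.expectation (alsvre_step X Y n G \<beta> q p \<tau> T (x, y, u)) h \<le> a + b * (W x y u / (4 * M))"
proof -
  define A where "A = lsvre (X \<times> Y) n (\<lambda>i. prox_grad \<beta> u (G i)) (x, y) \<tau> p T"
  have fin: "finite (set_pmf A)" 
    unfolding A_def lsvre_def set_map_pmf by (intro finite_imageI finite_set_lsvre_state n)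
  have "measure_pmf.expectation (alsvre_step X Y n G \<beta> q p \<tau> T (x, y, u)) h \<le>
      measure_pmf.expectation A (\<lambda>z. a + b * (norm (z - zs u))\<^sup>2)"
    unfolding alsvre_step_eq A_def[symmetric]
  proof (rule expectation_bind_le[OF fin])
    fix z assume "z \<in> set_pmf A"
    then have "z \<in> X \<times> Y" using lsvre_contraction(2)[OF x y] by (simp add: A_def)
    then have "outer_step x y u (fst z) (snd z)
        (closest_point X (fst z - \<tau> *\<^sub>R (gx (fst z) (snd z) + \<beta> *\<^sub>R (fst z - u))))
        (closest_point Y (snd z + \<tau> *\<^sub>R gy (fst z) (snd z)))
        (closest_point X (fst z - \<tau> *\<^sub>R (gx (fst z) (snd z) + \<beta> *\<^sub>R (fst z - u))) + \<gamma> *\<^sub>R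
          (closest_point X (fst z - \<tau> *\<^sub>R (gx (fst z) (snd z) + \<beta> *\<^sub>R (fst z - u))) - x))
        ((norm (z - zs u))\<^sup>2)"
      using x y by (auto simp: outer_step_def norm_prod_def)
    from h[OF this] show "measure_pmf.expectation (let x' = closest_point X (fst z - \<tau> *\<^sub>R (gx (fst z) (snd z) + \<beta> *\<^sub>R (fst z - u)));
          y' = closest_point Y (snd z + \<tau> *\<^sub>R gy (fst z) (snd z))
      in return_pmf (x', y', x' + \<gamma> *\<^sub>R (x' - x))) h \<le> a + b * (norm (z - zs u))\<^sup>2"
      by (simp add: Let_def)
  qed (auto simp: Let_def)
  also have "\<dots> = a + b * measure_pmf.expectation A (\<lambda>z. (norm (z - zs u))\<^sup>2)"
    by (simp add: integrable_measure_pmf_finite[OF fin])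
  also have "\<dots> \<le> a + b * (W x y u / (4 * M))"
    using lsvre_contraction(1)[OF x y] b by (intro add_left_mono mult_left_mono) (auto simp: A_def)
  finally show ?thesis .
qed

end

section \<open>Expectations along the run\<close>

locale alsvre_run = alsvre_problem +
  fixes x0 y0
  assumes x0: "x0 \<in> X" and y0: "y0 \<in> Y"
begin

abbreviation "state k \<equiv> alsvre_state X Y n G (x0, y0) \<beta> q p (\<lambda>_. \<tau>) (\<lambda>_. T) k"
abbreviation "\<E> k h \<equiv> measure_pmf.expectation (state k) h"

lemma state_in: "(x, y, u) \<in> set_pmf (state k) \<Longrightarrow> x \<in> X \<and> y \<in> Y"
proof (induction k arbitrary: x y u)
  case (Suc k)
  have "closest_point X a \<in> X" "closest_point Y b \<in> Y" for a b
    using X Y by (auto intro: closest_point_in_set)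
  then show ?case using Suc by (auto simp: alsvre_step_def Let_def)
qed (use x0 y0 in auto)

lemma integrable_state: "integrable (state k) (h :: 'a \<times> 'b \<times> 'a \<Rightarrow> real)"
  by (intro integrable_measure_pmf_finite finite_set_alsvre_state n)

text \<open>Given the state, the mean of \<open>d\<close> is at most
  \<open>W x y u / (4 * M)\<close>. Every recursion below is an instance of this and of one
  deterministic estimate.\<close>

lemma expectation_step:
  assumes b: "0 \<le> b"
    and h: "\<And>x y u xt yt x' y' u' d. outer_step x y u xt yt x' y' u' d \<Longrightarrow> h (x', y', u') \<le> a (x, y, u) + b * d"
  shows "\<E> (Suc k) h \<le> \<E> k a + b * (\<E> k (\<lambda>(x, y, u). W x y u) / (4 * M))"
proof -
  have "\<E> (Suc k) h \<le> \<E> k (\<lambda>s. a s + b * ((\<lambda>(x, y, u). W x y u) s / (4 * M)))"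
    unfolding alsvre_state.simps
  proof (rule expectation_bind_le)
    fix s assume s: "s \<in> set_pmf (state k)"
    obtain x y u where xyu: "s = (x, y, u)" by (cases s)
    show "measure_pmf.expectation (alsvre_step X Y n G \<beta> q p \<tau> T s) h \<le> a s + b * ((\<lambda>(x, y, u). W x y u) s / (4 * M))"
      using s state_in[of x y u k] unfolding xyu prod.case by (intro alsvre_step_expectation b h) auto
  qed (auto intro: finite_set_alsvre_state finite_set_alsvre_step n)
  also have "\<dots> = \<E> k a + b * (\<E> k (\<lambda>(x, y, u). W x y u) / (4 * M))"
    by (simp add: integrable_state)
  finally show ?thesis .
qed

section \<open>The duality gap and the initial values\<close>

definition "gap0 = sp.phi x0 - sp.psi y0"
definition "gap z = duality_gap X Y (average n f) z"

lemma gap_eq: "x \<in> X \<Longrightarrow> y \<in> Y \<Longrightarrow> gap (x, y) = sp.phi x - sp.psi y"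
  by (simp add: gap_def duality_gap_def sp.phi_SUP sp.psi_INF)

lemma gap_split: "x \<in> X \<Longrightarrow> y \<in> Y \<Longrightarrow>
    gap (x, y) = (sp.phi x - sp.phi (fst opt)) + (sp.psi (snd opt) - sp.psi y)"
  using sp.saddle_value[OF opt] by (simp add: gap_eq)

lemma gap0_bounds: "0 \<le> gap0" "sp.phi x0 - sp.phi (fst opt) \<le> gap0" "(norm (x0 - fst opt))\<^sup>2 \<le> 2 * gap0 / m"
proof -
  have 0: "0 \<le> \<mu>x / 2 * (norm (x0 - fst opt))\<^sup>2" "0 \<le> \<mu>y / 2 * (norm (y0 - snd opt))\<^sup>2"
    using \<mu> by auto
  have 1: "sp.phi (fst opt) + \<mu>x / 2 * (norm (x0 - fst opt))\<^sup>2 \<le> sp.phi x0"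
    "sp.psi y0 + \<mu>y / 2 * (norm (y0 - snd opt))\<^sup>2 \<le> sp.psi (snd opt)"
    by (rule sp.phi_growth[OF opt x0] sp.psi_growth[OF opt y0])+
  show "0 \<le> gap0" "sp.phi x0 - sp.phi (fst opt) \<le> gap0"
    using 0 1 sp.saddle_value[OF opt] by (auto simp: gap0_def)
  have "m / 2 * (norm (x0 - fst opt))\<^sup>2 \<le> \<mu>x / 2 * (norm (x0 - fst opt))\<^sup>2"
    using m_le by (intro mult_right_mono) auto
  also have "\<dots> \<le> gap0" using 0 1 sp.saddle_value[OF opt] by (auto simp: gap0_def)
  finally show "(norm (x0 - fst opt))\<^sup>2 \<le> 2 * gap0 / m" using m_pos by (simp add: field_simps)
qed

lemma S_0: "S x0 x0 \<le> 2 * gap0"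
proof -
  have "(1 / \<theta>) *\<^sub>R ((1 + \<theta>) *\<^sub>R x0 - x0) = x0" using \<theta> by (simp add: algebra_simps)
  then have "S x0 x0 = sp.phi x0 - sp.phi (fst opt) + \<mu>x / 2 * (norm (x0 - fst opt))\<^sup>2"
    by (simp add: S_def accel_potential_def norm_minus_commute)
  then show ?thesis using sp.phi_growth[OF opt x0] gap0_bounds by linarith
qed

text \<open>Growth bounds the distance to the first saddle point by the gap of the first subproblem.
  Its centre is \<open>x0\<close>, so the primal value there is unchanged, while the dual value can
  only rise.\<close>

lemma W_0: "W x0 y0 x0 \<le> 2 * gap0 / m"
proof -
  interpret P: saddle_problem X Y "\<lambda>x y. average n f (x, y) + \<beta> / 2 * (norm (x - x0))\<^sup>2"
    "\<lambda>x y. gx x y + \<beta> *\<^sub>R (x - x0)" gy "\<mu>x + \<beta>" \<mu>y "L + \<beta>" by (rule prox_saddle_problem)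
  have phi: "P.phi x0 = sp.phi x0" using sp.prox_phi[OF \<beta> x0, of x0] by simp
  obtain x where x: "P.min_pt y0 x" using P.min_pt_exists[OF y0] by blast
  then have "x \<in> X" by (simp add: P.min_pt_def)
  then have "sp.psi y0 \<le> average n f (x, y0)" by (rule sp.psi_le[OF y0])
  also have "\<dots> \<le> P.psi y0" using P.psi_eq[OF y0 x] \<beta> by simp
  finally have psi: "sp.psi y0 \<le> P.psi y0" .
  let ?x = "fst (zs x0)" and ?y = "snd (zs x0)"
  have "m / 2 * W x0 y0 x0 = m / 2 * (norm (x0 - ?x))\<^sup>2 + m / 2 * (norm (y0 - ?y))\<^sup>2"
    by (simp add: W_def norm_prod_def distrib_left)
  also have "\<dots> \<le> (\<mu>x + \<beta>) / 2 * (norm (x0 - ?x))\<^sup>2 + \<mu>y / 2 * (norm (y0 - ?y))\<^sup>2"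
    using m_le \<beta> by (intro add_mono mult_right_mono) auto
  also have "\<dots> \<le> P.phi x0 - P.psi y0"
    using P.phi_growth[OF zs_saddle x0] P.psi_growth[OF zs_saddle y0] P.saddle_value[OF zs_saddle] by linarith
  also have "\<dots> \<le> gap0" using phi psi by (simp add: gap0_def)
  finally show ?thesis using m_pos by (simp add: field_simps)
qed

section \<open>Recursions for the expected potentials\<close>

definition "ES k = \<E> k (\<lambda>(x, y, u). S x u)"
definition "EW k = \<E> k (\<lambda>(x, y, u). W x y u)"
definition "ED k = \<E> k (\<lambda>(x, y, u). (norm (x - fst opt))\<^sup>2)"
definition "EU k = \<E> k (\<lambda>(x, y, u). (norm (u - fst opt))\<^sup>2)"

lemma expectation_diff: "\<E> k (\<lambda>s. h s - h' s) = \<E> k h - \<E> k (h' :: _ \<Rightarrow> real)"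
  by (simp add: integrable_state)

lemma ES_step:
  assumes s: "0 < s" "s \<le> 1"
  shows "(1 - s) * ES (Suc k) \<le> (1 - \<theta>) * ES k + C / (4 * M) * EW k / s"
proof -
  have "\<E> (Suc k) (\<lambda>s'. (1 - s) * (\<lambda>(x, y, u). S x u) s') \<le>
      \<E> k (\<lambda>s'. (1 - \<theta>) * (\<lambda>(x, y, u). S x u) s') + C / s * (\<E> k (\<lambda>(x, y, u). W x y u) / (4 * M))"
    using step_S[OF _ s] C_pos s by (intro expectation_step) auto
  then show ?thesis by (simp add: ES_def EW_def mult_ac del: alsvre_state.simps)
qed

lemma EW_step_S: "EW (Suc k) \<le> 17 / 8 * EW k / (4 * M) + 2 * \<beta> / (m * \<mu>x) * (ES (Suc k) + ES k)"
proof -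
  define c where "c = 2 * \<beta> / (m * \<mu>x)"
  have "\<E> (Suc k) (\<lambda>s. (\<lambda>(x, y, u). W x y u) s - c * (\<lambda>(x, y, u). S x u) s) \<le>
      \<E> k (\<lambda>s. c * (\<lambda>(x, y, u). S x u) s) + 17 / 8 * (\<E> k (\<lambda>(x, y, u). W x y u) / (4 * M))"
    using step_W_S by (intro expectation_step) (auto simp: c_def)
  then have "EW (Suc k) - c * ES (Suc k) \<le> c * ES k + 17 / 8 * (EW k / (4 * M))"
    unfolding expectation_diff by (simp add: ES_def EW_def del: alsvre_state.simps)
  then show ?thesis unfolding c_def[symmetric] by (simp add: distrib_left)
qed

lemma EW_step_U: "EW (Suc k) \<le> 17 / 8 * EW k / (4 * M) + \<beta> / m * (EU (Suc k) + EU k)"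
proof -
  define c where "c = \<beta> / m"
  have "\<E> (Suc k) (\<lambda>s. (\<lambda>(x, y, u). W x y u) s - c * (\<lambda>(x, y, u). (norm (u - fst opt))\<^sup>2) s) \<le>
      \<E> k (\<lambda>s. c * (\<lambda>(x, y, u). (norm (u - fst opt))\<^sup>2) s) + 17 / 8 * (\<E> k (\<lambda>(x, y, u). W x y u) / (4 * M))"
  proof (intro expectation_step)
    fix x y u xt yt x' y' u' d assume "outer_step x y u xt yt x' y' u' d"
    from step_W_opt[OF this] show "(\<lambda>(x, y, u). W x y u) (x', y', u') - c * (\<lambda>(x, y, u). (norm (u - fst opt))\<^sup>2) (x', y', u')
        \<le> c * (\<lambda>(x, y, u). (norm (u - fst opt))\<^sup>2) (x, y, u) + 17 / 8 * d"
      unfolding c_def[symmetric] by (simp add: distrib_left)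
  qed simp
  then have "EW (Suc k) - c * EU (Suc k) \<le> c * EU k + 17 / 8 * (EW k / (4 * M))"
    unfolding expectation_diff by (simp add: EU_def EW_def del: alsvre_state.simps)
  then show ?thesis unfolding c_def[symmetric] by (simp add: distrib_left)
qed

lemma ED_step: "ED (Suc k) \<le> 17 / 8 * EW k / (4 * M) + 2 * (\<beta> / (\<mu>x + \<beta>))\<^sup>2 * EU k"
proof -
  have "\<E> (Suc k) (\<lambda>(x, y, u). (norm (x - fst opt))\<^sup>2) \<le>
      \<E> k (\<lambda>s. 2 * (\<beta> / (\<mu>x + \<beta>))\<^sup>2 * (\<lambda>(x, y, u). (norm (u - fst opt))\<^sup>2) s)
        + 17 / 8 * (\<E> k (\<lambda>(x, y, u). W x y u) / (4 * M))"
    using step_x by (intro expectation_step) auto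
  then show ?thesis by (simp add: ED_def EU_def EW_def del: alsvre_state.simps)
qed

lemma EU_step: "EU (Suc k) \<le> 3 * (2 * ED (Suc k) + \<gamma> * ED k)"
proof -
  have "\<E> (Suc k) (\<lambda>s. (\<lambda>(x, y, u). (norm (u - fst opt))\<^sup>2) s - 6 * (\<lambda>(x, y, u). (norm (x - fst opt))\<^sup>2) s) \<le>
      \<E> k (\<lambda>s. 3 * \<gamma> * (\<lambda>(x, y, u). (norm (x - fst opt))\<^sup>2) s) + 0 * (\<E> k (\<lambda>(x, y, u). W x y u) / (4 * M))"
  proof (intro expectation_step)
    fix x y u xt yt x' y' u' d assume "outer_step x y u xt yt x' y' u' d"
    from step_u[OF this] show "(\<lambda>(x, y, u). (norm (u - fst opt))\<^sup>2) (x', y', u') - 6 * (\<lambda>(x, y, u). (norm (x - fst opt))\<^sup>2) (x', y', u')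
        \<le> 3 * \<gamma> * (\<lambda>(x, y, u). (norm (x - fst opt))\<^sup>2) (x, y, u) + 0 * d"
      by (simp add: distrib_left)
  qed simp
  then have "EU (Suc k) - 6 * ED (Suc k) \<le> 3 * \<gamma> * ED k"
    unfolding expectation_diff by (simp add: EU_def ED_def del: alsvre_state.simps)
  then show ?thesis by (simp add: distrib_left)
qed

section \<open>From the potentials to the expected gap\<close>

definition "EG k = \<E> k (\<lambda>(x, y, u). gap (x, y))"

text \<open>The new \<open>S\<close> contains the primal gap. The dual gap goes through
  \<open>step_psi\<close>, where the distance from \<open>zs u\<close> to \<open>opt\<close> is
  charged to the old \<open>S\<close>.\<close>

lemma EG_step_S: "EG (Suc k) \<le> ES (Suc k) + 16 * (K * (L / \<mu>y)\<^sup>2 / \<mu>x) * ES k + K / M * EW k"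
proof -
  define c where "c = 16 * (K * (L / \<mu>y)\<^sup>2 / \<mu>x)"
  have K: "0 \<le> K" using \<mu> \<beta> by (simp add: K_def)
  have "\<E> (Suc k) (\<lambda>s. (\<lambda>(x, y, u). gap (x, y)) s - (\<lambda>(x, y, u). S x u) s) \<le>
      \<E> k (\<lambda>s. c * (\<lambda>(x, y, u). S x u) s) + 4 * K * (\<E> k (\<lambda>(x, y, u). W x y u) / (4 * M))"
  proof (intro expectation_step)
    fix x y u xt yt x' y' u' d assume st: "outer_step x y u xt yt x' y' u' d"
    have "2 * K * (2 * d + 2 * (norm (zs u - opt))\<^sup>2) \<le> 2 * K * (2 * d + 2 * (2 * (L / \<mu>y)\<^sup>2 * (2 / \<mu>x * S x u)))"
    proof (intro mult_left_mono add_left_mono)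
      show "(norm (zs u - opt))\<^sup>2 \<le> 2 * (L / \<mu>y)\<^sup>2 * (2 / \<mu>x * S x u)"
        using zs_opt_dist dist_le_S[OF step_conditions(1)[OF st]]
        by (meson mult_left_mono order_trans zero_le_mult_iff zero_le_numeral zero_le_power2)
    qed (use K in auto)
    also have "\<dots> = 4 * K * d + c * S x u" by (simp add: c_def algebra_simps)
    finally have "sp.psi (snd opt) - sp.psi y' \<le> 4 * K * d + c * S x u" using step_psi[OF st] by linarith
    then show "(\<lambda>(x, y, u). gap (x, y)) (x', y', u') - (\<lambda>(x, y, u). S x u) (x', y', u')
        \<le> c * (\<lambda>(x, y, u). S x u) (x, y, u) + 4 * K * d"
      using phi_le_S[of x' u'] gap_split[OF step_in[OF st]] by simp
  qed (use K in auto)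
  then have "EG (Suc k) - ES (Suc k) \<le> c * ES k + 4 * K * (EW k / (4 * M))"
    unfolding expectation_diff by (simp add: ES_def EW_def EG_def del: alsvre_state.simps)
  then show ?thesis unfolding c_def[symmetric] by simp
qed

text \<open>Here \<open>prox_sp_dist\<close> replaces \<open>zs_opt_dist\<close>, so that the whole
  coefficient of \<open>EU k\<close> is proportional to \<beta>;
  \<open>gap_bound_unaccelerated\<close> trades this for a power of \<open>r\<close>.\<close>

lemma EG_step_U: "EG (Suc k) \<le> (\<beta> / 2 + K * \<beta> / m) * EU k + (C + 4 * K) * (EW k / (4 * M))"
proof -
  define c where "c = \<beta> / 2 + K * \<beta> / m"
  have K: "0 \<le> K" using \<mu> \<beta> by (simp add: K_def)
  have "\<E> (Suc k) (\<lambda>(x, y, u). gap (x, y)) \<le>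
      \<E> k (\<lambda>s. c * (\<lambda>(x, y, u). (norm (u - fst opt))\<^sup>2) s) + (C + 4 * K) * (\<E> k (\<lambda>(x, y, u). W x y u) / (4 * M))"
  proof (intro expectation_step)
    fix x y u xt yt x' y' u' d assume st: "outer_step x y u xt yt x' y' u' d"
    let ?U = "(norm (u - fst opt))\<^sup>2"
    have "2 * K * (2 * d + 2 * (norm (zs u - opt))\<^sup>2) \<le> 2 * K * (2 * d + 2 * (\<beta> / (4 * m) * ?U))"
      using K by (intro mult_left_mono add_left_mono prox_sp_dist prox_sp_zs prox_sp_opt) auto
    also have "\<dots> = 4 * K * d + K * \<beta> / m * ?U" by (simp add: algebra_simps)
    finally have 1: "sp.psi (snd opt) - sp.psi y' \<le> 4 * K * d + K * \<beta> / m * ?U" using step_psi[OF st] by linarith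
    have "0 \<le> \<beta> / 2 * (norm (x' - u))\<^sup>2" "0 \<le> (\<mu>x + \<beta>) / 2 * (norm (fst opt - fst (zs u)))\<^sup>2"
      using \<mu> \<beta> by auto
    then have 2: "sp.phi x' - sp.phi (fst opt) \<le> \<beta> / 2 * ?U + C * d"
      using step_phi[OF st] prox_value_growth[OF opt_in(1), of u] by (simp add: norm_minus_commute)
    show "(\<lambda>(x, y, u). gap (x, y)) (x', y', u') \<le> c * (\<lambda>(x, y, u). (norm (u - fst opt))\<^sup>2) (x, y, u) + (C + 4 * K) * d"
      using 1 2 gap_split[OF step_in[OF st]] by (simp add: c_def distrib_right)
  qed (use K C_pos in auto)
  then show ?thesis by (simp add: EU_def EW_def EG_def c_def del: alsvre_state.simps)
qed

lemma init: "ES 0 = S x0 x0" "EW 0 = W x0 y0 x0" "ED 0 = (norm (x0 - fst opt))\<^sup>2" "EU 0 = (norm (x0 - fst opt))\<^sup>2"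
  by (simp_all add: ES_def EW_def ED_def EU_def)

lemma K_bounds: "1 \<le> L / \<mu>y" "1 \<le> K * (L / \<mu>y)\<^sup>2 / \<mu>x" "K / \<mu>x \<le> K * (L / \<mu>y)\<^sup>2 / \<mu>x" "0 < K"
  "\<mu>x \<le> K"
proof -
  show 1: "1 \<le> L / \<mu>y" using \<mu> by simp
  then have c: "1 \<le> (L / \<mu>y)\<^sup>2" by (rule one_le_power)
  have "1 * \<mu>x \<le> L / \<mu>x * L" using \<mu> by (intro mult_mono) auto
  moreover have "0 \<le> sqrt (real n) * (L + \<beta>)" using L_pos \<beta> by simp
  ultimately show K: "\<mu>x \<le> K" unfolding K_def by linarith
  then show "0 < K" using \<mu> by linarith
  then show 2: "K / \<mu>x \<le> K * (L / \<mu>y)\<^sup>2 / \<mu>x"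
    using c \<mu> mult_left_mono[OF c, of K] by (intro divide_right_mono) auto
  have "1 \<le> K / \<mu>x" using K \<mu> by simp
  then show "1 \<le> K * (L / \<mu>y)\<^sup>2 / \<mu>x" using 2 by linarith
qed

lemma mu_le_C: "\<mu>x \<le> C"
proof -
  have "\<mu>x * 1 \<le> (L + \<beta>) * ((L + \<beta>) / \<mu>y)" using \<mu> \<beta> by (intro mult_mono) auto
  then have "\<mu>x \<le> (L + \<beta>)\<^sup>2 / \<mu>y" by (simp add: power2_eq_square)
  moreover have "0 \<le> 2 * sqrt (real n) * (L + \<beta>)" "0 \<le> (L + \<beta>)\<^sup>2 / \<mu>y"
    using \<mu> L_pos \<beta> by auto
  moreover have "C = 7 * ((L + \<beta>)\<^sup>2 / \<mu>y) + 2 * sqrt (real n) * (L + \<beta>)"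
    using C_ge by simp
  ultimately show ?thesis by linarith
qed

lemma gap_sq: "0 < (\<theta> - \<rho>)\<^sup>2" "(\<theta> - \<rho>)\<^sup>2 \<le> 1"
  using r by (auto intro!: power_le_one)

text \<open>The three terms of \<open>EG_step_S\<close> contribute 2, 32 and 2. The middle one is
  taken one index earlier; the \<open>r\<^sup>2\<close> in the bound on \<open>S\<close> makes up
  for it.\<close>

lemma gap_bound_accelerated:
  assumes "\<mu>x \<le> 72 * \<beta>"
  shows "EG (Suc k) \<le> 36 * (K * (L / \<mu>y)\<^sup>2 / \<mu>x / (\<theta> - \<rho>)\<^sup>2 * (gap0 * r ^ Suc k))"
proof -
  define s where "s = (\<theta> - \<rho>) / (2 * r)"
  have s: "0 < s" "s \<le> 1" using r by (auto simp: s_def field_simps)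
  have rho_lt: "\<rho> < \<theta>" using r by simp
  note rec = accelerated_recursion[OF \<rho>(1) rho_lt \<theta>(2) C_pos M_pos m_pos \<mu>(1) \<beta> gap0_bounds(1) r_def s_def
      M_r M_C assms, of ES EW, unfolded init, OF S_0 W_0 ES_step[OF s] EW_step_S]
  define E where "E = gap0 * r ^ Suc k"
  define Q where "Q = K * (L / \<mu>y)\<^sup>2 / \<mu>x"
  define g where "g = (\<theta> - \<rho>)\<^sup>2"
  have g: "0 < g" "g \<le> 1" using gap_sq by (auto simp: g_def)
  have Q: "1 \<le> Q" "K / \<mu>x \<le> Q" using K_bounds by (auto simp: Q_def)
  have E: "0 \<le> E" using gap0_bounds r by (simp add: E_def)
  have QE: "Q * E \<le> Q / g * E" using g Q E by (intro mult_right_mono) (auto simp: field_simps)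
  have "ES (Suc k) \<le> 2 * r\<^sup>2 / g * E" using rec(1)[of "Suc k"] by (simp add: E_def g_def)
  also have "\<dots> \<le> 2 * Q / g * E"
  proof (intro mult_right_mono divide_right_mono E)
    have "r\<^sup>2 \<le> 1" using r by (intro power_le_one) auto
    then show "2 * r\<^sup>2 \<le> 2 * Q" using Q by linarith
  qed (use g in auto)
  finally have 1: "ES (Suc k) \<le> 2 * (Q / g * E)" by simp
  have "16 * Q * ES k \<le> 16 * Q * (2 * r\<^sup>2 / g * (gap0 * r ^ k))"
    using rec(1)[of k] Q by (intro mult_left_mono) (auto simp: g_def mult.assoc)
  also have "\<dots> = r * (32 * (Q / g * E))" by (simp add: E_def power2_eq_square)
  also have "\<dots> \<le> 1 * (32 * (Q / g * E))" using r Q g E by (intro mult_right_mono) auto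
  finally have 2: "16 * Q * ES k \<le> 32 * (Q / g * E)" by simp
  have "K / M * EW k \<le> K / M * (2 * M * gap0 / C * r ^ Suc k)"
    using rec(2)[of k] K_bounds M_pos by (intro mult_left_mono) auto
  also have "\<dots> = K / C * (2 * E)" using M_pos by (simp add: E_def)
  also have "\<dots> \<le> Q * (2 * E)"
  proof (intro mult_right_mono)
    have "K / C \<le> K / \<mu>x" using \<mu> K_bounds mu_le_C by (intro divide_left_mono) auto
    then show "K / C \<le> Q" using Q by linarith
  qed (use E in auto)
  also have "\<dots> \<le> 2 * (Q / g * E)" using QE by simp
  finally have 3: "K / M * EW k \<le> 2 * (Q / g * E)" .
  show ?thesis
    using order_trans[OF EG_step_S[of k, folded Q_def] add_mono[OF add_mono[OF 1 2] 3]]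
    unfolding Q_def[symmetric] g_def[symmetric] E_def[symmetric] by (simp add: mult_ac)
qed

text \<open>117 is 36 + 72 + 9: the two parts of the coefficient of \<open>EU k\<close>, and the
  inner error with 34/4 rounded up.\<close>

lemma gap_bound_unaccelerated:
  assumes small: "72 * \<beta> \<le> \<mu>x"
  shows "EG (Suc k) \<le> 117 * (K * (L / \<mu>y)\<^sup>2 / \<mu>x / (\<theta> - \<rho>)\<^sup>2 * (gap0 * r ^ Suc k))"
proof -
  define b where "b = \<beta> / (\<mu>x + \<beta>)"
  define A where "A = 2 * gap0 / m"
  have A: "0 \<le> A" using gap0_bounds m_pos by (simp add: A_def)
  have b0: "0 \<le> b" "b \<le> 1 / 72" using small \<mu> \<beta> by (auto simp: b_def field_simps)
  have "1 - b = \<theta>\<^sup>2" using \<mu> \<beta> \<theta>(3) by (simp add: b_def field_simps)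
  then have "b = (1 - \<theta>) * (1 + \<theta>)" by (simp add: power2_eq_square algebra_simps)
  also have "\<dots> \<le> r * 2" using \<theta> r \<rho> by (intro mult_mono) (auto simp: r_def)
  finally have br: "b \<le> 2 * r" by simp
  \<comment> \<open>\<open>EU k\<close> carries only \<open>r ^ k\<close>; through this bound the
    factor \<beta> in front of it supplies the missing \<open>r\<close>.\<close>
  have \<beta>r: "\<beta> \<le> 4 * \<mu>x * r"
  proof -
    have "\<beta> = b * (\<mu>x + \<beta>)" using \<mu> \<beta> by (simp add: b_def)
    also have "\<dots> \<le> 2 * r * (2 * \<mu>x)" using br small \<beta> b0 r by (intro mult_mono) auto
    finally show ?thesis by (simp add: mult_ac)
  qed
  have M2: "1728 * \<beta> \<le> M * (m * r\<^sup>2)"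
  proof -
    have "\<mu>x * (1728 * \<beta>) \<le> C * (1728 * \<beta>)" using mu_le_C \<beta> by (intro mult_right_mono) auto
    also have "\<dots> = 1728 * \<beta> * C" by simp
    also have "\<dots> \<le> M * (\<mu>x * m * r\<^sup>2 * (\<theta> - \<rho>)\<^sup>2)" by (rule M_C)
    also have "\<dots> \<le> M * (\<mu>x * m * r\<^sup>2 * 1)"
      using M_pos \<mu> m_pos gap_sq by (intro mult_left_mono) auto
    also have "\<dots> = \<mu>x * (M * (m * r\<^sup>2))" by simp
    finally show ?thesis using \<mu> by simp
  qed
  note rec = unaccelerated_recursion[OF r(1) less_imp_le[OF r(2)] M_pos m_pos \<beta> A b0(1) \<gamma>(1) br b0(2) \<gamma>(3) M_r M2,
      of ED EU EW, unfolded init, folded A_def, OF gap0_bounds(3)[folded A_def] gap0_bounds(3)[folded A_def]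
      W_0[folded A_def] ED_step[folded b_def] EU_step EW_step_U]
  define c where "c = L / \<mu>y"
  define E where "E = gap0 * r ^ Suc k"
  define Q where "Q = K * c\<^sup>2 / \<mu>x"
  define g where "g = (\<theta> - \<rho>)\<^sup>2"
  have g: "0 < g" "g \<le> 1" using gap_sq by (auto simp: g_def)
  have "1 \<le> c" using K_bounds by (simp add: c_def)
  then have c: "1 \<le> c" "c \<le> c\<^sup>2" using mult_left_mono[of 1 c c] by (auto simp: power2_eq_square)
  have Q: "1 \<le> Q" "K / \<mu>x \<le> Q" using K_bounds by (auto simp: Q_def c_def)
  have E: "0 \<le> E" using gap0_bounds r by (simp add: E_def)
  have mc: "\<mu>x / m \<le> c" using \<mu> by (auto simp: m_def c_def min_def field_simps intro: mult_mono)
  have "1 * c\<^sup>2 \<le> K / \<mu>x * c\<^sup>2" using K_bounds(5) \<mu> by (intro mult_right_mono) auto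
  then have c2Q: "c\<^sup>2 \<le> Q" by (simp add: Q_def)
  have U: "EU k \<le> 18 * gap0 / m * r ^ k" using rec(1)[of k] by (simp add: A_def)
  have W: "EW k / (4 * M) \<le> E / (4 * m)"
    using rec(2)[of k] M_pos m_pos by (simp add: A_def E_def field_simps)
  have \<beta>U: "\<beta> * EU k \<le> 72 * (\<mu>x / m) * E"
  proof -
    have "\<beta> * EU k \<le> \<beta> * (18 * gap0 / m * r ^ k)" using U \<beta> by (intro mult_left_mono)
    also have "\<dots> \<le> 4 * \<mu>x * r * (18 * gap0 / m * r ^ k)"
      using \<beta>r gap0_bounds m_pos r by (intro mult_right_mono) auto
    finally show ?thesis by (simp add: E_def mult_ac)
  qed
  have mcE: "\<mu>x / m * E \<le> c * E" using mc E by (intro mult_right_mono)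
  have KmE: "0 \<le> K / m" using K_bounds m_pos by simp
  have 1: "\<beta> / 2 * EU k \<le> 36 * (Q * E)"
  proof -
    have "c * E \<le> Q * E" using c c2Q E by (intro mult_right_mono) auto
    then show ?thesis using \<beta>U mcE by simp
  qed
  have Km: "K / m \<le> Q / c"
  proof -
    have "K / m = K / \<mu>x * (\<mu>x / m)" using \<mu> by simp
    also have "\<dots> \<le> K / \<mu>x * c" using mc K_bounds \<mu> by (intro mult_left_mono) auto
    also have "\<dots> = Q / c" using c by (simp add: Q_def power2_eq_square)
    finally show ?thesis .
  qed
  have 2: "K * \<beta> / m * EU k \<le> 72 * (Q * E)"
  proof -
    have "K * \<beta> / m * EU k = K / m * (\<beta> * EU k)" by simp
    also have "\<dots> \<le> K / m * (72 * (c * E))" using \<beta>U mcE KmE by (intro mult_left_mono) auto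
    also have "\<dots> \<le> Q / c * (72 * (c * E))" using Km c E by (intro mult_right_mono) auto
    also have "\<dots> = 72 * (Q * E)" using c by simp
    finally show ?thesis .
  qed
  have 3: "(C + 4 * K) * (EW k / (4 * M)) \<le> 9 * (Q * E)"
  proof -
    have Kn: "sqrt (real n) * (L + \<beta>) \<le> K" "L * L \<le> K * \<mu>x"
      using \<mu> \<beta> L_pos by (auto simp: K_def field_simps)
    \<comment> \<open>Since \<beta> is at most \<open>L\<close>,
      \<open>L + \<beta> \<le> 2 L\<close>, which makes \<open>C\<close> comparable to
      \<open>K c\<close>.\<close>
    have "C \<le> 28 * (K * c) + 2 * K"
    proof -
      have "(L + \<beta>) * (L + \<beta>) \<le> 2 * L * (2 * L)" using small \<mu> \<beta> by (intro mult_mono) auto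
      also have "\<dots> \<le> 4 * (K * \<mu>x)" using Kn by simp
      also have "\<dots> \<le> 4 * (K * L)" using \<mu> K_bounds by simp
      finally have "7 * (L + \<beta>)\<^sup>2 \<le> 28 * (K * L)" by (simp only: power2_eq_square)
      then have "7 * (L + \<beta>)\<^sup>2 / \<mu>y \<le> 28 * (K * L) / \<mu>y"
        using \<mu> by (intro divide_right_mono) auto
      then show ?thesis using Kn unfolding C_ge[symmetric] c_def by simp
    qed
    also have "\<dots> \<le> 28 * (K * c) + 2 * (K * c)" using c K_bounds by simp
    finally have "C + 4 * K \<le> 34 * (K * c)" using c K_bounds mult_left_mono[of 1 c K] by linarith
    then have "(C + 4 * K) * (EW k / (4 * M)) \<le> 34 * (K * c) * (E / (4 * m))"
      using W C_pos K_bounds E m_pos c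
      by (intro order_trans[OF mult_left_mono[OF W] mult_right_mono]) auto
    also have "\<dots> = 34 / 4 * (K / m * c * E)" by simp
    also have "\<dots> \<le> 34 / 4 * (Q / c * c * E)" using Km c E by (intro mult_left_mono mult_right_mono) auto
    also have "\<dots> \<le> 9 * (Q * E)" using c Q E by simp
    finally show ?thesis .
  qed
  have QE: "Q * E \<le> Q / g * E" using g Q E by (intro mult_right_mono) (auto simp: field_simps)
  have "EG (Suc k) \<le> \<beta> / 2 * EU k + K * \<beta> / m * EU k + (C + 4 * K) * (EW k / (4 * M))"
    using EG_step_U[of k] by (simp add: distrib_right)
  then have "EG (Suc k) \<le> 117 * (Q / g * E)"
    using 1 2 3 QE mult_nonneg_nonneg[of Q E] Q E by linarith
  then show ?thesis by (simp add: Q_def g_def E_def c_def)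
qed

end

section \<open>Conclusion: constant parameters and the two regimes\<close>

lemma alsvre_state_constant:
  assumes "\<And>k. k \<ge> 1 \<Longrightarrow> \<tau> k = t" "\<And>k. k \<ge> 1 \<Longrightarrow> T k = N"
  shows "alsvre_state X Y n G z0 \<beta> q p \<tau> T k = alsvre_state X Y n G z0 \<beta> q p (\<lambda>_. t) (\<lambda>_. N) k"
  using assms by (induction k) auto

theorem theorem3:
  fixes X :: "'a::euclidean_space set" and Y :: "'b::euclidean_space set"
    and n :: nat
    and f :: "nat \<Rightarrow> 'a \<times> 'b \<Rightarrow> real" and G :: "nat \<Rightarrow> 'a \<times> 'b \<Rightarrow> 'a \<times> 'b"
    and L \<mu>x \<mu>y \<kappa>x \<kappa>y \<beta> q p \<rho> \<Delta> :: real
    and \<tau> :: "nat \<Rightarrow> real" and T :: "nat \<Rightarrow> nat"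
    and x0 :: 'a and y0 :: 'b
  assumes X: "closed X" "convex X" and Y: "closed Y" "convex Y"
    and n: "n \<ge> 1"
    and f_differentiable: "\<And>i. i \<in> {1..n} \<Longrightarrow> has_gradient_on (f i) (G i) (X \<times> Y)"
    and f_convex: "\<And>i y. i \<in> {1..n} \<Longrightarrow> y \<in> Y \<Longrightarrow> convex_on X (\<lambda>x. f i (x, y))"
    and f_concave: "\<And>i x. i \<in> {1..n} \<Longrightarrow> x \<in> X \<Longrightarrow> concave_on Y (\<lambda>y. f i (x, y))"
    and f_smooth: "average_smooth_on (X \<times> Y) n L G"
    and f_strong: "convex_concave_on X Y \<mu>x \<mu>y (average n f)"
    and \<mu>: "\<mu>x > 0" "\<mu>y > 0" "\<mu>x \<le> L" "\<mu>y \<le> L"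
    and \<kappa>x: "\<kappa>x = L / \<mu>x" and \<kappa>y: "\<kappa>y = L / \<mu>y"
    and start: "(x0, y0) \<in> X \<times> Y"
    and \<beta>: "\<beta> \<ge> 0"
    and q: "q = \<mu>x / (\<mu>x + \<beta>)"
    and p: "p = 1 / (2 * real n)"
    and \<tau>: "\<And>k. k \<ge> 1 \<Longrightarrow> \<tau> k = 1 / (4 * sqrt (real n) * (L + \<beta>))"
    and \<rho>: "0 < \<rho>" "\<rho> < sqrt q"
    and T: "\<And>k. k \<ge> 1 \<Longrightarrow> T k = nat \<lceil>4 * (real n + 2 * sqrt (real n) * (L + \<beta>) / min (\<mu>x + \<beta>) \<mu>y) *
        ln (12 * (2 / (1 - \<rho>) +
          1728 * \<beta> * (L + \<beta>) * (7 * (L + \<beta>) + 2 * sqrt (real n) * \<mu>y) /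
          (\<mu>x * \<mu>y * min \<mu>x \<mu>y * (1 - \<rho>)\<^sup>2 * (sqrt q - \<rho>)\<^sup>2)))\<rceil>"
    and \<Delta>: "\<Delta> = duality_gap X Y (average n f) (x0, y0)"
  shows "\<forall>k\<ge>1. measure_pmf.expectation (alsvre X Y n G (x0, y0) \<beta> q p \<tau> T k)
            (duality_gap X Y (average n f))
          \<le> 916 * \<Delta> * (\<kappa>x * L + sqrt (real n) * (L + \<beta>)) * \<kappa>y\<^sup>2 /
              (\<mu>x * (sqrt q - \<rho>)\<^sup>2) * (1 - \<rho>) ^ k"
proof (intro allI impI)
  fix k :: nat
  assume "k \<ge> 1"
  then obtain j where k: "k = Suc j" by (cases k) auto
  have ne: "X \<noteq> {}" "Y \<noteq> {}" using start by auto
  have T1: "T k = T 1" if "k \<ge> 1" for k using T[OF that] T[OF order_refl] by (rule trans[OF _ sym])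
  note const_steps = alsvre_state_constant[of \<tau> _ T, OF \<tau> T1]
  interpret alsvre_run X Y n f G L \<mu>x \<mu>y \<beta> q p \<rho> "1 / (4 * sqrt (real n) * (L + \<beta>))"
    "2 / (1 - \<rho>) + 1728 * \<beta> * (L + \<beta>) * (7 * (L + \<beta>) + 2 * sqrt (real n) * \<mu>y) /
      (\<mu>x * \<mu>y * min \<mu>x \<mu>y * (1 - \<rho>)\<^sup>2 * (sqrt q - \<rho>)\<^sup>2)"
    "T 1" x0 y0
    by (unfold_locales; fact X Y ne n f_differentiable f_smooth f_strong \<mu> \<beta> q p \<rho> refl T[OF order_refl]
        start[THEN SigmaD1] start[THEN SigmaD2])
  define B where "B = K * (L / \<mu>y)\<^sup>2 / \<mu>x / (\<theta> - \<rho>)\<^sup>2 * (gap0 * r ^ Suc j)"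
  have "0 \<le> B"
    unfolding B_def using gap0_bounds(1) r K_bounds(4) \<mu> by simp
  have "alsvre_state X Y n G (x0, y0) \<beta> q p \<tau> T k = state k" by (rule const_steps)
  then have "measure_pmf.expectation (alsvre X Y n G (x0, y0) \<beta> q p \<tau> T k) (duality_gap X Y (average n f)) = EG (Suc j)"
    unfolding alsvre_def EG_def gap_def k
    by (simp add: case_prod_unfold comp_def del: alsvre_state.simps)
  \<comment> \<open>One of \<open>\<mu>x \<le> 72 * \<beta>\<close> and
    \<open>72 * \<beta> \<le> \<mu>x\<close> holds; the constants are 36 and 117.\<close>
  also have "\<dots> \<le> 117 * B"
    using gap_bound_accelerated[of j] gap_bound_unaccelerated[of j] \<open>0 \<le> B\<close>
    unfolding B_def[symmetric] by linarith
  also have "\<dots> \<le> 916 * B" using \<open>0 \<le> B\<close> by simp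
  also have "\<dots> = 916 * \<Delta> * (\<kappa>x * L + sqrt (real n) * (L + \<beta>)) * \<kappa>y\<^sup>2 / (\<mu>x * (sqrt q - \<rho>)\<^sup>2) * (1 - \<rho>) ^ k"
  proof -
    have "\<Delta> = gap0" using gap_eq[OF x0 y0] by (simp add: \<Delta> gap_def gap0_def)
    then show ?thesis by (simp add: B_def K_def \<theta>_def r_def \<kappa>x \<kappa>y k mult_ac)
  qed
  finally show "measure_pmf.expectation (alsvre X Y n G (x0, y0) \<beta> q p \<tau> T k) (duality_gap X Y (average n f))
      \<le> 916 * \<Delta> * (\<kappa>x * L + sqrt (real n) * (L + \<beta>)) * \<kappa>y\<^sup>2 / (\<mu>x * (sqrt q - \<rho>)\<^sup>2) * (1 - \<rho>) ^ k" .
qed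

end
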